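(* Let $l\ge4$ be an integer, let $G$ be a group of type $[3,3,\dots,3]$ with $l$ rotational centers of order $3$, acting on $\mathbb{H}^2$, and let $\mathcal{F}_G$ be a fundamental domain of $G$. Then, whatever the tree surface graph of $\mathcal{F}_G$ is (in particular, whatever the numbers of its rotational centers and additional points of each degree are), $$\operatorname{Area}(\mathcal{F}_G)=\left(\frac{4}{3}l-4\right)\pi.$$
   Context: $\mathbb{H}^2$ is the hyperbolic plane of curvature $-1$. For an integer $l\ge4$, a group of type $G=[3,3,\dots,3]$ ($l$ times) is a discrete group of orientation-preserving isometries of $\mathbb{H}^2$ whose quotient $\mathbb{H}^2/G$ is topologically a sphere with exactly $l$ cone points, each coming from a $G$-orbit of rotation centers with stabilizer of order $3$. A fundamental domain $\mathcal{F}_G$ of $G$ is a compact convex polygon (all interior angles at its vertices in $(0,\pi)$) whose $G$-images tile $\mathbb{H}^2$ edge-to-edge, with sides paired by elements of $G$, such that the image of the boundary of $\mathcal{F}_G$ in the sphere $\mathbb{H}^2/G$ is a tree (the tree surface graph). The vertices of the tree are the $l$ cone points (called rotational centers), each of degree at least $1$, and $w\ge0$ further points with trivial stabilizers (called additional points), each of degree at least $3$. The polygon $\mathcal{F}_G$ is recovered by cutting the sphere along this tree. A tree vertex of degree $d$ thus corresponds to $d$ vertices of $\mathcal{F}_G$, and the interior angles of $\mathcal{F}_G$ at these $d$ vertices sum to $2\pi/3$ if the tree vertex is a rotational center and to $2\pi$ if it is an additional point. *)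

theory Defs
  imports "HOL-Analysis.Analysis" "HOL-Algebra.Group_Action"
begin

section \<open>The hyperbolic plane (Beltrami-Klein model, curvature -1)\<close>

text \<open>
  The points are those of the open euclidean unit disc and the geodesics are its chords. Hence
  hyperbolic segments, convexity, convex polygons, their vertices and their sides are the euclidean
  ones. The model is not conformal: angles and area are taken with respect to the metric tensor
  below. The hyperbolic topology is the euclidean topology of the disc.
\<close>

abbreviation hyp_plane :: "(real^2) set" where
  "hyp_plane \<equiv> ball 0 1"

definition hyp_dist :: "real^2 \<Rightarrow> real^2 \<Rightarrow> real" where
  "hyp_dist x y = arcosh ((1 - x \<bullet> y) / sqrt ((1 - x \<bullet> x) * (1 - y \<bullet> y)))"

definition hyp_metric :: "real^2 \<Rightarrow> real^2 \<Rightarrow> real^2 \<Rightarrow> real" where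
  "hyp_metric x u v = (u \<bullet> v) / (1 - x \<bullet> x) + (x \<bullet> u) * (x \<bullet> v) / (1 - x \<bullet> x)\<^sup>2"

definition hyp_area_density :: "real^2 \<Rightarrow> real" where
  "hyp_area_density x =
     sqrt (hyp_metric x (axis 1 1) (axis 1 1) * hyp_metric x (axis 2 1) (axis 2 1)
           - (hyp_metric x (axis 1 1) (axis 2 1))\<^sup>2)"

lemma hyp_area_density_eq:
  assumes "x \<in> hyp_plane"
  shows "hyp_area_density x = 1 / sqrt ((1 - (norm x)\<^sup>2) ^ 3)"
proof -
  define a b r where "a = x $ 1" and "b = x $ 2" and "r = 1 - x \<bullet> x"
  have xx: "x \<bullet> x = a\<^sup>2 + b\<^sup>2"
    by (simp add: a_def b_def inner_vec_def sum_2 power2_eq_square)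
  have "(norm x)\<^sup>2 < 1"
    using assms by (simp add: abs_square_less_1)
  then have r: "r > 0" and rn: "r = 1 - (norm x)\<^sup>2"
    by (simp_all add: r_def power2_norm_eq_inner)
  have ab: "a\<^sup>2 + b\<^sup>2 = 1 - r"
    using xx r_def by simp
  have "hyp_metric x (axis 1 1) (axis 1 1) = 1 / r + a\<^sup>2 / r\<^sup>2"
       "hyp_metric x (axis 2 1) (axis 2 1) = 1 / r + b\<^sup>2 / r\<^sup>2"
       "hyp_metric x (axis 1 1) (axis 2 1) = a * b / r\<^sup>2"
    unfolding hyp_metric_def r_def[symmetric] a_def b_def
    by (simp_all add: inner_vec_def sum_2 axis_def power2_eq_square)
  then have "hyp_area_density x =
      sqrt ((1 / r + a\<^sup>2 / r\<^sup>2) * (1 / r + b\<^sup>2 / r\<^sup>2) - (a * b / r\<^sup>2)\<^sup>2)"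
    by (simp add: hyp_area_density_def)
  also have "(1 / r + a\<^sup>2 / r\<^sup>2) * (1 / r + b\<^sup>2 / r\<^sup>2) - (a * b / r\<^sup>2)\<^sup>2
      = 1 / r\<^sup>2 + (a\<^sup>2 + b\<^sup>2) / r ^ 3"
    using r by (simp add: field_simps power2_eq_square power3_eq_cube)
  also have "\<dots> = 1 / r ^ 3"
    unfolding ab using r by (simp add: field_simps power2_eq_square power3_eq_cube)
  finally show ?thesis
    by (simp add: rn real_sqrt_divide)
qed

definition hyp_area :: "(real^2) set \<Rightarrow> real" where
  "hyp_area S = (LINT x:S|lborel. hyp_area_density x)"

text \<open>The angle at \<^term>\<open>v\<close> between the geodesic segments from \<^term>\<open>v\<close> to \<^term>\<open>a\<close> and
  from \<^term>\<open>v\<close> to \<^term>\<open>b\<close>.\<close>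

definition hyp_angle :: "real^2 \<Rightarrow> real^2 \<Rightarrow> real^2 \<Rightarrow> real" where
  "hyp_angle v a b =
     arccos (hyp_metric v (a - v) (b - v) /
             sqrt (hyp_metric v (a - v) (a - v) * hyp_metric v (b - v) (b - v)))"


section \<open>Groups of isometries and their quotients\<close>

definition hyp_isometry :: "(real^2 \<Rightarrow> real^2) \<Rightarrow> bool" where
  "hyp_isometry g \<longleftrightarrow> bij_betw g hyp_plane hyp_plane \<and>
     (\<forall>x\<in>hyp_plane. \<forall>y\<in>hyp_plane. hyp_dist (g x) (g y) = hyp_dist x y)"

definition orientation_preserving :: "(real^2 \<Rightarrow> real^2) \<Rightarrow> bool" where
  "orientation_preserving g \<longleftrightarrow>
     (\<forall>x\<in>hyp_plane. \<exists>g'. (g has_derivative g') (at x) \<and> det (matrix g') > 0)"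

text \<open>
  The elements of \<^term>\<open>BijGroup hyp_plane\<close> are extensional functions, so that group elements agree
  as soon as they agree on the hyperbolic plane. The predicate \<^const>\<open>discrete\<close> refers to the
  topology of pointwise convergence; on isometries it coincides with the compact-open topology.
\<close>

definition discrete_isometry_group :: "(real^2 \<Rightarrow> real^2) set \<Rightarrow> bool" where
  "discrete_isometry_group G \<longleftrightarrow>
     subgroup G (BijGroup hyp_plane) \<and>
     (\<forall>g\<in>G. hyp_isometry g \<and> orientation_preserving g) \<and>
     discrete G"

abbreviation hyp_orbit :: "(real^2 \<Rightarrow> real^2) set \<Rightarrow> real^2 \<Rightarrow> (real^2) set" where
  "hyp_orbit G x \<equiv> orbit (BijGroup hyp_plane \<lparr>carrier := G\<rparr>) (\<lambda>g. g) x"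

abbreviation hyp_stabilizer :: "(real^2 \<Rightarrow> real^2) set \<Rightarrow> real^2 \<Rightarrow> (real^2 \<Rightarrow> real^2) set" where
  "hyp_stabilizer G x \<equiv> stabilizer (BijGroup hyp_plane \<lparr>carrier := G\<rparr>) (\<lambda>g. g) x"

text \<open>The orbit space with the quotient topology.\<close>

definition orbit_space :: "(real^2 \<Rightarrow> real^2) set \<Rightarrow> (real^2) set topology" where
  "orbit_space G =
     topology (\<lambda>U. U \<subseteq> hyp_orbit G ` hyp_plane \<and>
                   openin (top_of_set hyp_plane) {x \<in> hyp_plane. hyp_orbit G x \<in> U})"

lemma openin_orbit_space:
  "openin (orbit_space G) U \<longleftrightarrow>
     U \<subseteq> hyp_orbit G ` hyp_plane \<and>
     openin (top_of_set hyp_plane) {x \<in> hyp_plane. hyp_orbit G x \<in> U}"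
proof -
  let ?P = "\<lambda>U. openin (top_of_set hyp_plane) {x \<in> hyp_plane. hyp_orbit G x \<in> U}"
  have "?P (S \<inter> T)" if "?P S" "?P T" for S T
  proof -
    have "{x \<in> hyp_plane. hyp_orbit G x \<in> S \<inter> T} =
        {x \<in> hyp_plane. hyp_orbit G x \<in> S} \<inter> {x \<in> hyp_plane. hyp_orbit G x \<in> T}"
      by blast
    then show ?thesis
      using that by (simp only: openin_Int)
  qed
  moreover have "?P (\<Union>K)" if "\<forall>S\<in>K. ?P S" for K
  proof -
    have "{x \<in> hyp_plane. hyp_orbit G x \<in> \<Union>K} =
        \<Union> ((\<lambda>S. {x \<in> hyp_plane. hyp_orbit G x \<in> S}) ` K)"
      by blast
    moreover have "openin (top_of_set hyp_plane)
        (\<Union> ((\<lambda>S. {x \<in> hyp_plane. hyp_orbit G x \<in> S}) ` K))"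
      using that by (intro openin_Union) blast
    ultimately show ?thesis
      by (simp only:)
  qed
  ultimately have "istopology (\<lambda>U. U \<subseteq> hyp_orbit G ` hyp_plane \<and> ?P U)"
    unfolding istopology_def by blast
  then show ?thesis
    unfolding orbit_space_def by (simp add: topology_inverse')
qed

definition cone_points :: "(real^2 \<Rightarrow> real^2) set \<Rightarrow> (real^2) set set" where
  "cone_points G =
     hyp_orbit G ` {x \<in> hyp_plane. hyp_stabilizer G x \<noteq> {\<one>\<^bsub>BijGroup hyp_plane\<^esub>}}"

text \<open>Groups of type \<open>[3, 3, \<dots>, 3]\<close> (\<open>l\<close> times).\<close>

definition group_of_type_3s :: "nat \<Rightarrow> (real^2 \<Rightarrow> real^2) set \<Rightarrow> bool" where
  "group_of_type_3s l G \<longleftrightarrow>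
     discrete_isometry_group G \<and>
     orbit_space G homeomorphic_space top_of_set (sphere (0 :: real^3) 1) \<and>
     finite (cone_points G) \<and> card (cone_points G) = l \<and>
     (\<forall>x\<in>hyp_plane. hyp_orbit G x \<in> cone_points G \<longrightarrow> card (hyp_stabilizer G x) = 3)"


section \<open>Fundamental domains\<close>

definition compact_convex_polygon :: "(real^2) set \<Rightarrow> bool" where
  "compact_convex_polygon F \<longleftrightarrow>
     polytope F \<and> F \<subseteq> hyp_plane \<and> interior F \<noteq> {} \<and>
     (\<forall>v a b. closed_segment v a edge_of F \<and> closed_segment v b edge_of F \<and> a \<noteq> b \<longrightarrow>
        0 < hyp_angle v a b \<and> hyp_angle v a b < pi)"

definition tiles_edge_to_edge :: "(real^2 \<Rightarrow> real^2) set \<Rightarrow> (real^2) set \<Rightarrow> bool" where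
  "tiles_edge_to_edge G F \<longleftrightarrow>
     (\<Union>g\<in>G. g ` F) = hyp_plane \<and>
     (\<forall>g\<in>G. \<forall>h\<in>G. g \<noteq> h \<longrightarrow>
        g ` F \<inter> h ` F = {} \<or>
        (\<exists>v. g ` F \<inter> h ` F = {v} \<and> v extreme_point_of (g ` F) \<and> v extreme_point_of (h ` F)) \<or>
        (g ` F \<inter> h ` F edge_of (g ` F) \<and> g ` F \<inter> h ` F edge_of (h ` F)))"

text \<open>The element \<open>\<gamma> s\<close> takes the side \<open>s\<close> to its partner \<open>\<sigma> s\<close> and the
  polygon to the neighbouring tile across \<open>\<sigma> s\<close>.\<close>

definition sides_paired :: "(real^2 \<Rightarrow> real^2) set \<Rightarrow> (real^2) set \<Rightarrow> bool" where
  "sides_paired G F \<longleftrightarrow>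
     (\<exists>\<sigma> \<gamma>. \<forall>s. s edge_of F \<longrightarrow>
        \<sigma> s edge_of F \<and> \<sigma> s \<noteq> s \<and> \<sigma> (\<sigma> s) = s \<and>
        \<gamma> s \<in> G \<and> \<gamma> s ` s = \<sigma> s \<and> F \<inter> \<gamma> s ` F = \<sigma> s)"

text \<open>Graphs drawn on a space: the vertices are points, the edges are subsets of the space, and the
  ends of an edge are the vertices lying on it. Parallel edges count as a cycle (\<open>k = 2\<close>).\<close>

definition graph_adjacent :: "'p set \<Rightarrow> 'p set set \<Rightarrow> ('p \<times> 'p) set" where
  "graph_adjacent V E = {(x, y). \<exists>e\<in>E. e \<inter> V = {x, y}}"

definition graph_cycle :: "'p set \<Rightarrow> 'p set set \<Rightarrow> nat \<Rightarrow> (nat \<Rightarrow> 'p) \<Rightarrow> (nat \<Rightarrow> 'p set) \<Rightarrow> bool" where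
  "graph_cycle V E k p c \<longleftrightarrow>
     k \<ge> 2 \<and> inj_on p {..<k} \<and> inj_on c {..<k} \<and> p ` {..<k} \<subseteq> V \<and> c ` {..<k} \<subseteq> E \<and>
     (\<forall>i<k. c i \<inter> V = {p i, p (Suc i mod k)})"

definition tree_graph :: "'p set \<Rightarrow> 'p set set \<Rightarrow> bool" where
  "tree_graph V E \<longleftrightarrow>
     finite V \<and> finite E \<and> V \<noteq> {} \<and>
     (\<forall>e\<in>E. card (e \<inter> V) = 2) \<and>
     (\<forall>x\<in>V. \<forall>y\<in>V. (x, y) \<in> (graph_adjacent V E)\<^sup>*) \<and>
     (\<nexists>k p c. graph_cycle V E k p c)"

definition graph_degree :: "'p set set \<Rightarrow> 'p \<Rightarrow> nat" where
  "graph_degree E x = card {e \<in> E. x \<in> e}"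

text \<open>The surface graph: the image of the boundary of the polygon in the orbit space.\<close>

definition surface_vertices :: "(real^2 \<Rightarrow> real^2) set \<Rightarrow> (real^2) set \<Rightarrow> (real^2) set set" where
  "surface_vertices G F = hyp_orbit G ` {v. v extreme_point_of F}"

definition surface_edges :: "(real^2 \<Rightarrow> real^2) set \<Rightarrow> (real^2) set \<Rightarrow> (real^2) set set set" where
  "surface_edges G F = (\<lambda>s. hyp_orbit G ` s) ` {s. s edge_of F}"

text \<open>Vertices of the surface graph that are not cone points have trivial stabilizers by the
  definition of \<^const>\<open>cone_points\<close>.\<close>

definition tree_surface_graph :: "(real^2 \<Rightarrow> real^2) set \<Rightarrow> (real^2) set \<Rightarrow> bool" where
  "tree_surface_graph G F \<longleftrightarrow>
     tree_graph (surface_vertices G F) (surface_edges G F) \<and>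
     cone_points G \<subseteq> surface_vertices G F \<and>
     (\<forall>x\<in>cone_points G. graph_degree (surface_edges G F) x \<ge> 1) \<and>
     (\<forall>x\<in>surface_vertices G F - cone_points G. graph_degree (surface_edges G F) x \<ge> 3)"

definition fundamental_domain :: "(real^2 \<Rightarrow> real^2) set \<Rightarrow> (real^2) set \<Rightarrow> bool" where
  "fundamental_domain G F \<longleftrightarrow>
     compact_convex_polygon F \<and> tiles_edge_to_edge G F \<and> sides_paired G F \<and>
     tree_surface_graph G F"

end

theory Submission
  imports Defs
begin

text \<open>
  The area comes from Gauss-Bonnet, the number of sides of the polygon and the total of its angles.

  A convex polygon with \<open>n\<close> sides has area \<open>(n - 2) \<pi>\<close> minus its angle sum. To see this without
  ordering the vertices, join an interior point, the center, to the two ends of each side. The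
  resulting triangles each have area \<open>\<pi>\<close> minus their angle sum (\<open>hyp_area_triangle\<close>), and their angles at the
  center add up to \<open>2 \<pi>\<close> (\<open>center_angle_sum\<close>). The other two angles of the triangles add up to the
  angle sum of the polygon (\<open>hyp_area_polygon\<close>). For a triangle with a vertical side, Fubini's
  theorem turns the area into two line integrals along the other sides. Up to sign and a constant, their
  antiderivative is the angle between the side and the vertical direction (\<open>line_slope_deriv\<close>).

  The pairs of a tile and one of its sides, here called flags, carry the combinatorics. Since the tiles
  overlap only in points and sides, a geometric segment is the image of a side in at most two
  flags, one on each side of it (\<open>flags_opposite\<close>). Hence exactly two sides of the polygon map to
  each edge of the surface graph (\<open>card_sides\<close>). Around a corner \<open>v\<close>, crossing a side leads to another flag at
  \<open>v\<close>, so finitely many flags fill a neighbourhood of \<open>v\<close> and their angles add up to \<open>2 \<pi>\<close>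
  (\<open>flag_angle_sum\<close>). The tiles that have \<open>v\<close> as the image of a given corner \<open>u\<close> in its orbit are as many
  as the elements of the stabilizer, so the angles of the polygon in the orbit of \<open>v\<close> add
  up to \<open>2 \<pi>\<close> divided by the order of the stabilizer (\<open>corner_class_angle_sum\<close>).

  The surface graph is a tree, so with \<open>V\<close> vertices it has \<open>V - 1\<close> edges (\<open>tree_graph_card\<close>) and the polygon
  has \<open>2 (V - 1)\<close> sides. With \<open>l\<close> vertices of order three and \<open>V - l\<close> of order one, the area is
  \<open>(2 V - 4) \<pi> - 2 \<pi> l / 3 - 2 \<pi> (V - l)\<close>, in which \<open>V\<close> cancels.
\<close>

section \<open>Angles in the Klein model\<close>

abbreviation up :: "real^2" where "up \<equiv> axis 2 1"

definition cross :: "real^2 \<Rightarrow> real^2 \<Rightarrow> real" where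
  "cross u w = u $ 1 * w $ 2 - u $ 2 * w $ 1"

text \<open>
  Linear coordinates on the tangent space at \<open>x\<close> in which the metric is a multiple of the
  Euclidean metric of the complex plane and the upward direction lies on the positive real axis.
  They turn angles into arguments of complex numbers.
\<close>

definition conf :: "real^2 \<Rightarrow> real^2 \<Rightarrow> complex" where
  "conf x u = Complex (hyp_metric x u up) (hyp_area_density x * u $ 1)"

lemma inner_2: "(x::real^2) \<bullet> y = x $ 1 * y $ 1 + x $ 2 * y $ 2"
  by (simp add: inner_vec_def sum_2)

lemma up_nth [simp]: "up $ 1 = 0" "up $ 2 = 1"
  by (simp_all add: axis_def)

lemma hyp_plane_less: "x \<in> hyp_plane \<Longrightarrow> 0 < 1 - x \<bullet> x"
  by (simp add: abs_square_less_1 flip: power2_norm_eq_inner)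

lemma hyp_area_density_pos: "x \<in> hyp_plane \<Longrightarrow> 0 < hyp_area_density x"
  using hyp_plane_less [of x] by (simp add: hyp_area_density_eq power2_norm_eq_inner)

lemma hyp_metric_commute: "hyp_metric x u v = hyp_metric x v u"
  by (simp add: hyp_metric_def inner_commute mult.commute)

lemma hyp_metric_add_left: "hyp_metric x (u + u') w = hyp_metric x u w + hyp_metric x u' w"
  by (simp add: hyp_metric_def inner_simps add_divide_distrib algebra_simps)

lemma hyp_metric_scale_left: "hyp_metric x (c *\<^sub>R u) w = c * hyp_metric x u w"
  by (simp add: hyp_metric_def algebra_simps)

lemma hyp_metric_pos:
  assumes "x \<in> hyp_plane" "u \<noteq> 0"
  shows "0 < hyp_metric x u u"
proof -
  have "0 < (u \<bullet> u) / (1 - x \<bullet> x)"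
    using assms hyp_plane_less by simp
  moreover have "0 \<le> (x \<bullet> u) * (x \<bullet> u) / (1 - x \<bullet> x)\<^sup>2"
    by simp
  ultimately show ?thesis
    unfolding hyp_metric_def by linarith
qed

lemma linear_conf: "linear (conf x)"
  by (rule linearI)
    (simp_all add: conf_def hyp_metric_add_left hyp_metric_scale_left complex_eq_iff algebra_simps)

lemma conf_add: "conf x (u + w) = conf x u + conf x w"
  by (rule linear_add [OF linear_conf])

lemma conf_diff: "conf x (u - w) = conf x u - conf x w"
  by (rule linear_diff [OF linear_conf])

lemma conf_scale: "conf x (c *\<^sub>R u) = of_real c * conf x u"
  using linear_scale [OF linear_conf, of x c u] by (simp only: scaleR_conv_of_real)

lemma hyp_area_density_squared:
  assumes "x \<in> hyp_plane"
  shows "(hyp_area_density x)\<^sup>2 =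
    hyp_metric x (axis 1 1) (axis 1 1) * hyp_metric x up up - (hyp_metric x (axis 1 1) up)\<^sup>2"
proof -
  have "0 < hyp_area_density x" by (rule hyp_area_density_pos [OF assms])
  then show ?thesis
    unfolding hyp_area_density_def by (simp add: real_sqrt_gt_0_iff)
qed

text \<open>
  The squared density is the Gram determinant of the metric in the standard basis, so this is
  the two-dimensional Gram identity for the vectors \<open>u\<close>, \<open>w\<close> and the upward direction.
\<close>

lemma conf_inner:
  assumes "x \<in> hyp_plane"
  shows "Re (cnj (conf x u) * conf x w) = hyp_metric x up up * hyp_metric x u w"
proof -
  define p q s where "p = hyp_metric x (axis 1 1) (axis 1 1)"
    and "q = hyp_metric x (axis 1 1) up" and "s = hyp_metric x up up"
  have expand: "v = v $ 1 *\<^sub>R axis 1 1 + v $ 2 *\<^sub>R up" for v :: "real^2"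
    by (simp add: vec_eq_iff forall_2 axis_def)
  have m: "hyp_metric x v up = v $ 1 * q + v $ 2 * s" for v
    by (subst expand) (simp add: hyp_metric_add_left hyp_metric_scale_left q_def s_def)
  have m1: "hyp_metric x v w = v $ 1 * hyp_metric x (axis 1 1) w + v $ 2 * hyp_metric x up w" for v w
    by (subst expand [of v]) (simp only: hyp_metric_add_left hyp_metric_scale_left)
  have m2: "hyp_metric x u w = u $ 1 * (w $ 1 * p + w $ 2 * q) + u $ 2 * (w $ 1 * q + w $ 2 * s)"
    using m1 [of u w] m1 [of w "axis 1 1"] m [of w]
    by (simp add: hyp_metric_commute [of x _ w] p_def q_def hyp_metric_commute [of x up "axis 1 1"])
  have d: "hyp_area_density x * hyp_area_density x = p * s - q * q"
    using hyp_area_density_squared [OF assms]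
    by (simp add: p_def q_def s_def power2_eq_square)
  have "Re (cnj (conf x u) * conf x w) =
      (u $ 1 * q + u $ 2 * s) * (w $ 1 * q + w $ 2 * s)
      + (hyp_area_density x * hyp_area_density x) * (u $ 1 * w $ 1)"
    by (simp add: conf_def m algebra_simps)
  also have "\<dots> = s * hyp_metric x u w"
    unfolding d m2 by (simp add: algebra_simps)
  finally show ?thesis
    by (simp add: s_def)
qed

lemma conf_norm:
  assumes "x \<in> hyp_plane"
  shows "norm (conf x u) = sqrt (hyp_metric x up up * hyp_metric x u u)"
  using conf_inner [OF assms, of u u]
  by (simp add: cmod_def power2_eq_square)

lemma up_nz [simp]: "up \<noteq> 0"
  by (simp add: vec_eq_iff forall_2)

lemma conf_eq_0_iff:
  assumes "x \<in> hyp_plane"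
  shows "conf x u = 0 \<longleftrightarrow> u = 0"
proof
  assume "conf x u = 0"
  then have "hyp_metric x up up * hyp_metric x u u = 0"
    using conf_norm [OF assms, of u] by (simp add: real_sqrt_eq_zero_cancel_iff)
  then show "u = 0"
    using hyp_metric_pos [OF assms, of up] hyp_metric_pos [OF assms, of u] by auto
qed (simp add: linear_0 linear_conf)

lemma conf_cross:
  assumes "x \<in> hyp_plane"
  shows "Im (cnj (conf x u) * conf x w) =
    - hyp_area_density x * hyp_metric x up up * cross u w"
proof -
  have expand: "v = v $ 1 *\<^sub>R axis 1 1 + v $ 2 *\<^sub>R up" for v :: "real^2"
    by (simp add: vec_eq_iff forall_2 axis_def)
  have m: "hyp_metric x v up = v $ 1 * hyp_metric x (axis 1 1) up + v $ 2 * hyp_metric x up up" for v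
    by (subst expand) (simp add: hyp_metric_add_left hyp_metric_scale_left)
  show ?thesis
    by (simp add: conf_def cross_def m [of u] m [of w] algebra_simps)
qed

lemma arccos_Re: 
  assumes "z \<noteq> 0" shows "arccos (Re z / norm z) = \<bar>Arg z\<bar>"
proof -
  have "cos \<bar>Arg z\<bar> = Re z / norm z"
    using cos_Arg assms by (simp add: abs_if)
  then show ?thesis
    using arccos_cos [of "\<bar>Arg z\<bar>"] Arg_le_pi [of z] mpi_less_Arg [of z] by simp
qed

lemma hyp_angle_conf:
  assumes "v \<in> hyp_plane" "a \<noteq> v" "b \<noteq> v"
  shows "hyp_angle v a b = \<bar>Arg (conf v (b - v) / conf v (a - v))\<bar>"
proof -
  define z w where "z = conf v (a - v)" and "w = conf v (b - v)"
  have nz: "z \<noteq> 0" "w \<noteq> 0"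
    using assms by (simp_all add: z_def w_def conf_eq_0_iff)
  have pos: "0 < hyp_metric v up up"
    using assms hyp_metric_pos by simp
  have "norm z * norm w = hyp_metric v up up *
      sqrt (hyp_metric v (a - v) (a - v) * hyp_metric v (b - v) (b - v))"
    using pos by (simp add: z_def w_def conf_norm [OF assms(1)] real_sqrt_mult)
  then have "hyp_metric v (a - v) (b - v) /
      sqrt (hyp_metric v (a - v) (a - v) * hyp_metric v (b - v) (b - v))
    = Re (cnj z * w) / (norm z * norm w)"
    unfolding z_def w_def conf_inner [OF assms(1)] using pos by simp
  also have "\<dots> = Re (cnj z * w) / norm (cnj z * w)"
    by (simp add: norm_mult)
  finally have "hyp_angle v a b = \<bar>Arg (cnj z * w)\<bar>"
    unfolding hyp_angle_def using nz arccos_Re [of "cnj z * w"] by (simp del: times_complex.sel)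
  also have "cnj z * w = of_real ((norm z)\<^sup>2) * (w / z)"
    using nz by (simp add: field_simps complex_norm_square del: of_real_power)
  also have "Arg \<dots> = Arg (w / z)"
    using nz by (subst Arg_times_of_real) auto
  finally show ?thesis
    by (simp add: z_def w_def)
qed

lemma hyp_angle_commute: "hyp_angle v a b = hyp_angle v b a"
  by (simp add: hyp_angle_def hyp_metric_commute mult.commute)

lemma hyp_angle_direction:
  assumes "a' - v = c *\<^sub>R (a - v)" "c > 0"
  shows "hyp_angle v a' b = hyp_angle v a b"
proof -
  have "hyp_metric v (a' - v) (a' - v) = c\<^sup>2 * hyp_metric v (a - v) (a - v)"
    unfolding assms(1)
    by (simp add: hyp_metric_scale_left hyp_metric_commute [of v _ "c *\<^sub>R _"] power2_eq_square)
  then show ?thesis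
    using assms(2)
    by (simp add: hyp_angle_def assms(1) hyp_metric_scale_left real_sqrt_mult)
qed

lemma abs_Arg_minus:
  assumes "z \<noteq> 0" shows "\<bar>Arg (- z)\<bar> = pi - \<bar>Arg z\<bar>"
proof -
  have "\<bar>Re z / norm z\<bar> \<le> 1"
    using abs_Re_le_cmod [of z] assms by (simp add: divide_simps)
  then show ?thesis
    using arccos_Re [of z] arccos_Re [of "- z"] assms arccos_minus [of "Re z / norm z"]
    by (simp add: abs_le_iff del: divide_le_eq_1 abs_divide)
qed

lemma hyp_angle_opposite:
  assumes "v \<in> hyp_plane" "a \<noteq> v" "b \<noteq> v" "a' - v = - c *\<^sub>R (a - v)" "c > 0"
  shows "hyp_angle v a' b = pi - hyp_angle v a b"
proof -
  have nz: "conf v (b - v) / conf v (a - v) \<noteq> 0"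
    using assms by (simp add: conf_eq_0_iff)
  have ne: "a' \<noteq> v"
    using assms by auto
  have "conf v (a' - v) = - of_real c * conf v (a - v)"
    unfolding assms(4) by (simp only: conf_scale of_real_minus)
  then have "conf v (b - v) / conf v (a' - v) = - (conf v (b - v) / conf v (a - v) / of_real c)"
    using assms(5) by simp
  then have "\<bar>Arg (conf v (b - v) / conf v (a' - v))\<bar>
      = pi - \<bar>Arg (conf v (b - v) / conf v (a - v) / of_real c)\<bar>"
    using nz assms(5) by (simp only: abs_Arg_minus) (subst abs_Arg_minus, auto)
  then show ?thesis
    unfolding Arg_divide_of_real [OF assms(5)]
      hyp_angle_conf [OF assms(1-3)] hyp_angle_conf [OF assms(1) ne assms(3)] .
qed

lemma Arg_Im_pos_mult:
  assumes "Im z > 0" "Im w > 0" "Im (z * w) > 0"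
  shows "Arg (z * w) = Arg z + Arg w"
proof -
  have nz: "z \<noteq> 0" "w \<noteq> 0" "z * w \<noteq> 0" using assms by auto
  have a: "0 < Arg z" "Arg z < pi" "0 < Arg w" "Arg w < pi" "Arg (z * w) < pi" "0 < Arg (z * w)"
    using assms Arg_lt_pi [of z] Arg_lt_pi [of w] Arg_lt_pi [of "z * w"] by blast+
  show ?thesis
    using Arg_times' [OF nz(1,2)] a by (auto split: if_splits)
qed

lemma abs_Arg_cnj: "\<bar>Arg (cnj z)\<bar> = \<bar>Arg z\<bar>"
  by (simp add: Arg_cnj)

lemma abs_Arg_between:
  assumes "Im q \<noteq> 0" "s > 0" "t > 0"
  shows "\<bar>Arg q\<bar> = \<bar>Arg (of_real s + of_real t * q)\<bar> + \<bar>Arg (q / (of_real s + of_real t * q))\<bar>"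
proof -
  have main: "\<bar>Arg q\<bar> = \<bar>Arg (of_real s + of_real t * q)\<bar> + \<bar>Arg (q / (of_real s + of_real t * q))\<bar>"
    if "Im q > 0" for q
  proof -
    define y where "y = of_real s + of_real t * q"
    have y: "Im y > 0"
      using that assms by (simp add: y_def)
    then have nz: "y \<noteq> 0" by auto
    have "Im (q / y) = Im (q * cnj y) / (norm y)\<^sup>2"
      by (simp add: complex_div_cnj [of q y] Im_divide_of_real flip: of_real_power)
    also have "Im (q * cnj y) = s * Im q"
      by (simp add: y_def algebra_simps)
    finally have "Im (q / y) > 0"
      using that assms nz by simp
    then have "Arg (y * (q / y)) = Arg y + Arg (q / y)"
      using y nz that by (intro Arg_Im_pos_mult) auto
    then show ?thesis
      using nz y \<open>Im (q / y) > 0\<close> that Arg_pos_iff [of y] Arg_pos_iff [of "q / y"] Arg_pos_iff [of q] by (simp flip: y_def)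
  qed
  show ?thesis
  proof (cases "Im q > 0")
    case False
    then show ?thesis
      using main [of "cnj q"] assms abs_Arg_cnj [of q] abs_Arg_cnj [of "of_real s + of_real t * q"]
        abs_Arg_cnj [of "q / (of_real s + of_real t * q)"] by simp
  qed (rule main)
qed

lemma Im_conf_quotient:
  assumes "v \<in> hyp_plane" "u \<noteq> 0"
  shows "Im (conf v w / conf v u) =
    - (hyp_area_density v * hyp_metric v up up / (norm (conf v u))\<^sup>2) * cross u w"
proof -
  have "Im (conf v w / conf v u) = Im (cnj (conf v u) * conf v w) / (norm (conf v u))\<^sup>2"
    by (simp add: complex_div_cnj [of "conf v w"] Im_divide_of_real mult.commute del: times_complex.sel flip: of_real_power)
  then show ?thesis
    by (simp add: conf_cross [OF assms(1)] del: times_complex.sel)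
qed

lemma Im_conf_quotient_coeff_pos:
  assumes "v \<in> hyp_plane" "u \<noteq> 0"
  shows "hyp_area_density v * hyp_metric v up up / (norm (conf v u))\<^sup>2 > 0"
  using assms by (simp add: conf_eq_0_iff hyp_area_density_pos hyp_metric_pos)

lemma cross_nz: 
  assumes "cross u w \<noteq> 0" shows "u \<noteq> 0" "w \<noteq> 0"
  using assms by (auto simp: cross_def)

lemma hyp_angle_add:
  assumes "v \<in> hyp_plane" "cross (b - v) (c - v) \<noteq> 0"
    and "d - v = s *\<^sub>R (b - v) + t *\<^sub>R (c - v)" "s > 0" "t > 0"
  shows "hyp_angle v b c = hyp_angle v b d + hyp_angle v d c"
proof -
  have nz: "b - v \<noteq> 0" "c - v \<noteq> 0"
    using cross_nz [OF assms(2)] by simp_all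
  have "cross (b - v) (d - v) = t * cross (b - v) (c - v)"
    unfolding assms(3) by (simp add: cross_def algebra_simps)
  then have "d - v \<noteq> 0"
    using cross_nz(2) [of "b - v" "d - v"] assms by simp
  define z w where "z = conf v (b - v)" and "w = conf v (c - v)"
  have cnz: "z \<noteq> 0" "w \<noteq> 0"
    using nz assms by (simp_all add: z_def w_def conf_eq_0_iff)
  have y: "conf v (d - v) = of_real s * z + of_real t * w"
    unfolding assms(3) z_def w_def by (simp only: conf_add conf_scale)
  then have e: "conf v (d - v) / z = of_real s + of_real t * (w / z)"
    using cnz by (simp add: field_simps)
  have "Im (w / z) \<noteq> 0"
    unfolding z_def w_def Im_conf_quotient [OF assms(1) nz(1)]
    using less_imp_neq [OF Im_conf_quotient_coeff_pos [OF assms(1) nz(1)]] assms(2)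
    by (simp only: mult_eq_0_iff neg_equal_0_iff_equal) auto
  from abs_Arg_between [OF this assms(4,5)]
  have "\<bar>Arg (w / z)\<bar> = \<bar>Arg (conf v (d - v) / z)\<bar> + \<bar>Arg (w / conf v (d - v))\<bar>"
    unfolding e [symmetric] using cnz by simp
  then show ?thesis
    using nz \<open>d - v \<noteq> 0\<close> assms(1) by (simp add: hyp_angle_conf z_def w_def)
qed

text \<open>
  Equality in the Cauchy-Schwarz inequality. It expresses betweenness by an angle, and therefore
  by distances.
\<close>

lemma hyp_angle_eq_pi_iff:
  assumes "v \<in> hyp_plane" "a \<noteq> v" "b \<noteq> v"
  shows "hyp_angle v a b = pi \<longleftrightarrow> v \<in> open_segment a b"
proof -
  have nz: "conf v (a - v) \<noteq> 0" "conf v (b - v) \<noteq> 0"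
    using assms by (simp_all add: conf_eq_0_iff)
  have "hyp_angle v a b = pi \<longleftrightarrow> Arg (conf v (b - v) / conf v (a - v)) = pi"
    using assms mpi_less_Arg [of "conf v (b - v) / conf v (a - v)"] by (auto simp: hyp_angle_conf abs_if)
  also have "\<dots> \<longleftrightarrow> (\<exists>t>0. conf v (b - v) / conf v (a - v) = - of_real t)"
    (is "_ \<longleftrightarrow> ?r")
    unfolding Arg_eq_pi complex_eq_iff by (auto intro: exI [of _ "- Re _"])
  also have "\<dots> \<longleftrightarrow> (\<exists>t>0. b - v = - t *\<^sub>R (a - v))"
  proof (intro ex_cong conj_cong refl)
    fix t :: real
    have "conf v (b - v) / conf v (a - v) = - of_real t \<longleftrightarrow>
        conf v (b - v - (- t *\<^sub>R (a - v))) = 0"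
      unfolding conf_diff [of v "b - v"] conf_scale [of v "- t"] using nz by (subst nonzero_divide_eq_eq) (simp_all add: eq_neg_iff_add_eq_0)
    then show "conf v (b - v) / conf v (a - v) = - of_real t \<longleftrightarrow> b - v = - t *\<^sub>R (a - v)"
      by (simp only: conf_eq_0_iff [OF assms(1)] right_minus_eq)
  qed
  also have "\<dots> \<longleftrightarrow> v \<in> open_segment a b"
  proof
    assume "\<exists>t>0. b - v = - t *\<^sub>R (a - v)"
    then obtain t where t: "t > 0" "b - v = - t *\<^sub>R (a - v)" by auto
    have ab: "a \<noteq> b"
    proof
      assume "a = b"
      with t have "(1 + t) *\<^sub>R (a - v) = 0" by (simp add: scaleR_add_left algebra_simps)
      with t assms show False by simp
    qed
    have "(1 + t) *\<^sub>R v = t *\<^sub>R a + b"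
      using t(2) by (simp add: algebra_simps)
    then have "v = (1 / (1 + t)) *\<^sub>R (t *\<^sub>R a + b)"
      using t(1) by (metis add_pos_pos less_numeral_extra(1) less_irrefl scaleR_left_imp_eq scaleR_scaleR
          nonzero_eq_divide_eq mult.commute scaleR_one)
    also have "\<dots> = (1 - 1 / (1 + t)) *\<^sub>R a + (1 / (1 + t)) *\<^sub>R b"
      using t(1) by (simp add: vec_eq_iff field_simps)
    finally show "v \<in> open_segment a b"
      using ab t(1) unfolding in_segment by (intro conjI exI [of _ "1 / (1 + t)"]) auto
  next
    assume "v \<in> open_segment a b"
    then obtain u where u: "0 < u" "u < 1" "v = (1 - u) *\<^sub>R a + u *\<^sub>R b"
      by (auto simp: in_segment)
    then have "b - v = - ((1 - u) / u) *\<^sub>R (a - v)"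
      using u(1) unfolding u(3) by (simp add: vec_eq_iff field_simps)
    with u show "\<exists>t>0. b - v = - t *\<^sub>R (a - v)"
      by (intro exI [of _ "(1 - u) / u"]) simp
  qed
  finally show ?thesis .
qed

text \<open>
  The hyperbolic cosine of the distance.
\<close>

definition hyp_cosh :: "real^2 \<Rightarrow> real^2 \<Rightarrow> real" where
  "hyp_cosh x y = (1 - x \<bullet> y) / sqrt ((1 - x \<bullet> x) * (1 - y \<bullet> y))"

lemma hyp_cosh_ge_1:
  assumes "x \<in> hyp_plane" "y \<in> hyp_plane"
  shows "1 \<le> hyp_cosh x y"
proof -
  have lt: "norm x < 1" "norm y < 1"
    using assms by simp_all
  then have 0: "0 \<le> 1 - norm x * norm y"
    by (simp add: mult_le_one less_imp_le)
  have "(1 - x \<bullet> x) * (1 - y \<bullet> y) \<le> (1 - norm x * norm y)\<^sup>2"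
    using sum_squares_ge_zero [of "norm x - norm y" 0]
    by (simp add: dot_square_norm power2_eq_square algebra_simps)
  then have "sqrt ((1 - x \<bullet> x) * (1 - y \<bullet> y)) \<le> 1 - norm x * norm y"
    using 0 by (rule real_le_lsqrt [rotated 1, OF _ ])
  also have "\<dots> \<le> 1 - x \<bullet> y"
    using norm_cauchy_schwarz [of x y] by simp
  finally show ?thesis
    using hyp_plane_less assms unfolding hyp_cosh_def by (subst le_divide_eq_1_pos) simp_all
qed

text \<open>
  The hyperbolic law of cosines. An angle is a function of three distances, so that isometries
  preserve angles although nothing is known about their derivatives.
\<close>

lemma hyp_angle_hyp_cosh:
  assumes "v \<in> hyp_plane" "a \<in> hyp_plane" "b \<in> hyp_plane"
  shows "hyp_angle v a b = arccos ((hyp_cosh v a * hyp_cosh v b - hyp_cosh a b) /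
    sqrt (((hyp_cosh v a)\<^sup>2 - 1) * ((hyp_cosh v b)\<^sup>2 - 1)))"
proof -
  define R where "R x = sqrt (1 - x \<bullet> x)" for x :: "real^2"
  have R: "0 < R x" "(R x)\<^sup>2 = 1 - x \<bullet> x" if "x \<in> hyp_plane" for x
    using hyp_plane_less [OF that] by (simp_all add: R_def)
  have ip: "1 - x \<bullet> y = hyp_cosh x y * R x * R y" if "x \<in> hyp_plane" "y \<in> hyp_plane" for x y
    using R(1) [OF that(1)] R(1) [OF that(2)] by (simp add: hyp_cosh_def R_def real_sqrt_mult)
  have one: "hyp_cosh x x = 1" if "x \<in> hyp_plane" for x
    using hyp_plane_less [OF that] by (simp add: hyp_cosh_def)
  have m: "hyp_metric v (x - v) (y - v) =
      (R x * R y / (R v)\<^sup>2) * (hyp_cosh v x * hyp_cosh v y - hyp_cosh x y)"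
    if "x \<in> hyp_plane" "y \<in> hyp_plane" for x y
  proof -
    have "hyp_metric v (x - v) (y - v) =
        ((1 - v \<bullet> x) * (1 - v \<bullet> y) - (1 - x \<bullet> y) * (1 - v \<bullet> v)) / (1 - v \<bullet> v)\<^sup>2"
      using hyp_plane_less [OF assms(1)]
      by (simp add: hyp_metric_def inner_diff_left inner_diff_right divide_simps inner_commute [of x v] inner_commute [of y v])
        (simp add: power2_eq_square algebra_simps)
    also have "\<dots> = ((hyp_cosh v x * R v * R x) * (hyp_cosh v y * R v * R y)
        - (hyp_cosh x y * R x * R y) * (R v)\<^sup>2) / ((R v)\<^sup>2)\<^sup>2"
      using that assms by (simp only: ip R(2))
    also have "\<dots> = (R x * R y / (R v)\<^sup>2) * (hyp_cosh v x * hyp_cosh v y - hyp_cosh x y)"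
      using R(1) [OF assms(1)] by (simp add: field_simps power2_eq_square)
    finally show ?thesis .
  qed
  have c: "0 < R a * R b / (R v)\<^sup>2"
    using R(1) [OF assms(1)] R(1) [OF assms(2)] R(1) [OF assms(3)] by simp
  have "sqrt (hyp_metric v (a - v) (a - v) * hyp_metric v (b - v) (b - v)) =
      sqrt ((R a * R b / (R v)\<^sup>2)\<^sup>2 * (((hyp_cosh v a)\<^sup>2 - 1) * ((hyp_cosh v b)\<^sup>2 - 1)))"
    unfolding m [OF assms(2) assms(2)] m [OF assms(3) assms(3)]
    using R(1) [OF assms(1)]
    by (simp only: one [OF assms(2)] one [OF assms(3)]) (simp add: power2_eq_square)
  also have "\<dots> = (R a * R b / (R v)\<^sup>2) * sqrt (((hyp_cosh v a)\<^sup>2 - 1) * ((hyp_cosh v b)\<^sup>2 - 1))"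
    using c by (simp only: real_sqrt_mult real_sqrt_abs abs_of_pos)
  finally show ?thesis
    unfolding hyp_angle_def m [OF assms(2) assms(3)]
    using R(1) [OF assms(1)] R(1) [OF assms(2)] R(1) [OF assms(3)] by simp
qed

lemma hyp_isometry_hyp_cosh:
  assumes "hyp_isometry g" "x \<in> hyp_plane" "y \<in> hyp_plane"
  shows "hyp_cosh (g x) (g y) = hyp_cosh x y"
proof -
  have g: "g x \<in> hyp_plane" "g y \<in> hyp_plane"
    using assms unfolding hyp_isometry_def bij_betw_def by blast+
  have "arcosh (hyp_cosh (g x) (g y)) = arcosh (hyp_cosh x y)"
    using assms unfolding hyp_isometry_def hyp_dist_def hyp_cosh_def by blast
  then have "cosh (arcosh (hyp_cosh (g x) (g y))) = cosh (arcosh (hyp_cosh x y))"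
    by (rule arg_cong)
  then show ?thesis
    using hyp_cosh_ge_1 [OF g] hyp_cosh_ge_1 [OF assms(2,3)] by (simp add: cosh_arcosh_real)
qed

lemma hyp_isometry_hyp_angle:
  assumes "hyp_isometry g" "v \<in> hyp_plane" "a \<in> hyp_plane" "b \<in> hyp_plane"
  shows "hyp_angle (g v) (g a) (g b) = hyp_angle v a b"
proof -
  have "g v \<in> hyp_plane" "g a \<in> hyp_plane" "g b \<in> hyp_plane"
    using assms unfolding hyp_isometry_def bij_betw_def by blast+
  then show ?thesis
    using assms by (simp only: hyp_angle_hyp_cosh hyp_isometry_hyp_cosh)
qed

section \<open>Gauss-Bonnet for triangles\<close>

text \<open>
  The integral of the area density over the vertical segment from \<open>(x, 0)\<close> to \<open>(x, y)\<close>.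
\<close>

definition strip_integrand :: "real \<Rightarrow> real \<Rightarrow> real" where
  "strip_integrand x y = y / ((1 - x\<^sup>2) * sqrt (1 - x\<^sup>2 - y\<^sup>2))"

definition up_angle :: "real^2 \<Rightarrow> real^2 \<Rightarrow> real" where
  "up_angle v b = hyp_angle v (v + up) b"

definition pt :: "real \<Rightarrow> real \<Rightarrow> real^2" where
  "pt x y = x *\<^sub>R axis 1 1 + y *\<^sub>R up"

lemma pt_nth [simp]: "pt x y $ 1 = x" "pt x y $ 2 = y"
  by (simp_all add: pt_def axis_def)

lemma pt_eta [simp]: "pt (v $ 1) (v $ 2) = v"
  by (simp add: vec_eq_iff forall_2)

lemma hyp_plane_2: "norm (v::real^2) < 1 \<longleftrightarrow> (v $ 1)\<^sup>2 + (v $ 2)\<^sup>2 < 1"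
  using abs_square_less_1 [of "norm v"] dot_square_norm [of v]
  by (simp add: inner_2 flip: power2_eq_square)

lemma density_pt:
  assumes "pt x y \<in> hyp_plane"
  shows "hyp_area_density (pt x y) = 1 / ((1 - x\<^sup>2 - y\<^sup>2) * sqrt (1 - x\<^sup>2 - y\<^sup>2))"
proof -
  have "0 < 1 - x\<^sup>2 - y\<^sup>2"
    using assms by (simp add: hyp_plane_2)
  have n: "1 - (norm (pt x y))\<^sup>2 = 1 - x\<^sup>2 - y\<^sup>2"
    unfolding power2_norm_eq_inner inner_2 by (simp add: power2_eq_square)
  show ?thesis
    unfolding hyp_area_density_eq [OF assms] n
    using \<open>0 < 1 - x\<^sup>2 - y\<^sup>2\<close> by (simp add: power3_eq_cube real_sqrt_mult)
qed

lemma strip_integrand_deriv: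
  assumes "pt x y \<in> hyp_plane"
  shows "(strip_integrand x has_real_derivative hyp_area_density (pt x y)) (at y)"
proof -
  define r where "r = 1 - x\<^sup>2 - y\<^sup>2"
  have r: "0 < r"
    using assms by (simp add: hyp_plane_2 r_def)
  have x: "1 - x\<^sup>2 = r + y\<^sup>2" by (simp add: r_def)
  have "0 < r + y\<^sup>2" using r by (simp add: add_pos_nonneg)
  have "((\<lambda>y. y / sqrt (1 - x\<^sup>2 - y\<^sup>2)) has_real_derivative
      (1 * sqrt r - y * (- (2 * y) * (inverse (sqrt r) / 2))) / (sqrt r * sqrt r)) (at y)"
    using r unfolding r_def
    by (auto intro!: derivative_eq_intros simp: field_simps)
  then have "((\<lambda>y. y / sqrt (1 - x\<^sup>2 - y\<^sup>2) / (1 - x\<^sup>2)) has_real_derivative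
      (1 * sqrt r - y * (- (2 * y) * (inverse (sqrt r) / 2))) / (sqrt r * sqrt r) / (1 - x\<^sup>2)) (at y)"
    by (rule DERIV_cdivide)
  moreover have "(1 * sqrt r - y * (- (2 * y) * (inverse (sqrt r) / 2))) / (sqrt r * sqrt r) / (1 - x\<^sup>2)
      = hyp_area_density (pt x y)"
  proof -
    have "1 * sqrt r - y * (- (2 * y) * (inverse (sqrt r) / 2)) = (r + y\<^sup>2) / sqrt r"
      using r by (simp add: field_simps power2_eq_square)
    then show ?thesis
      using r \<open>0 < r + y\<^sup>2\<close> unfolding density_pt [OF assms] x r_def [symmetric] by simp
  qed
  moreover have "strip_integrand x = (\<lambda>y. y / sqrt (1 - x\<^sup>2 - y\<^sup>2) / (1 - x\<^sup>2))"
    by (simp add: strip_integrand_def fun_eq_iff mult.commute)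
  ultimately show ?thesis
    by simp
qed

text \<open>
  The cotangent of the hyperbolic angle between the line \<open>y = m x + k\<close>, directed to the right, and
  the upward direction at the point with first coordinate \<open>x\<close>.
\<close>

definition line_slope :: "real \<Rightarrow> real \<Rightarrow> real \<Rightarrow> real" where
  "line_slope m k x = (m + k * x) / sqrt (1 - x\<^sup>2 - (m * x + k)\<^sup>2)"

text \<open>
  The core of Gauss-Bonnet: along a geodesic, the angle with the vertical direction decreases at
  the rate given by a primitive of the area form.
\<close>

lemma line_slope_deriv:
  assumes "pt x (m * x + k) \<in> hyp_plane"
  shows "((\<lambda>x. arctan (line_slope m k x)) has_real_derivative strip_integrand x (m * x + k)) (at x)"
proof -
  define y where "y = m * x + k"
  define r where "r = 1 - x\<^sup>2 - y\<^sup>2"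
  define w where "w = 1 + m\<^sup>2 - k\<^sup>2"
  have r: "0 < r"
    using assms by (simp add: hyp_plane_2 r_def y_def)
  have x: "0 < 1 - x\<^sup>2"
    using r zero_le_power2 [of y] unfolding r_def by linarith
  have k: "k = y - m * x" by (simp add: y_def)
  have e1: "r + (m + k * x)\<^sup>2 = (1 - x\<^sup>2) * w"
    by (simp add: r_def w_def k power2_eq_square algebra_simps)
  have e2: "k * r + (m + k * x) * (x + m * y) = y * w"
    by (simp add: r_def w_def k power2_eq_square algebra_simps)
  have "0 < r + (m + k * x)\<^sup>2" using r by (simp add: add_pos_nonneg)
  with x have w: "0 < w"
    unfolding e1 by (simp add: zero_less_mult_iff)
  have "((\<lambda>x. line_slope m k x) has_real_derivative
      (k * sqrt r - (m + k * x) * (- (2 * x + 2 * m * y) * (inverse (sqrt r) / 2))) / (sqrt r * sqrt r)) (at x)"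
    using r unfolding r_def line_slope_def y_def
    by (auto intro!: derivative_eq_intros simp: field_simps)
  moreover have "k * sqrt r - (m + k * x) * (- (2 * x + 2 * m * y) * (inverse (sqrt r) / 2)) = y * w / sqrt r"
    unfolding e2 [symmetric] using r by (simp add: field_simps)
  ultimately have d: "((\<lambda>x. line_slope m k x) has_real_derivative y * w / sqrt r / r) (at x)"
    using r by simp
  have "(line_slope m k x)\<^sup>2 = (m + k * x)\<^sup>2 / r"
    using r by (simp add: line_slope_def power_divide flip: r_def y_def)
  then have "1 + (line_slope m k x)\<^sup>2 = (r + (m + k * x)\<^sup>2) / r"
    using r by (simp add: add_divide_distrib)
  then have "inverse (1 + (line_slope m k x)\<^sup>2) * (y * w / sqrt r / r) = y / ((1 - x\<^sup>2) * sqrt r)"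
    unfolding e1 using r x w by simp
  then show ?thesis
    using DERIV_chain2 [OF DERIV_arctan d]
    by (simp add: strip_integrand_def flip: r_def y_def)
qed

lemma up_angle_line_slope:
  assumes v: "v \<in> hyp_plane" "v $ 2 = m * v $ 1 + k"
    and b: "b $ 2 = m * b $ 1 + k" "b $ 1 \<noteq> v $ 1"
  shows "up_angle v b = pi / 2 - sgn (b $ 1 - v $ 1) * arctan (line_slope m k (v $ 1))"
proof -
  define x y r q where "x = v $ 1" and "y = v $ 2" and "r = 1 - x\<^sup>2 - y\<^sup>2" and "q = line_slope m k x"
  define c where "c = b $ 1 - x"
  have r: "0 < r"
    using v(1) by (simp add: hyp_plane_2 r_def x_def y_def)
  have y: "y = m * x + k" using v by (simp add: x_def y_def)
  have vp: "v = pt x y" by (simp add: x_def y_def)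
  have vv: "1 - v \<bullet> v = r"
    by (simp add: inner_2 r_def x_def y_def power2_eq_square)
  define D where "D = hyp_area_density v"
  have D: "D = 1 / (r * sqrt r)"
    using density_pt v(1) by (simp add: vp D_def r_def)
  have Dp: "0 < D" using r by (simp add: D)
  have q: "q = (m + k * x) / sqrt r"
    by (simp add: q_def line_slope_def r_def y)
  have c: "c \<noteq> 0" "b - v = c *\<^sub>R pt 1 m"
    using b by (simp_all add: c_def x_def vec_eq_iff forall_2 v(2) algebra_simps)
  have "hyp_metric v (pt 1 m) up = m / r + (x + m * y) * y / r\<^sup>2"
    unfolding hyp_metric_def vv by (simp add: inner_2 x_def y_def mult.commute)
  also have "\<dots> = (m + k * x) / r\<^sup>2"
    using r by (simp add: field_simps power2_eq_square) (simp add: r_def y power2_eq_square algebra_simps)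
  also have "\<dots> = D * q"
    using r by (simp add: D q power2_eq_square)
  finally have "conf v (pt 1 m) = of_real D * Complex q 1"
    by (simp add: conf_def complex_eq_iff D_def)
  then have cb: "conf v (b - v) = of_real (c * D) * Complex q 1"
    by (simp add: c conf_scale)
  have cu: "conf v up = of_real (hyp_metric v up up)"
    by (simp add: conf_def complex_eq_iff)
  have pos: "0 < hyp_metric v up up"
    using v hyp_metric_pos by simp
  have ne: "v + up \<noteq> v" "b \<noteq> v"
    using b by auto
  have A: "\<bar>Arg (Complex q 1)\<bar> = pi / 2 - arctan q"
  proof -
    have "\<bar>Arg (Complex q 1)\<bar> = arccos (q / sqrt (1 + q\<^sup>2))"
      using arccos_Re [of "Complex q 1"] by (simp add: cmod_def add.commute complex_eq_iff)
    also have "\<dots> = arccos (cos (pi / 2 - arctan q))"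
      by (simp add: cos_diff sin_arctan)
    also have "\<dots> = pi / 2 - arctan q"
      using arctan_bounded [of q] by (intro arccos_cos) auto
    finally show ?thesis .
  qed
  have "up_angle v b = \<bar>Arg (conf v (b - v) / of_real (hyp_metric v up up))\<bar>"
    unfolding up_angle_def hyp_angle_conf [OF v(1) ne] by (simp add: cu)
  also have "\<dots> = \<bar>Arg (of_real (c * D) * Complex q 1)\<bar>"
    unfolding Arg_divide_of_real [OF pos] cb ..
  also have "\<dots> = pi / 2 - sgn c * arctan q"
  proof (cases "c > 0")
    case True
    then show ?thesis
      using Dp A Arg_times_of_real [of "c * D"] by simp
  next
    case False
    then have "c < 0" using c by simp
    then have "0 < - c * D" using Dp by (simp add: mult_neg_pos)
    have "Arg (of_real (c * D) * Complex q 1) = Arg (of_real (- c * D) * (- Complex q 1))"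
      by simp
    also have "\<dots> = Arg (- Complex q 1)"
      by (rule Arg_times_of_real [OF \<open>0 < - c * D\<close>])
    finally have "\<bar>Arg (of_real (c * D) * Complex q 1)\<bar> = pi - \<bar>Arg (Complex q 1)\<bar>"
      using abs_Arg_minus [of "Complex q 1"] by (simp add: complex_eq_iff)
    then show ?thesis
      using A \<open>c < 0\<close> by simp
  qed
  finally show ?thesis
    by (simp add: c_def q_def x_def)
qed

lemma continuous_strip_integrand:
  assumes "pt x (m * x + k) \<in> hyp_plane"
  shows "isCont (\<lambda>x. strip_integrand x (m * x + k)) x"
proof -
  have "0 < 1 - x\<^sup>2 - (m * x + k)\<^sup>2"
    using assms by (simp add: hyp_plane_2)
  moreover from this have "0 < 1 - x\<^sup>2"
    using zero_le_power2 [of "m * x + k"] by linarith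
  ultimately show ?thesis
    unfolding strip_integrand_def by (intro continuous_intros) auto
qed

lemma segment_in_hyp_plane:
  assumes "a \<in> hyp_plane" "b \<in> hyp_plane" "a $ 2 = m * a $ 1 + k" "b $ 2 = m * b $ 1 + k"
    and "min (a $ 1) (b $ 1) \<le> x" "x \<le> max (a $ 1) (b $ 1)" "a $ 1 \<noteq> b $ 1"
  shows "pt x (m * x + k) \<in> hyp_plane"
proof -
  define t where "t = (x - a $ 1) / (b $ 1 - a $ 1)"
  have t: "0 \<le> t" "t \<le> 1"
    using assms(5-7) by (auto simp: t_def min_def max_def divide_simps split: if_splits)
  have x: "x = (1 - t) * a $ 1 + t * b $ 1"
    using assms(7) by (simp add: t_def divide_simps) (simp add: algebra_simps)
  have "pt x (m * x + k) = (1 - t) *\<^sub>R a + t *\<^sub>R b"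
    unfolding vec_eq_iff forall_2 by (simp add: assms(3,4)) (simp add: x algebra_simps)
  then show ?thesis
    using convexD_alt [OF convex_ball assms(1,2) t] by simp
qed

text \<open>
  In the Klein model the verticals meet the horizontal diameter at right angles. For a segment
  above the diameter, the region between them is a quadrilateral with two right angles, and the value
  is its angle defect.
\<close>

lemma strip_integral:
  assumes "a \<in> hyp_plane" "b \<in> hyp_plane" "a $ 2 = m * a $ 1 + k" "b $ 2 = m * b $ 1 + k"
    and "a $ 1 \<noteq> b $ 1"
  shows "has_bochner_integral lborel
    (\<lambda>x. strip_integrand x (m * x + k) * indicator {min (a $ 1) (b $ 1)..max (a $ 1) (b $ 1)} x)
    (up_angle a b + up_angle b a - pi)"
proof -
  let ?l = "min (a $ 1) (b $ 1)" and ?u = "max (a $ 1) (b $ 1)"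
  have "has_bochner_integral lborel (\<lambda>x. strip_integrand x (m * x + k) * indicator {?l..?u} x)
    (arctan (line_slope m k ?u) - arctan (line_slope m k ?l))"
  proof (rule has_bochner_integral_FTC_Icc_real)
    fix x assume "?l \<le> x" "x \<le> ?u"
    from segment_in_hyp_plane [OF assms(1-4) this assms(5)]
    show "((\<lambda>x. arctan (line_slope m k x)) has_real_derivative strip_integrand x (m * x + k)) (at x)"
      "isCont (\<lambda>x. strip_integrand x (m * x + k)) x"
      by (simp_all add: line_slope_deriv continuous_strip_integrand)
  qed simp
  moreover have "up_angle a b + up_angle b a - pi = arctan (line_slope m k ?u) - arctan (line_slope m k ?l)"
    using assms up_angle_line_slope [of a m k b] up_angle_line_slope [of b m k a]
    by (cases "a $ 1 < b $ 1") simp_all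
  ultimately show ?thesis by simp
qed

lemma measurable_pt: "(\<lambda>p. pt (fst p) (snd p)) \<in> measurable lborel borel"
  by (auto simp: pt_def intro!: borel_measurable_continuous_onI continuous_intros)

text \<open>
  Lebesgue measure on vectors of length two as a product measure, for the use of Fubini's theorem.
\<close>

lemma lborel_pt: "(lborel :: (real^2) measure) = distr lborel borel (\<lambda>p. pt (fst p) (snd p))"
proof (rule lborel_eqI)
  fix l u :: "real^2"
  assume le: "\<And>b. b \<in> Basis \<Longrightarrow> l \<bullet> b \<le> u \<bullet> b"
  have le2: "l $ 1 \<le> u $ 1" "l $ 2 \<le> u $ 2"
    using le [of "axis 1 1"] le [of up] by (simp_all add: axis_in_Basis_iff inner_axis)
  have pre: "(\<lambda>p. pt (fst p) (snd p)) -` box l u = box (l $ 1, l $ 2) (u $ 1, u $ 2)"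
    proof -
    have "p \<in> box (l $ 1, l $ 2) (u $ 1, u $ 2) \<longleftrightarrow>
        (l $ 1 < fst p \<and> fst p < u $ 1) \<and> (l $ 2 < snd p \<and> snd p < u $ 2)" for p
      unfolding mem_box Basis_prod_def ball_Un by (cases p) simp
    then show ?thesis
      unfolding vimage_def mem_box_cart forall_2 by auto
  qed
  have "emeasure (distr lborel borel (\<lambda>p. pt (fst p) (snd p))) (box l u) =
      emeasure lborel (box (l $ 1, l $ 2) (u $ 1, u $ 2))"
    by (subst emeasure_distr) (use measurable_pt in \<open>simp_all add: pre\<close>)
  also have "\<dots> = ennreal ((u $ 1 - l $ 1) * (u $ 2 - l $ 2))"
    using le2 by (subst emeasure_lborel_box) (auto simp: Basis_prod_def prod.union_disjoint prod.reindex inj_on_def)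
  also have "(u $ 1 - l $ 1) * (u $ 2 - l $ 2) = (\<Prod>b\<in>Basis. (u - l) \<bullet> b)"
  proof -
    have "(Basis :: (real^2) set) = {axis 1 1, up}"
      by (auto simp: Basis_vec_def UNIV_2)
    then have "(\<Prod>b\<in>Basis. (u - l) \<bullet> b) = (\<Prod>b\<in>{axis 1 1, up}. (u - l) \<bullet> b)"
      by (rule arg_cong)
    also have "\<dots> = ((u - l) \<bullet> axis 1 1) * ((u - l) \<bullet> up)"
      by (subst prod.insert) (simp_all add: axis_eq_axis)
    finally show ?thesis
      by (simp add: inner_axis)
  qed
  finally show "emeasure (distr lborel borel (\<lambda>p. pt (fst p) (snd p))) (box l u) =
      ennreal (\<Prod>b\<in>Basis. (u - l) \<bullet> b)" .
qed simp

lemma continuous_on_hyp_area_density: 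
  assumes "S \<subseteq> hyp_plane" shows "continuous_on S hyp_area_density"
proof -
  have "continuous_on S (\<lambda>x. 1 / sqrt ((1 - (norm x)\<^sup>2) ^ 3))"
  proof (intro continuous_intros ballI)
    fix x assume "x \<in> S"
    then have "(norm x)\<^sup>2 < 1"
      using assms by (auto simp: abs_square_less_1)
    then show "sqrt ((1 - (norm x)\<^sup>2) ^ 3) \<noteq> 0" by simp
  qed
  then show ?thesis
    using assms by (subst continuous_on_cong [OF refl hyp_area_density_eq]) auto
qed

lemma set_integrable_hyp_area_density:
  assumes "compact S" "S \<subseteq> hyp_plane"
  shows "set_integrable lborel S hyp_area_density"
  unfolding set_integrable_def
  by (intro borel_integrable_compact assms continuous_on_hyp_area_density)

lemma hyp_area_between_graphs:
  fixes D :: "(real^2) set" and L U :: "real \<Rightarrow> real"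
  assumes D: "D = {v. v $ 1 \<in> I \<and> L (v $ 1) \<le> v $ 2 \<and> v $ 2 \<le> U (v $ 1)}"
    and "compact D" "D \<subseteq> hyp_plane" and LU: "\<And>x. x \<in> I \<Longrightarrow> L x \<le> U x"
  shows "hyp_area D = (LINT x|lborel. (strip_integrand x (U x) - strip_integrand x (L x)) * indicator I x)"
proof -
  define f where "f p = indicator D (pt (fst p) (snd p)) * hyp_area_density (pt (fst p) (snd p))" for p
  have int: "integrable lborel (\<lambda>v. indicator D v * hyp_area_density v)"
    using set_integrable_hyp_area_density [OF assms(2,3)] by (simp add: set_integrable_def)
  then have m2: "(\<lambda>v. indicator D v * hyp_area_density v) \<in> borel_measurable borel"
    by (simp add: borel_measurable_integrable)
  have "integrable (distr lborel borel (\<lambda>p. pt (fst p) (snd p))) (\<lambda>v. indicator D v * hyp_area_density v)"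
    using int by (simp add: lborel_pt [symmetric])
  then have fint: "integrable lborel f"
    unfolding f_def by (subst (asm) integrable_distr_eq [OF measurable_pt m2])
  have "hyp_area D = (LINT v|distr lborel borel (\<lambda>p. pt (fst p) (snd p)). indicator D v * hyp_area_density v)"
    by (simp add: hyp_area_def set_lebesgue_integral_def lborel_pt [symmetric])
  also have "\<dots> = (LINT p|lborel. f p)"
    unfolding f_def by (rule integral_distr [OF measurable_pt m2])
  also have "\<dots> = (LINT x|lborel. LINT y|lborel. f (x, y))"
    using fint unfolding lborel_prod [symmetric] by (rule lborel_pair.integral_fst' [symmetric])
  also have "\<dots> = (LINT x|lborel. (strip_integrand x (U x) - strip_integrand x (L x)) * indicator I x)"
  proof (rule Bochner_Integration.integral_cong [OF refl])
    fix x :: real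
    show "(LINT y|lborel. f (x, y)) = (strip_integrand x (U x) - strip_integrand x (L x)) * indicator I x"
    proof (cases "x \<in> I")
      case True
      have "(LINT y|lborel. f (x, y)) = (LINT y|lborel. hyp_area_density (pt x y) * indicator {L x..U x} y)"
        by (rule Bochner_Integration.integral_cong [OF refl])
          (simp add: f_def D True indicator_def)
      also have "\<dots> = strip_integrand x (U x) - strip_integrand x (L x)"
      proof (rule integral_FTC_Icc_real [OF LU [OF True]])
        fix y assume "L x \<le> y" "y \<le> U x"
        then have "pt x y \<in> D"
          using True by (simp add: D)
        then have p: "pt x y \<in> hyp_plane"
          using assms(3) by blast
        then show "(strip_integrand x has_real_derivative hyp_area_density (pt x y)) (at y)"
          by (rule strip_integrand_deriv)
        have "isCont hyp_area_density (pt x y)"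
          using continuous_on_hyp_area_density [OF order_refl] p
          by (simp add: continuous_on_eq_continuous_at)
        then show "isCont (\<lambda>y. hyp_area_density (pt x y)) y"
          by (rule continuous_within_compose2 [of _ _ "\<lambda>y. pt x y", rotated] isCont_o2 [rotated])
            (auto simp: pt_def intro!: continuous_intros)
      qed
      finally show ?thesis using True by simp
    qed (simp add: f_def D)
  qed
  finally show ?thesis .
qed

lemma triangle_vertical_side_eq:
  fixes a b c :: "real^2"
  assumes bc: "b $ 1 = c $ 1" "b $ 2 < c $ 2" and ab: "a $ 1 \<noteq> b $ 1"
    and m: "a $ 2 = m * a $ 1 + k" "b $ 2 = m * b $ 1 + k"
    and m': "a $ 2 = m' * a $ 1 + k'" "c $ 2 = m' * c $ 1 + k'"
  shows "convex hull {a, b, c} = {v. v $ 1 \<in> {min (a $ 1) (b $ 1)..max (a $ 1) (b $ 1)} \<and>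
    m * v $ 1 + k \<le> v $ 2 \<and> v $ 2 \<le> m' * v $ 1 + k'}" (is "_ = ?D")
proof (intro Set.set_eqI iffI)
  fix p assume "p \<in> convex hull {a, b, c}"
  then obtain u v w where uvw: "0 \<le> u" "0 \<le> v" "0 \<le> w" "u + v + w = 1"
      "p = u *\<^sub>R a + v *\<^sub>R b + w *\<^sub>R c"
    unfolding convex_hull_3 by auto
  have u: "u = 1 - v - w" using uvw by simp
  have p1: "p $ 1 = u * a $ 1 + (v + w) * b $ 1" and p2: "p $ 2 = u * a $ 2 + v * b $ 2 + w * c $ 2"
    using bc by (simp_all add: uvw(5) algebra_simps)
  have "p $ 1 \<in> {min (a $ 1) (b $ 1)..max (a $ 1) (b $ 1)}"
  proof -
    have "p $ 1 = (1 - (v + w)) *\<^sub>R a $ 1 + (v + w) *\<^sub>R b $ 1"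
      unfolding p1 by (simp add: u)
    then have "p $ 1 \<in> closed_segment (a $ 1) (b $ 1)"
      using uvw unfolding in_segment by (intro exI [of _ "v + w"]) auto
    then show ?thesis
      by (auto simp: closed_segment_eq_real_ivl split: if_splits)
  qed
  moreover have "m * p $ 1 + k = u * a $ 2 + (v + w) * b $ 2"
    unfolding p1 m by (simp add: u algebra_simps)
  then have "m * p $ 1 + k \<le> p $ 2"
    unfolding p2 using mult_left_mono [of "b $ 2" "c $ 2" w] bc uvw by (simp add: algebra_simps)
  moreover have "m' * p $ 1 + k' = u * a $ 2 + (v + w) * c $ 2"
    unfolding p1 m' bc(1) by (simp add: u algebra_simps)
  then have "p $ 2 \<le> m' * p $ 1 + k'"
    unfolding p2 using mult_left_mono [of "b $ 2" "c $ 2" v] bc uvw by (simp add: algebra_simps)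
  ultimately show "p \<in> ?D" by simp
next
  fix p assume p: "p \<in> ?D"
  then have "p $ 1 \<in> closed_segment (a $ 1) (b $ 1)"
    by (auto simp: closed_segment_eq_real_ivl min_def max_def split: if_splits)
  then obtain t where t: "0 \<le> t" "t \<le> 1" "p $ 1 = (1 - t) * a $ 1 + t * b $ 1"
    unfolding in_segment by auto
  define w where "w = (p $ 2 - (m * p $ 1 + k)) / (c $ 2 - b $ 2)"
  have e: "m * p $ 1 + k = (1 - t) * a $ 2 + t * b $ 2" 
    unfolding t(3) m by (simp add: algebra_simps)
  have e': "m' * p $ 1 + k' = (1 - t) * a $ 2 + t * c $ 2" 
    unfolding t(3) m' bc(1) by (simp add: algebra_simps)
  have "0 \<le> w"
    using p bc by (simp add: w_def)
  have "p $ 2 - (m * p $ 1 + k) \<le> t * (c $ 2 - b $ 2)"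
    using p e e' by (simp add: algebra_simps)
  then have "w \<le> t"
    using bc by (simp add: w_def pos_divide_le_eq)
  have "w * (c $ 2 - b $ 2) = p $ 2 - (m * p $ 1 + k)"
    using bc by (simp add: w_def)
  then have "p $ 2 = (1 - t) * a $ 2 + (t - w) * b $ 2 + w * c $ 2"
    unfolding e by (simp add: algebra_simps)
  then have "p = (1 - t) *\<^sub>R a + (t - w) *\<^sub>R b + w *\<^sub>R c"
    using t(3) bc by (simp add: vec_eq_iff forall_2 algebra_simps)
  then show "p \<in> convex hull {a, b, c}"
    unfolding convex_hull_3 using t \<open>0 \<le> w\<close> \<open>w \<le> t\<close>
    by (intro CollectI exI [of _ "1 - t"] exI [of _ "t - w"] exI [of _ w]) auto
qed

definition triangle_Gauss_Bonnet :: "real^2 \<Rightarrow> real^2 \<Rightarrow> real^2 \<Rightarrow> bool" where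
  "triangle_Gauss_Bonnet a b c \<longleftrightarrow>
    hyp_area (convex hull {a, b, c}) = pi - hyp_angle a b c - hyp_angle b c a - hyp_angle c a b"

lemma triangle_Gauss_Bonnet_rotate: "triangle_Gauss_Bonnet a b c \<Longrightarrow> triangle_Gauss_Bonnet b c a"
  unfolding triangle_Gauss_Bonnet_def by (simp add: insert_commute algebra_simps)

lemma triangle_Gauss_Bonnet_swap: "triangle_Gauss_Bonnet a b c \<Longrightarrow> triangle_Gauss_Bonnet a c b"
  unfolding triangle_Gauss_Bonnet_def
  by (simp add: insert_commute hyp_angle_commute [of _ b a] hyp_angle_commute [of _ c a] hyp_angle_commute [of _ c b])

text \<open>
  The area is the difference of the strips under the sides \<open>ac\<close> and \<open>ab\<close>. At \<open>b\<close> and \<open>c\<close> the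
  vertical direction is that of the side \<open>bc\<close>, and at \<open>a\<close> the angles with the vertical differ by the angle of the
  triangle.
\<close>

lemma triangle_Gauss_Bonnet_vertical_side:
  assumes in_plane: "a \<in> hyp_plane" "b \<in> hyp_plane" "c \<in> hyp_plane"
    and bc: "b $ 1 = c $ 1" "b $ 2 < c $ 2" and ab: "a $ 1 \<noteq> b $ 1"
  shows "triangle_Gauss_Bonnet a b c"
proof -
  \<comment> \<open>The lines through \<open>a\<close> and \<open>b\<close>, and through \<open>a\<close> and \<open>c\<close>.\<close>
  define m k where "m = (b $ 2 - a $ 2) / (b $ 1 - a $ 1)" and "k = a $ 2 - m * a $ 1"
  define m' k' where "m' = (c $ 2 - a $ 2) / (c $ 1 - a $ 1)" and "k' = a $ 2 - m' * a $ 1"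
  have "m * (b $ 1 - a $ 1) = b $ 2 - a $ 2" "m' * (c $ 1 - a $ 1) = c $ 2 - a $ 2"
    using ab bc by (simp_all add: m_def m'_def)
  then have m: "a $ 2 = m * a $ 1 + k" "b $ 2 = m * b $ 1 + k"
    and m': "a $ 2 = m' * a $ 1 + k'" "c $ 2 = m' * c $ 1 + k'"
    unfolding k_def k'_def right_diff_distrib by linarith+
  let ?T = "convex hull {a, b, c}"
  let ?I = "{min (a $ 1) (b $ 1)..max (a $ 1) (b $ 1)}"
  note T = triangle_vertical_side_eq [OF bc ab m m']
  have sub: "?T \<subseteq> hyp_plane"
    using in_plane by (intro hull_minimal) auto
  have le: "m * x + k \<le> m' * x + k'" if "x \<in> ?I" for x
  proof -
    from that have "x \<in> closed_segment (a $ 1) (b $ 1)"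
      by (auto simp: closed_segment_eq_real_ivl min_def max_def split: if_splits)
    then obtain t where t: "0 \<le> t" "t \<le> 1" "x = (1 - t) * a $ 1 + t * b $ 1"
      unfolding in_segment by auto
    have "m * x + k = (1 - t) * a $ 2 + t * b $ 2" 
      unfolding t(3) m by (simp add: algebra_simps)
    moreover have "m' * x + k' = (1 - t) * a $ 2 + t * c $ 2" 
      unfolding t(3) m' bc(1) by (simp add: algebra_simps)
    ultimately show ?thesis
      using mult_left_mono [of "b $ 2" "c $ 2" t] t(1) bc(2) by linarith
  qed
  have ac: "a $ 1 \<noteq> c $ 1" using ab bc by simp
  have sl: "has_bochner_integral lborel (\<lambda>x. strip_integrand x (m * x + k) * indicator ?I x)
      (up_angle a b + up_angle b a - pi)"
    by (rule strip_integral [OF in_plane(1,2) m ab])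
  have su: "has_bochner_integral lborel (\<lambda>x. strip_integrand x (m' * x + k') * indicator ?I x)
      (up_angle a c + up_angle c a - pi)"
    using strip_integral [OF in_plane(1,3) m' ac] by (simp add: bc(1))
  have "hyp_area ?T = (LINT x|lborel. (strip_integrand x (m' * x + k') - strip_integrand x (m * x + k)) * indicator ?I x)"
    by (rule hyp_area_between_graphs [OF T _ sub le]) (simp_all add: finite_imp_compact_convex_hull)
  also have "\<dots> = (up_angle a c + up_angle c a - pi) - (up_angle a b + up_angle b a - pi)"
    unfolding left_diff_distrib
    by (rule has_bochner_integral_integral_eq [OF has_bochner_integral_diff [OF su sl]])
  finally have area: "hyp_area ?T = (up_angle a c + up_angle c a - pi) - (up_angle a b + up_angle b a - pi)" .
  have "up_angle b a = hyp_angle b c a"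
    unfolding up_angle_def
  proof (rule hyp_angle_direction)
    show "b + up - b = (1 / (c $ 2 - b $ 2)) *\<^sub>R (c - b)"
      using bc by (simp add: vec_eq_iff forall_2)
    show "0 < 1 / (c $ 2 - b $ 2)"
      using bc by simp
  qed
  moreover have "up_angle c a = pi - hyp_angle c a b"
  proof -
    have "(c + up) - c = - (1 / (c $ 2 - b $ 2)) *\<^sub>R (b - c)"
    proof -
      have "- (1 / (c $ 2 - b $ 2)) *\<^sub>R (b - c) = (1 / (c $ 2 - b $ 2)) *\<^sub>R (c - b)"
        by (metis minus_diff_eq scaleR_minus_left scaleR_minus_right)
      also have "\<dots> = up"
        using bc by (simp add: vec_eq_iff forall_2)
      finally show ?thesis by simp
    qed
    then have "hyp_angle c (c + up) a = pi - hyp_angle c b a"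
      using bc ab in_plane by (intro hyp_angle_opposite [where c = "1 / (c $ 2 - b $ 2)"]) auto
    then show ?thesis
      by (simp add: up_angle_def hyp_angle_commute)
  qed
  moreover have "up_angle a b = up_angle a c + hyp_angle a b c"
  proof -
    have "hyp_angle a (a + up) b = hyp_angle a (a + up) c + hyp_angle a c b"
      by (rule hyp_angle_add [where s = "c $ 2 - b $ 2" and t = 1])
        (use bc ab in_plane in \<open>auto simp: vec_eq_iff forall_2 cross_def\<close>)
    then show ?thesis
      by (simp add: up_angle_def hyp_angle_commute [of a c b])
  qed
  ultimately show ?thesis
    unfolding triangle_Gauss_Bonnet_def area by simp
qed

lemma hyp_area_finite_UN:
  assumes "finite I" "\<And>i. i \<in> I \<Longrightarrow> compact (A i)" "\<And>i. i \<in> I \<Longrightarrow> A i \<subseteq> hyp_plane"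
    and "\<And>i j. i \<in> I \<Longrightarrow> j \<in> I \<Longrightarrow> i \<noteq> j \<Longrightarrow> negligible (A i \<inter> A j)"
  shows "hyp_area (\<Union>i\<in>I. A i) = (\<Sum>i\<in>I. hyp_area (A i))"
  unfolding hyp_area_def
proof (rule set_integral_finite_UN_AE [OF assms(1)])
  fix i j assume ij: "i \<in> I" "j \<in> I"
  show "AE x in lborel. x \<in> A i \<and> x \<in> A j \<longrightarrow> i = j"
  proof (cases "i = j")
    case False
    have "A i \<inter> A j \<in> sets borel"
      using ij assms(2) by (intro borel_closed closed_Int compact_imp_closed) auto
    moreover have "emeasure lborel (A i \<inter> A j) = 0"
      using assms(4) [OF ij False] calculation
      by (simp add: negligible_iff_null_sets null_sets_def emeasure_completion)
    ultimately have "A i \<inter> A j \<in> null_sets lborel"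
      by auto
    then show ?thesis
      by (rule AE_I' [rotated 1, OF _ , rotated]) auto
  qed simp
next
  fix i assume i: "i \<in> I"
  then show "A i \<in> sets lborel"
    using assms(2) [OF i] by (simp add: borel_compact)
  show "set_integrable lborel (A i) hyp_area_density"
    by (rule set_integrable_hyp_area_density [OF assms(2) [OF i] assms(3) [OF i]])
qed

lemma hyp_area_Un:
  assumes "compact S" "compact T" "S \<subseteq> hyp_plane" "T \<subseteq> hyp_plane" "negligible (S \<inter> T)"
  shows "hyp_area (S \<union> T) = hyp_area S + hyp_area T"
proof -
  have "hyp_area (\<Union>i\<in>{True, False}. if i then S else T)
      = (\<Sum>i\<in>{True, False}. hyp_area (if i then S else T))"
    by (rule hyp_area_finite_UN) (use assms in \<open>auto simp: Int_commute split: if_splits\<close>)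
  then show ?thesis by (simp add: Un_commute)
qed

text \<open>
  Cutting along the segment \<open>bd\<close> creates two angles at \<open>d\<close> that add up to \<open>\<pi>\<close>. They
  compensate the \<open>\<pi>\<close> of the additional triangle.
\<close>

lemma triangle_Gauss_Bonnet_cevian:
  assumes in_plane: "a \<in> hyp_plane" "b \<in> hyp_plane" "c \<in> hyp_plane"
    and t: "0 < t" "t < 1" "d = (1 - t) *\<^sub>R a + t *\<^sub>R c"
    and vertical: "a $ 1 < b $ 1" "b $ 1 < c $ 1" "d $ 1 = b $ 1"
    and nc: "cross (b - a) (c - a) \<noteq> 0"
    and "triangle_Gauss_Bonnet a b d" "triangle_Gauss_Bonnet c b d"
  shows "triangle_Gauss_Bonnet a b c"
proof -
  have d: "d \<in> hyp_plane"
    using convexD_alt [OF convex_ball in_plane(1,3), of t] t by simp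
  have da: "d - a = t *\<^sub>R (c - a)" and dc: "d - c = (1 - t) *\<^sub>R (a - c)"
    and db: "d - b = (1 - t) *\<^sub>R (a - b) + t *\<^sub>R (c - b)"
    by (simp_all add: t(3) algebra_simps)
  have ad: "a - d = t *\<^sub>R (a - c)" and cd: "c - d = - ((1 - t) / t) *\<^sub>R (a - d)"
    using t(1) by (simp_all add: t(3) vec_eq_iff field_simps)
  have "cross (a - b) (c - b) = cross (b - a) (c - a) * - 1"
    by (simp add: cross_def algebra_simps)
  then have nb: "cross (a - b) (c - b) \<noteq> 0" using nc by simp
  have ne: "d \<noteq> b"
  proof
    assume "d = b"
    then have "b - a = t *\<^sub>R (c - a)"
      using da by simp
    then show False using nc by (simp add: cross_def)
  qed
  have ne2: "a \<noteq> d" "c \<noteq> d" using vertical by auto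
  have angle_b: "hyp_angle b a c = hyp_angle b a d + hyp_angle b d c"
    using t in_plane nb by (intro hyp_angle_add [OF _ _ db]) auto
  have angle_d: "hyp_angle d c b = pi - hyp_angle d a b"
    using t by (intro hyp_angle_opposite [OF d ne2(1) ne [symmetric] cd]) auto
  have angle_a: "hyp_angle a d b = hyp_angle a c b"
    by (rule hyp_angle_direction [OF da t(1)])
  have angle_c: "hyp_angle c d b = hyp_angle c a b"
    by (rule hyp_angle_direction [OF dc]) (use t in simp)
  let ?S = "convex hull {a, b, d}" and ?T = "convex hull {c, b, d}" and ?U = "convex hull {a, b, c}"
  have dU: "d \<in> ?U"
    unfolding t(3) by (intro convexD_alt [OF convex_convex_hull]) (use t in \<open>auto intro: hull_inc\<close>)
  have "?U = ?S \<union> ?T"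
  proof
    show "?S \<union> ?T \<subseteq> ?U"
      using dU by (intro Un_least hull_minimal) (auto intro: hull_inc)
    show "?U \<subseteq> ?S \<union> ?T"
    proof
      fix p assume "p \<in> ?U"
      then have "p \<in> convex hull (insert b {a, c})" by (simp add: insert_commute)
      then obtain q where q: "q \<in> convex hull {a, c}" "p \<in> closed_segment b q"
        unfolding convex_hull_insert_segments by auto
      then have "q \<in> closed_segment a c" by (simp add: segment_convex_hull)
      moreover have "d \<in> closed_segment a c"
        using t unfolding in_segment by (intro exI [of _ t]) auto
      ultimately have "q \<in> closed_segment a d \<or> q \<in> closed_segment c d"
        using Un_closed_segment [of d a c] by (auto simp: closed_segment_commute)
      then have "q \<in> ?S \<or> q \<in> ?T"
        unfolding segment_convex_hull
        using hull_mono [of "{a, d}" "{a, b, d}" convex] hull_mono [of "{c, d}" "{c, b, d}" convex] by blast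
      moreover have "b \<in> ?S" "b \<in> ?T" by (simp_all add: hull_inc)
      ultimately show "p \<in> ?S \<union> ?T"
        using q(2) closed_segment_subset [of b ?S q] closed_segment_subset [of b ?T q]
        by (auto simp: convex_convex_hull)
    qed
  qed
  moreover have "negligible (?S \<inter> ?T)"
  proof (rule negligible_subset)
    have half: "convex {v::real^2. v $ 1 \<le> x}" "convex {v::real^2. v $ 1 \<ge> x}" for x
      using convex_halfspace_le [of "axis 1 1 :: real^2" x] convex_halfspace_ge [of x "axis 1 1 :: real^2"]
      by (simp_all add: inner_axis' )
    have "?S \<subseteq> {v. v $ 1 \<le> b $ 1}" "?T \<subseteq> {v. v $ 1 \<ge> b $ 1}"
      by (intro hull_minimal half; use vertical in simp)+
    then show "?S \<inter> ?T \<subseteq> {v. v $ 1 = b $ 1}"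
      by fastforce
    show "negligible {v :: real^2. v $ 1 = b $ 1}"
      using negligible_standard_hyperplane [of "axis 1 1 :: real^2" "b $ 1"]
      by (simp add: inner_axis axis_in_Basis_iff)
  qed
  moreover have "compact ?S" "compact ?T"
    by (simp_all add: finite_imp_compact_convex_hull)
  moreover have "?S \<subseteq> hyp_plane" "?T \<subseteq> hyp_plane"
    by (rule hull_minimal; use in_plane d in simp)+
  ultimately have "hyp_area ?U = hyp_area ?S + hyp_area ?T"
    by (simp add: hyp_area_Un)
  then show ?thesis
    using assms(11,12) angle_a angle_b angle_c angle_d
    unfolding triangle_Gauss_Bonnet_def
    by (simp add: hyp_angle_commute [of a d b] hyp_angle_commute [of a c b] hyp_angle_commute [of b d a]
       hyp_angle_commute [of b c a] hyp_angle_commute [of b d c] hyp_angle_commute [of d b a]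
       hyp_angle_commute [of c b d] hyp_angle_commute [of c b a] hyp_angle_commute [of d b c])
qed

lemma triangle_Gauss_Bonnet_ordered:
  assumes in_plane: "a \<in> hyp_plane" "b \<in> hyp_plane" "c \<in> hyp_plane"
    and nc: "cross (b - a) (c - a) \<noteq> 0" and le: "a $ 1 \<le> b $ 1" "b $ 1 \<le> c $ 1"
  shows "triangle_Gauss_Bonnet a b c"
proof -
  have vertical: "triangle_Gauss_Bonnet p q r"
    if "p \<in> hyp_plane" "q \<in> hyp_plane" "r \<in> hyp_plane" "q $ 1 = r $ 1" "p $ 1 \<noteq> q $ 1" "q \<noteq> r" for p q r
  proof -
    have "q $ 2 \<noteq> r $ 2" using that by (auto simp: vec_eq_iff forall_2)
    then show ?thesis
      using that triangle_Gauss_Bonnet_vertical_side [of p q r]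
        triangle_Gauss_Bonnet_swap [OF triangle_Gauss_Bonnet_vertical_side [of p r q]]
      by (cases "q $ 2 < r $ 2") auto
  qed
  have ne: "b \<noteq> a" "c \<noteq> a" "b \<noteq> c" "\<not> (a $ 1 = b $ 1 \<and> b $ 1 = c $ 1)"
    using nc by (auto simp: cross_def)
  consider "a $ 1 = b $ 1" | "b $ 1 = c $ 1" | "a $ 1 < b $ 1" "b $ 1 < c $ 1"
    using le by linarith
  then show ?thesis
  proof cases
    case 1
    then show ?thesis
      using in_plane ne by (intro triangle_Gauss_Bonnet_rotate [OF vertical]) auto
  next
    case 2
    then show ?thesis
      using vertical [of a b c] in_plane ne by auto
  next
    case 3
    define t where "t = (b $ 1 - a $ 1) / (c $ 1 - a $ 1)"
    define d where "d = (1 - t) *\<^sub>R a + t *\<^sub>R c"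
    have t: "0 < t" "t < 1" using 3 by (simp_all add: t_def)
    have "t * (c $ 1 - a $ 1) = b $ 1 - a $ 1" using 3 by (simp add: t_def)
    then have d1: "d $ 1 = b $ 1" by (simp add: d_def algebra_simps)
    have d: "d \<in> hyp_plane"
      using convexD_alt [OF convex_ball in_plane(1,3), of t] t by (simp add: d_def)
    have "d \<noteq> b"
    proof
      assume "d = b"
      then have "b - a = t *\<^sub>R (c - a)" by (auto simp: d_def algebra_simps)
      then show False using nc by (simp add: cross_def)
    qed
    then have "triangle_Gauss_Bonnet a b d" "triangle_Gauss_Bonnet c b d"
      using 3 d1 \<open>d \<noteq> b\<close> by (intro vertical in_plane d; simp)+
    then show ?thesis
      by (rule triangle_Gauss_Bonnet_cevian [OF in_plane t d_def 3 d1 nc])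
  qed
qed

theorem hyp_area_triangle:
  assumes "a \<in> hyp_plane" "b \<in> hyp_plane" "c \<in> hyp_plane" "cross (b - a) (c - a) \<noteq> 0"
  shows "hyp_area (convex hull {a, b, c}) = pi - hyp_angle a b c - hyp_angle b c a - hyp_angle c a b"
proof -
  have s: "cross (c - a) (b - a) \<noteq> 0" "cross (c - b) (a - b) \<noteq> 0" "cross (a - b) (c - b) \<noteq> 0"
    "cross (a - c) (b - c) \<noteq> 0" "cross (b - c) (a - c) \<noteq> 0"
    using assms(4) by (simp_all add: cross_def algebra_simps)
  note o = triangle_Gauss_Bonnet_ordered
  note r = triangle_Gauss_Bonnet_rotate
  note w = triangle_Gauss_Bonnet_swap
  consider "a $ 1 \<le> b $ 1" "b $ 1 \<le> c $ 1" | "a $ 1 \<le> c $ 1" "c $ 1 \<le> b $ 1"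
    | "b $ 1 \<le> a $ 1" "a $ 1 \<le> c $ 1" | "b $ 1 \<le> c $ 1" "c $ 1 \<le> a $ 1"
    | "c $ 1 \<le> a $ 1" "a $ 1 \<le> b $ 1" | "c $ 1 \<le> b $ 1" "b $ 1 \<le> a $ 1"
    by linarith
  then have "triangle_Gauss_Bonnet a b c"
  proof cases
    case 1 then show ?thesis by (rule o [OF assms])
  next
    case 2 then show ?thesis by (rule w [OF o [OF assms(1,3,2) s(1)]])
  next
    case 3 then show ?thesis by (rule w [OF r [OF o [OF assms(2,1,3) s(3)]]])
  next
    case 4 then show ?thesis by (rule r [OF r [OF o [OF assms(2,3,1) s(2)]]])
  next
    case 5 then show ?thesis by (rule r [OF o [OF assms(3,1,2) s(4)]])
  next
    case 6 then show ?thesis by (rule w [OF r [OF r [OF o [OF assms(3,2,1) s(5)]]]])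
  qed
  then show ?thesis
    unfolding triangle_Gauss_Bonnet_def .
qed

section \<open>Angles around a point\<close>

definition open_sector :: "'a::real_vector \<Rightarrow> 'a \<Rightarrow> 'a set" where
  "open_sector u w = {s *\<^sub>R u + t *\<^sub>R w | s t. 0 < s \<and> 0 < t}"

definition closed_sector :: "'a::real_vector \<Rightarrow> 'a \<Rightarrow> 'a set" where
  "closed_sector u w = {s *\<^sub>R u + t *\<^sub>R w | s t. 0 \<le> s \<and> 0 \<le> t}"

lemma open_sector_commute: "open_sector u w = open_sector w u"
  unfolding open_sector_def by (intro Collect_cong) (metis add.commute)

lemma cis_in_open_sector_iff:
  assumes "u \<noteq> 0" "Im (w / u) > 0"
  shows "cis \<theta> \<in> open_sector u w \<longleftrightarrow> sin (\<theta> - Arg u) > 0 \<and> sin (Arg (w / u) - (\<theta> - Arg u)) > 0"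
proof -
  define \<alpha> \<delta> where "\<alpha> = Arg (w / u)" and "\<delta> = \<theta> - Arg u"
  have w: "w \<noteq> 0" using assms by auto
  have \<alpha>: "0 < \<alpha>" "\<alpha> < pi" using assms(2) Arg_lt_pi [of "w / u"] by (simp_all add: \<alpha>_def)
  then have sa: "0 < sin \<alpha>" by (rule sin_gt_zero)
  have u: "u = of_real (norm u) * cis (Arg u)"
    using rcis_cmod_Arg [of u] by (simp add: rcis_def)
  have "w / u = of_real (norm (w / u)) * cis \<alpha>"
    using rcis_cmod_Arg [of "w / u"] by (simp add: rcis_def \<alpha>_def)
  then have wu: "w = of_real (norm w / norm u) * cis \<alpha> * u"
    using assms by (simp add: norm_divide nonzero_divide_eq_eq)
  have key: "cis \<theta> = s *\<^sub>R u + t *\<^sub>R w \<longleftrightarrow> cos \<delta> = s * norm u + t * norm w * cos \<alpha> \<and> sin \<delta> = t * norm w * sin \<alpha>" for s t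
  proof -
    have "cis \<theta> = cis \<delta> * cis (Arg u)" by (simp add: \<delta>_def cis_mult)
    moreover have "s *\<^sub>R u + t *\<^sub>R w = (of_real (s * norm u) + of_real (t * norm w) * cis \<alpha>) * cis (Arg u)"
    proof -
      define n m U where "n = norm u" and "m = norm w" and "U = cis (Arg u)"
      have u': "u = of_real n * U" using u by (simp only: n_def U_def)
      have "w = of_real (m / n) * cis \<alpha> * u"
        by (rule wu [folded n_def m_def])
      then have "w = of_real (m / n) * cis \<alpha> * (of_real n * U)"
        by (simp only: u' [symmetric])
      then have w': "w = of_real m * cis \<alpha> * U"
        using assms(1) by (simp add: n_def)
      have "s *\<^sub>R u + t *\<^sub>R w = (of_real (s * n) + of_real (t * m) * cis \<alpha>) * U"
        unfolding u' w' by (simp add: scaleR_conv_of_real algebra_simps)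
      then show ?thesis
        by (simp only: n_def m_def U_def)
    qed
    ultimately have "cis \<theta> = s *\<^sub>R u + t *\<^sub>R w \<longleftrightarrow> cis \<delta> = of_real (s * norm u) + of_real (t * norm w) * cis \<alpha>"
      by simp
    then show ?thesis
      by (simp add: complex_eq_iff)
  qed
  show ?thesis
    unfolding \<alpha>_def [symmetric] \<delta>_def [symmetric]
  proof
    assume "cis \<theta> \<in> open_sector u w"
    then obtain s t where pos: "0 < s" "0 < t" and "cis \<theta> = s *\<^sub>R u + t *\<^sub>R w"
      unfolding open_sector_def by blast
    then have st: "cos \<delta> = s * norm u + t * norm w * cos \<alpha>" "sin \<delta> = t * norm w * sin \<alpha>"
      using key by blast+
    have "sin (\<alpha> - \<delta>) = s * norm u * sin \<alpha>"
      unfolding sin_diff st by (simp add: algebra_simps)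
    then show "0 < sin \<delta> \<and> 0 < sin (\<alpha> - \<delta>)"
      unfolding st(2) using pos sa assms(1) w by simp
  next
    assume pos: "0 < sin \<delta> \<and> 0 < sin (\<alpha> - \<delta>)"
    have "cos \<delta> * sin \<alpha> = sin (\<alpha> - \<delta>) + sin \<delta> * cos \<alpha>"
      by (simp add: sin_diff)
    then have c: "cos \<delta> = sin (\<alpha> - \<delta>) / sin \<alpha> + sin \<delta> / sin \<alpha> * cos \<alpha>"
      using sa by (simp only: nonzero_eq_divide_eq [symmetric] add_divide_distrib times_divide_eq_left
          less_imp_neq [THEN not_sym] not_False_eq_True)
    define s t where "s = sin (\<alpha> - \<delta>) / (norm u * sin \<alpha>)" and "t = sin \<delta> / (norm w * sin \<alpha>)"
    have "s * norm u = sin (\<alpha> - \<delta>) / sin \<alpha>" "t * norm w = sin \<delta> / sin \<alpha>"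
      using assms(1) w by (simp_all add: s_def t_def)
    moreover have "sin \<delta> = sin \<delta> / sin \<alpha> * sin \<alpha>"
      using sa by simp
    ultimately have "cis \<theta> = s *\<^sub>R u + t *\<^sub>R w"
      unfolding key using c by metis
    moreover have "0 < s" "0 < t"
      using pos sa assms(1) w by (simp_all add: s_def t_def)
    ultimately show "cis \<theta> \<in> open_sector u w"
      unfolding open_sector_def by blast
  qed
qed

lemma sin_pos_two_iff:
  assumes "0 < \<alpha>" "\<alpha> < pi" "0 < \<delta>" "\<delta> < 2 * pi"
  shows "sin \<delta> > 0 \<and> sin (\<alpha> - \<delta>) > 0 \<longleftrightarrow> \<delta> < \<alpha>"
proof
  assume a: "sin \<delta> > 0 \<and> sin (\<alpha> - \<delta>) > 0"
  have "\<delta> < pi"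
    using a sin_le_zero [of \<delta>] assms by force
  show "\<delta> < \<alpha>"
  proof (rule ccontr)
    assume "\<not> \<delta> < \<alpha>"
    then have "0 \<le> sin (\<delta> - \<alpha>)"
      using assms \<open>\<delta> < pi\<close> by (intro sin_ge_zero) auto
    also have "sin (\<delta> - \<alpha>) = - sin (\<alpha> - \<delta>)"
      using sin_minus [of "\<alpha> - \<delta>"] by simp
    finally show False using a by simp
  qed
next
  assume "\<delta> < \<alpha>"
  then show "sin \<delta> > 0 \<and> sin (\<alpha> - \<delta>) > 0"
    using assms by (intro conjI sin_gt_zero) auto
qed

text \<open>
  The angle of a sector is measured as the length of the set of its directions. Additivity of angles
  around a point is then additivity of Lebesgue measure.
\<close>

definition directions :: "complex set \<Rightarrow> real set" where
  "directions C = {\<theta> \<in> {-pi<..pi}. cis \<theta> \<in> C}"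

text \<open>
  The directions run from \<open>Arg u\<close> to \<open>Arg u + Arg (w / u)\<close>. When this exceeds \<open>\<pi>\<close> the set splits into two
  intervals, because arguments are taken in \<open>(-\<pi>, \<pi>]\<close>.
\<close>

lemma directions_open_sector_aux:
  assumes "u \<noteq> 0" "Im (w / u) > 0"
  shows "directions (open_sector u w) \<in> fmeasurable lborel"
    and "measure lborel (directions (open_sector u w)) = Arg (w / u)"
proof -
  define \<alpha> \<beta> where "\<alpha> = Arg (w / u)" and "\<beta> = Arg u"
  have \<alpha>: "0 < \<alpha>" "\<alpha> < pi" using assms(2) Arg_lt_pi [of "w / u"] by (simp_all add: \<alpha>_def)
  have \<beta>: "-pi < \<beta>" "\<beta> \<le> pi" using mpi_less_Arg Arg_le_pi by (simp_all add: \<beta>_def)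
  have mem: "\<theta> \<in> directions (open_sector u w) \<longleftrightarrow>
      -pi < \<theta> \<and> \<theta> \<le> pi \<and> (\<beta> < \<theta> \<and> \<theta> < \<beta> + \<alpha> \<or> \<theta> < \<beta> + \<alpha> - 2 * pi)" for \<theta>
  proof (cases "-pi < \<theta> \<and> \<theta> \<le> pi")
    case True
    define \<delta> where "\<delta> = \<theta> - \<beta>"
    have "\<theta> \<in> directions (open_sector u w) \<longleftrightarrow> sin \<delta> > 0 \<and> sin (\<alpha> - \<delta>) > 0"
      using True cis_in_open_sector_iff [OF assms, of \<theta>] by (simp add: directions_def \<delta>_def \<alpha>_def \<beta>_def)
    also have "\<dots> \<longleftrightarrow> \<beta> < \<theta> \<and> \<theta> < \<beta> + \<alpha> \<or> \<theta> < \<beta> + \<alpha> - 2 * pi"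
    proof (cases \<delta> "0::real" rule: linorder_cases)
      case greater
      have "\<delta> < 2 * pi" using True \<beta> by (simp add: \<delta>_def)
      from sin_pos_two_iff [OF \<alpha> greater this] show ?thesis
        using greater True \<alpha> \<beta> by (auto simp: \<delta>_def)
    next
      case equal
      then show ?thesis using True \<alpha> \<beta> by (auto simp: \<delta>_def)
    next
      case less
      have "sin (\<alpha> - \<delta>) = sin (\<alpha> - (\<delta> + 2 * pi))"
        using sin_periodic [of "\<alpha> - (\<delta> + 2 * pi)"] by (simp add: algebra_simps)
      then show ?thesis
        using sin_pos_two_iff [OF \<alpha>, of "\<delta> + 2 * pi"] sin_periodic [of \<delta>] less True \<alpha> \<beta>
        by (auto simp: \<delta>_def)
    qed
    finally show ?thesis using True by simp
  qed (auto simp: directions_def)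
  have fm: "{x<..<y} \<in> fmeasurable lborel" "{x<..y} \<in> fmeasurable lborel" for x y :: real
    by (rule fmeasurableI; cases "x \<le> y"; simp)+
  have "directions (open_sector u w) \<in> fmeasurable lborel \<and> measure lborel (directions (open_sector u w)) = \<alpha>"
  proof (cases "\<beta> + \<alpha> \<le> pi")
    case True
    then have "directions (open_sector u w) = {\<beta><..<\<beta> + \<alpha>}"
      using \<alpha> \<beta> by (intro Set.set_eqI) (auto simp: mem)
    then show ?thesis using \<alpha> fm(1) by simp
  next
    case False
    then have eq: "directions (open_sector u w) = {\<beta><..pi} \<union> {-pi<..<\<beta> + \<alpha> - 2 * pi}"
      using \<alpha> \<beta> by (intro Set.set_eqI) (auto simp: mem)
    have "measure lborel ({\<beta><..pi} \<union> {-pi<..<\<beta> + \<alpha> - 2 * pi})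
        = measure lborel {\<beta><..pi} + measure lborel {-pi<..<\<beta> + \<alpha> - 2 * pi}"
    proof -
      have "{-pi<..<\<beta> + \<alpha> - 2 * pi} - {\<beta><..pi} = {-pi<..<\<beta> + \<alpha> - 2 * pi}"
        using \<alpha> by auto
      then show ?thesis by (simp add: measure_Un2 fm)
    qed
    then show ?thesis
      unfolding eq using False \<alpha> \<beta> by (auto intro!: fmeasurable.Un fm)
  qed
  then show "directions (open_sector u w) \<in> fmeasurable lborel"
    "measure lborel (directions (open_sector u w)) = Arg (w / u)"
    by (simp_all add: \<alpha>_def)
qed

lemma directions_open_sector:
  assumes "u \<noteq> 0" "w \<noteq> 0" "Im (w / u) \<noteq> 0"
  shows "directions (open_sector u w) \<in> fmeasurable lborel"
    and "measure lborel (directions (open_sector u w)) = \<bar>Arg (w / u)\<bar>"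
proof -
  have "directions (open_sector u w) \<in> fmeasurable lborel \<and>
      measure lborel (directions (open_sector u w)) = \<bar>Arg (w / u)\<bar>"
  proof (cases "Im (w / u) > 0")
    case True
    then show ?thesis
      using directions_open_sector_aux [OF assms(1) True] Arg_lt_pi [of "w / u"] by simp
  next
    case False
    then have "Im (w / u) < 0" using assms by simp
    then have "Im (inverse (w / u)) > 0"
      unfolding inverse_complex.sel by (intro divide_pos_pos) (auto simp: sum_power2_gt_zero_iff)
    then have "Im (u / w) > 0" by (simp only: inverse_divide)
    moreover have "Arg (u / w) = - Arg (w / u)"
      using Arg_inverse [of "w / u"] assms(3) by (simp add: complex_is_Real_iff)
    ultimately show ?thesis
      using directions_open_sector_aux [OF assms(2), of u] Arg_lt_pi [of "u / w"]
      by (simp add: open_sector_commute [of u w])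
  qed
  then show "directions (open_sector u w) \<in> fmeasurable lborel"
    "measure lborel (directions (open_sector u w)) = \<bar>Arg (w / u)\<bar>" by simp_all
qed

text \<open>
  The open sectors are disjoint and miss only the finitely many directions of their boundary rays.
\<close>

lemma sum_Arg_sectors:
  fixes u w :: "'i \<Rightarrow> complex"
  assumes "finite I" and nz: "\<And>i. i \<in> I \<Longrightarrow> u i \<noteq> 0" "\<And>i. i \<in> I \<Longrightarrow> w i \<noteq> 0"
    "\<And>i. i \<in> I \<Longrightarrow> Im (w i / u i) \<noteq> 0"
    and disj: "\<And>i j. i \<in> I \<Longrightarrow> j \<in> I \<Longrightarrow> i \<noteq> j \<Longrightarrow> open_sector (u i) (w i) \<inter> open_sector (u j) (w j) = {}"
    and cover: "(\<Union>i\<in>I. closed_sector (u i) (w i)) = UNIV"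
  shows "(\<Sum>i\<in>I. \<bar>Arg (w i / u i)\<bar>) = 2 * pi"
proof -
  let ?D = "\<lambda>i. directions (open_sector (u i) (w i))"
  let ?N = "(\<lambda>i. Arg (u i)) ` I \<union> (\<lambda>i. Arg (w i)) ` I"
  have "{-pi<..pi} \<subseteq> (\<Union>i\<in>I. ?D i) \<union> ?N"
  proof
    fix \<theta> :: real assume \<theta>: "\<theta> \<in> {-pi<..pi}"
    obtain i where i: "i \<in> I" "cis \<theta> \<in> closed_sector (u i) (w i)"
      using cover by blast
    then obtain s t where st: "0 \<le> s" "0 \<le> t" "cis \<theta> = s *\<^sub>R u i + t *\<^sub>R w i"
      unfolding closed_sector_def by blast
    consider "0 < s" "0 < t" | "s = 0" | "t = 0" using st by linarith
    then show "\<theta> \<in> (\<Union>i\<in>I. ?D i) \<union> ?N"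
    proof cases
      case 1
      then have "cis \<theta> \<in> open_sector (u i) (w i)"
        using st(3) unfolding open_sector_def by blast
      then show ?thesis using \<theta> i(1) by (auto simp: directions_def)
    next
      case 2
      then have "cis \<theta> = of_real t * w i" using st(3) by (simp add: scaleR_conv_of_real)
      moreover have "t \<noteq> 0" using calculation by (metis cis_neq_zero mult_zero_left of_real_0)
      ultimately have "Arg (cis \<theta>) = Arg (w i)" using st Arg_times_of_real [of t "w i"] by simp
      then show ?thesis using i(1) \<theta> by (auto simp: Arg_cis)
    next
      case 3
      then have "cis \<theta> = of_real s * u i" using st(3) by (simp add: scaleR_conv_of_real)
      moreover have "s \<noteq> 0" using calculation by (metis cis_neq_zero mult_zero_left of_real_0)
      ultimately have "Arg (cis \<theta>) = Arg (u i)" using st Arg_times_of_real [of s "u i"] by simp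
      then show ?thesis using i(1) \<theta> by (auto simp: Arg_cis)
    qed
  qed
  moreover have "(\<Union>i\<in>I. ?D i) \<subseteq> {-pi<..pi}"
    by (auto simp: directions_def)
  moreover have null: "?N \<in> null_sets lborel"
    using assms(1) by (intro finite_imp_null_set_lborel) auto
  ultimately have "AE \<theta> in lborel. \<theta> \<in> (\<Union>i\<in>I. ?D i) \<longleftrightarrow> \<theta> \<in> {-pi<..pi}"
    by (intro AE_I' [OF null]) blast
  moreover have "(\<Union>i\<in>I. ?D i) \<in> sets lborel"
    using directions_open_sector(1) [OF nz] by (intro sets.finite_UN assms(1) fmeasurableD)
  ultimately have "measure lborel (\<Union>i\<in>I. ?D i) = measure lborel {-pi<..pi}"
    by (intro measure_eq_AE) auto
  moreover have "measure lborel (\<Union>i\<in>I. ?D i) = (\<Sum>i\<in>I. measure lborel (?D i))"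
  proof (rule measure_UNION' [OF assms(1)])
    have "directions A \<inter> directions B = {}" if "A \<inter> B = {}" for A B
      using that by (auto simp: directions_def)
    then show "pairwise (\<lambda>i j. disjnt (?D i) (?D j)) I"
      using disj by (intro pairwiseI) (simp add: disjnt_def)
  qed (rule directions_open_sector(1) [OF nz])
  moreover have "\<dots> = (\<Sum>i\<in>I. \<bar>Arg (w i / u i)\<bar>)"
    by (intro sum.cong refl directions_open_sector(2) nz)
  ultimately show ?thesis by simp
qed

lemma conf_surj:
  assumes "v \<in> hyp_plane" shows "\<exists>d. conf v d = z"
proof -
  have pos: "0 < hyp_metric v up up" "0 < hyp_area_density v"
    using assms hyp_metric_pos [OF assms up_nz] hyp_area_density_pos by auto
  define x where "x = Im z / hyp_area_density v"
  define y where "y = (Re z - x * hyp_metric v (axis 1 1) up) / hyp_metric v up up"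
  have "conf v (x *\<^sub>R axis 1 1 + y *\<^sub>R up) = z"
    using pos by (simp add: conf_def complex_eq_iff hyp_metric_add_left hyp_metric_scale_left x_def y_def)
  then show ?thesis ..
qed

theorem sum_hyp_angle_sectors:
  fixes a b :: "'i \<Rightarrow> real^2"
  assumes v: "v \<in> hyp_plane" and "finite I" and nz: "\<And>i. i \<in> I \<Longrightarrow> cross (a i - v) (b i - v) \<noteq> 0"
    and disj: "\<And>i j. i \<in> I \<Longrightarrow> j \<in> I \<Longrightarrow> i \<noteq> j \<Longrightarrow>
      open_sector (a i - v) (b i - v) \<inter> open_sector (a j - v) (b j - v) = {}"
    and cover: "(\<Union>i\<in>I. closed_sector (a i - v) (b i - v)) = UNIV"
  shows "(\<Sum>i\<in>I. hyp_angle v (a i) (b i)) = 2 * pi"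
proof -
  let ?u = "\<lambda>i. conf v (a i - v)" and ?w = "\<lambda>i. conf v (b i - v)"
  have nz': "a i - v \<noteq> 0" "b i - v \<noteq> 0" if "i \<in> I" for i
    using cross_nz [OF nz [OF that]] by simp_all
  have lin: "conf v (s *\<^sub>R d + t *\<^sub>R e) = s *\<^sub>R conf v d + t *\<^sub>R conf v e" for s t d e
    unfolding conf_add conf_scale by (simp add: scaleR_conv_of_real)
  have inj: "inj (conf v)"
  proof (rule injI)
    fix d e assume "conf v d = conf v e"
    then show "d = e" using conf_eq_0_iff [OF v, of "d - e"] by (simp add: conf_diff)
  qed
  have open_img: "open_sector (conf v d) (conf v e) = conf v ` open_sector d e" for d e
    unfolding open_sector_def lin [symmetric] by blast
  have closed_img: "closed_sector (conf v d) (conf v e) = conf v ` closed_sector d e" for d e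
    unfolding closed_sector_def lin [symmetric] by blast
  have "(\<Sum>i\<in>I. \<bar>Arg (?w i / ?u i)\<bar>) = 2 * pi"
  proof (rule sum_Arg_sectors [OF \<open>finite I\<close>])
    fix i assume i: "i \<in> I"
    show "?u i \<noteq> 0" "?w i \<noteq> 0" using nz' [OF i] v by (simp_all only: conf_eq_0_iff [OF v] not_False_eq_True)
    show "Im (?w i / ?u i) \<noteq> 0"
      unfolding Im_conf_quotient [OF v nz'(1) [OF i]]
      using less_imp_neq [OF Im_conf_quotient_coeff_pos [OF v nz'(1) [OF i]]] nz [OF i]
      by (simp only: mult_eq_0_iff neg_equal_0_iff_equal) auto
  next
    fix i j assume "i \<in> I" "j \<in> I" "i \<noteq> j"
    from disj [OF this] show "open_sector (?u i) (?w i) \<inter> open_sector (?u j) (?w j) = {}"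
      unfolding open_img image_Int [OF inj, symmetric] by simp
  next
    have "(\<Union>i\<in>I. closed_sector (?u i) (?w i)) = conf v ` (\<Union>i\<in>I. closed_sector (a i - v) (b i - v))"
      unfolding closed_img by blast
    also have "\<dots> = UNIV"
      unfolding cover surj_def using conf_surj [OF v] by metis
    finally show "(\<Union>i\<in>I. closed_sector (?u i) (?w i)) = UNIV" .
  qed
  moreover have "hyp_angle v (a i) (b i) = \<bar>Arg (?w i / ?u i)\<bar>" if "i \<in> I" for i
    using nz' [OF that] by (intro hyp_angle_conf v) auto
  ultimately show ?thesis
    by simp
qed

section \<open>Isometries and convexity\<close>

lemma hyp_isometry_in: "hyp_isometry g \<Longrightarrow> x \<in> hyp_plane \<Longrightarrow> g x \<in> hyp_plane"
  unfolding hyp_isometry_def bij_betw_def by blast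

lemma hyp_isometry_inj: "hyp_isometry g \<Longrightarrow> inj_on g hyp_plane"
  unfolding hyp_isometry_def bij_betw_def by blast

lemma hyp_isometry_image: "hyp_isometry g \<Longrightarrow> g ` hyp_plane = hyp_plane"
  unfolding hyp_isometry_def bij_betw_def by blast

lemma hyp_isometry_eq_iff:
  "hyp_isometry g \<Longrightarrow> x \<in> hyp_plane \<Longrightarrow> y \<in> hyp_plane \<Longrightarrow> g x = g y \<longleftrightarrow> x = y"
  by (rule inj_on_eq_iff [OF hyp_isometry_inj])

lemma hyp_isometry_inv_into:
  assumes "hyp_isometry g" shows "hyp_isometry (inv_into hyp_plane g)"
proof -
  have b: "bij_betw g hyp_plane hyp_plane" using assms by (simp add: hyp_isometry_def)
  have "hyp_dist (inv_into hyp_plane g x) (inv_into hyp_plane g y) = hyp_dist x y"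
    if "x \<in> hyp_plane" "y \<in> hyp_plane" for x y
  proof -
    have "inv_into hyp_plane g x \<in> hyp_plane" "inv_into hyp_plane g y \<in> hyp_plane"
      using bij_betwE [OF bij_betw_inv_into [OF b]] that by blast+
    moreover have "g (inv_into hyp_plane g x) = x" "g (inv_into hyp_plane g y) = y"
      using that hyp_isometry_image [OF assms] by (simp_all only: f_inv_into_f)
    ultimately show ?thesis
      using assms unfolding hyp_isometry_def by metis
  qed
  then show ?thesis
    using bij_betw_inv_into [OF b] unfolding hyp_isometry_def by metis
qed

lemma hyp_isometry_open_segment:
  assumes "hyp_isometry g" "v \<in> hyp_plane" "a \<in> hyp_plane" "b \<in> hyp_plane"
  shows "g v \<in> open_segment (g a) (g b) \<longleftrightarrow> v \<in> open_segment a b"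
proof (cases "v = a \<or> v = b")
  case True
  then show ?thesis by (auto simp: open_segment_def)
next
  case False
  then have "g a \<noteq> g v" "g b \<noteq> g v" "a \<noteq> v" "b \<noteq> v"
    using assms by (simp_all only: hyp_isometry_eq_iff) auto
  then show ?thesis
    using hyp_angle_eq_pi_iff [of v a b] hyp_angle_eq_pi_iff [of "g v" "g a" "g b"]
      hyp_isometry_hyp_angle [OF assms] hyp_isometry_in [OF assms(1,2)] assms(2) by simp
qed

lemma segment_in_ball:
  fixes a b :: "real^2"
  assumes "a \<in> hyp_plane" "b \<in> hyp_plane" shows "closed_segment a b \<subseteq> hyp_plane"
  using assms by (intro closed_segment_subset convex_ball)

text \<open>
  Betweenness is an angle condition and isometries preserve angles, so isometries are
  collineations and preserve convexity, convex hulls and faces.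
\<close>

lemma hyp_isometry_closed_segment:
  assumes g: "hyp_isometry g" and ab: "a \<in> hyp_plane" "b \<in> hyp_plane"
  shows "g ` closed_segment a b = closed_segment (g a) (g b)"
proof
  show "g ` closed_segment a b \<subseteq> closed_segment (g a) (g b)"
  proof (rule image_subsetI)
    fix v assume v: "v \<in> closed_segment a b"
    then have "v \<in> hyp_plane" using segment_in_ball [OF ab] by blast
    then show "g v \<in> closed_segment (g a) (g b)"
      using hyp_isometry_open_segment [OF g _ ab, of v] v
      by (auto simp: closed_segment_eq_open)
  qed
  show "closed_segment (g a) (g b) \<subseteq> g ` closed_segment a b"
  proof
    fix w assume w: "w \<in> closed_segment (g a) (g b)"
    then have "w \<in> hyp_plane"
      using segment_in_ball hyp_isometry_in [OF g] ab by blast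
    then obtain v where v: "v \<in> hyp_plane" "w = g v"
      using hyp_isometry_image [OF g] by blast
    then have "v \<in> closed_segment a b"
      using hyp_isometry_open_segment [OF g v(1) ab] w hyp_isometry_eq_iff [OF g v(1) ab(1)]
        hyp_isometry_eq_iff [OF g v(1) ab(2)]
      by (auto simp: closed_segment_eq_open)
    then show "w \<in> g ` closed_segment a b" using v(2) by blast
  qed
qed

lemma hyp_isometry_convex:
  assumes g: "hyp_isometry g" and S: "S \<subseteq> hyp_plane" "convex S"
  shows "convex (g ` S)"
  unfolding convex_contains_segment
proof (intro ballI)
  fix x y assume "x \<in> g ` S" "y \<in> g ` S"
  then obtain a b where ab: "a \<in> S" "b \<in> S" "x = g a" "y = g b" by blast
  have "closed_segment a b \<subseteq> S"
    using ab S(2) by (simp add: closed_segment_subset)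
  moreover have "closed_segment x y = g ` closed_segment a b"
    unfolding ab using ab(1,2) S(1) by (intro hyp_isometry_closed_segment [symmetric] g) blast+
  ultimately show "closed_segment x y \<subseteq> g ` S" by blast
qed

lemma hyp_isometry_hull:
  assumes g: "hyp_isometry g" and S: "S \<subseteq> hyp_plane"
  shows "g ` (convex hull S) = convex hull (g ` S)"
proof
  let ?h = "inv_into hyp_plane g"
  have hull: "convex hull T \<subseteq> hyp_plane" if "T \<subseteq> hyp_plane" for T :: "(real^2) set"
    using that by (intro hull_minimal convex_ball)
  have gS: "g ` S \<subseteq> hyp_plane" using S hyp_isometry_in [OF g] by blast
  show "convex hull (g ` S) \<subseteq> g ` (convex hull S)"
    by (intro hull_minimal image_mono hull_subset hyp_isometry_convex [OF g hull [OF S]] convex_convex_hull)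
  have inv: "?h (g x) = x" if "x \<in> S" for x
    using that S by (intro inv_into_f_f hyp_isometry_inj [OF g]) blast
  have "S \<subseteq> ?h ` (convex hull (g ` S))"
  proof
    fix x assume "x \<in> S"
    then have "g x \<in> convex hull (g ` S)" by (intro hull_inc) blast
    then show "x \<in> ?h ` (convex hull (g ` S))" using inv [OF \<open>x \<in> S\<close>] by force
  qed
  then have *: "convex hull S \<subseteq> ?h ` (convex hull (g ` S))"
    by (intro hull_minimal hyp_isometry_convex [OF hyp_isometry_inv_into [OF g] hull [OF gS]] convex_convex_hull)
  show "g ` (convex hull S) \<subseteq> convex hull (g ` S)"
  proof (rule image_subsetI)
    fix x assume "x \<in> convex hull S"
    then obtain y where y: "y \<in> convex hull (g ` S)" "x = ?h y" using * by blast
    then have "y \<in> g ` hyp_plane"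
      using hull [OF gS] hyp_isometry_image [OF g] by blast
    then show "g x \<in> convex hull (g ` S)" using y by (simp only: f_inv_into_f)
  qed
qed

lemma hyp_isometry_face_of:
  assumes g: "hyp_isometry g" and S: "S \<subseteq> hyp_plane" and T: "T face_of S"
  shows "(g ` T) face_of (g ` S)"
proof -
  have TS: "T \<subseteq> S" "convex T" using T by (simp_all add: face_of_def)
  show ?thesis
    unfolding face_of_def
  proof (intro conjI ballI impI)
    show "g ` T \<subseteq> g ` S" using TS by blast
    show "convex (g ` T)" using TS S by (intro hyp_isometry_convex g) auto
    fix x y z assume "x \<in> g ` S" "y \<in> g ` S" "z \<in> g ` T" and z: "z \<in> open_segment x y"
    then obtain a b c where abc: "a \<in> S" "b \<in> S" "c \<in> T" "x = g a" "y = g b" "z = g c" by blast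
    have "c \<in> open_segment a b"
      using z hyp_isometry_open_segment [OF g, of c a b] abc S TS(1) by blast
    then have "a \<in> T \<and> b \<in> T"
      using T abc(1-3) unfolding face_of_def by blast
    then show "x \<in> g ` T" "y \<in> g ` T" using abc by blast+
  qed
qed

lemma hyp_isometry_extreme_point:
  assumes "hyp_isometry g" "S \<subseteq> hyp_plane" "v extreme_point_of S"
  shows "g v extreme_point_of g ` S"
  using hyp_isometry_face_of [OF assms(1,2), of "{v}"] assms(3) by (simp add: face_of_singleton)

section \<open>Sectors and triangles\<close>

lemma cross_decompose:
  assumes "cross u w \<noteq> 0"
  shows "d = (cross d w / cross u w) *\<^sub>R u + (cross u d / cross u w) *\<^sub>R w"
proof -
  have "cross u w *\<^sub>R d = cross d w *\<^sub>R u + cross u d *\<^sub>R w"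
    by (simp add: vec_eq_iff forall_2 cross_def algebra_simps)
  then have "(1 / cross u w) *\<^sub>R (cross u w *\<^sub>R d) =
      (1 / cross u w) *\<^sub>R (cross d w *\<^sub>R u + cross u d *\<^sub>R w)"
    by (rule arg_cong)
  then show ?thesis
    using assms by (simp add: scaleR_add_right)
qed

lemma cross_combination:
  "cross (s *\<^sub>R u + t *\<^sub>R w) w = s * cross u w" "cross u (s *\<^sub>R u + t *\<^sub>R w) = t * cross u w"
  by (simp_all add: cross_def algebra_simps)

lemma open_sector_iff:
  assumes "cross u w \<noteq> 0"
  shows "d \<in> open_sector u w \<longleftrightarrow> cross d w / cross u w > 0 \<and> cross u d / cross u w > 0"
proof
  assume "d \<in> open_sector u w"
  then obtain s t where "0 < s" "0 < t" and d: "d = s *\<^sub>R u + t *\<^sub>R w"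
    unfolding open_sector_def by blast
  then show "cross d w / cross u w > 0 \<and> cross u d / cross u w > 0"
    using assms unfolding d cross_combination by simp
next
  assume "cross d w / cross u w > 0 \<and> cross u d / cross u w > 0"
  then show "d \<in> open_sector u w"
    using cross_decompose [OF assms, of d] unfolding open_sector_def by blast
qed

lemma closed_sector_iff:
  assumes "cross u w \<noteq> 0"
  shows "d \<in> closed_sector u w \<longleftrightarrow> cross d w / cross u w \<ge> 0 \<and> cross u d / cross u w \<ge> 0"
proof
  assume "d \<in> closed_sector u w"
  then obtain s t where "0 \<le> s" "0 \<le> t" and d: "d = s *\<^sub>R u + t *\<^sub>R w"
    unfolding closed_sector_def by blast
  then show "cross d w / cross u w \<ge> 0 \<and> cross u d / cross u w \<ge> 0"
    using assms unfolding d cross_combination by simp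
next
  assume "cross d w / cross u w \<ge> 0 \<and> cross u d / cross u w \<ge> 0"
  then show "d \<in> closed_sector u w"
    using cross_decompose [OF assms, of d] unfolding closed_sector_def by blast
qed

lemma continuous_on_cross [continuous_intros]:
  "continuous_on S f \<Longrightarrow> continuous_on S g \<Longrightarrow> continuous_on S (\<lambda>x. cross (f x) (g x))"
  unfolding cross_def by (intro continuous_intros)

lemma open_open_sector:
  assumes "cross u w \<noteq> 0" shows "open (open_sector u w)"
proof -
  have "open_sector u w = {d. cross d w / cross u w > 0} \<inter> {d. cross u d / cross u w > 0}"
    using open_sector_iff [OF assms] by auto
  moreover have "open ({d. cross d w / cross u w > 0} \<inter> {d. cross u d / cross u w > 0})"
    by (intro open_Int open_Collect_less continuous_intros) (simp_all add: assms)
  ultimately show ?thesis by simp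
qed

lemma closed_closed_sector:
  assumes "cross u w \<noteq> 0" shows "closed (closed_sector u w)"
proof -
  have "closed_sector u w = {d. cross d w / cross u w \<ge> 0} \<inter> {d. cross u d / cross u w \<ge> 0}"
    using closed_sector_iff [OF assms] by auto
  moreover have "closed ({d. cross d w / cross u w \<ge> 0} \<inter> {d. cross u d / cross u w \<ge> 0})"
    by (intro closed_Int closed_Collect_le continuous_intros) (simp_all add: assms)
  ultimately show ?thesis by simp
qed

text \<open>
  Two sectors that share the ray of \<open>u\<close> and lie on opposite sides of it fit together.
\<close>

lemma common_side_interior:
  assumes "cross u w * cross u w' < 0" "0 < \<alpha>"
  shows "\<alpha> *\<^sub>R u \<in> interior (closed_sector u w \<union> closed_sector u w')"
proof -
  have nz: "cross u w \<noteq> 0" "cross u w' \<noteq> 0" using assms by auto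
  define N where "N = {d. cross d w / cross u w > 0} \<inter> {d. cross d w' / cross u w' > 0}"
  have "open N"
    unfolding N_def by (intro open_Int open_Collect_less continuous_intros) (simp_all add: nz)
  moreover have "\<alpha> *\<^sub>R u \<in> N"
    using nz assms(2) cross_combination(1) [of \<alpha> u 0 w] cross_combination(1) [of \<alpha> u 0 w'] by (simp add: N_def)
  moreover have "N \<subseteq> closed_sector u w \<union> closed_sector u w'"
  proof
    fix d assume d: "d \<in> N"
    have "cross u d / cross u w \<ge> 0 \<or> cross u d / cross u w' \<ge> 0"
      using assms(1) by (auto simp: mult_less_0_iff divide_simps)
    then show "d \<in> closed_sector u w \<union> closed_sector u w'"
      using d unfolding N_def Un_iff closed_sector_iff [OF nz(1)] closed_sector_iff [OF nz(2)] by auto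
  qed
  ultimately show ?thesis by (rule interiorI)
qed

lemma open_sector_same_side:
  assumes "cross u w * cross u w' > 0"
  shows "open_sector u w \<inter> open_sector u w' \<noteq> {}"
proof -
  have nz: "cross u w \<noteq> 0" "cross u w' \<noteq> 0" using assms by auto
  define l m where "l = cross w' w / cross u w" and "m = cross u w' / cross u w"
  have w': "w' = l *\<^sub>R u + m *\<^sub>R w"
    unfolding l_def m_def by (rule cross_decompose [OF nz(1)])
  have m: "0 < m" using assms unfolding m_def by (auto simp: zero_less_mult_iff zero_less_divide_iff)
  \<comment> \<open>Adding a large multiple of \<open>u\<close> to \<open>w'\<close> makes its coefficient positive in both bases.\<close>
  define n where "n = 1 + \<bar>l\<bar>"
  have n: "0 < n" "0 < n + l" unfolding n_def by linarith+
  have "n *\<^sub>R u + 1 *\<^sub>R w' \<in> open_sector u w'"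
    unfolding open_sector_def using n(1) zero_less_one by blast
  moreover have "n *\<^sub>R u + 1 *\<^sub>R w' = (n + l) *\<^sub>R u + m *\<^sub>R w"
    by (subst w') (simp add: algebra_simps)
  then have "n *\<^sub>R u + 1 *\<^sub>R w' \<in> open_sector u w"
    unfolding open_sector_def using n(2) m by blast
  ultimately show ?thesis by blast
qed

text \<open>
  Near its apex a triangle coincides with its sector, which allows overlaps of sectors to be
  traded for overlaps of triangles.
\<close>

lemma open_sector_into_triangle:
  fixes v a b :: "real^2"
  assumes "cross (a - v) (b - v) \<noteq> 0" "d \<in> open_sector (a - v) (b - v)"
  shows "\<exists>e>0. \<forall>t. 0 < t \<and> t < e \<longrightarrow> v + t *\<^sub>R d \<in> interior (convex hull {v, a, b})"
proof -
  obtain x y where xy: "0 < x" "0 < y" "d = x *\<^sub>R (a - v) + y *\<^sub>R (b - v)"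
    using assms(2) unfolding open_sector_def by blast
  \<comment> \<open>The points with positive barycentric coordinates.\<close>
  let ?W = "{z. z - v \<in> open_sector (a - v) (b - v) \<and>
      cross (z - v) (b - v) / cross (a - v) (b - v) + cross (a - v) (z - v) / cross (a - v) (b - v) < 1}"
  have W: "?W = (\<lambda>z. z - v) -` open_sector (a - v) (b - v) \<inter>
     {z. cross (z - v) (b - v) / cross (a - v) (b - v) + cross (a - v) (z - v) / cross (a - v) (b - v) < 1}"
    by auto
  have "open ?W"
    unfolding W
    by (intro open_Int open_Collect_less open_vimage open_open_sector [OF assms(1)] continuous_intros)
      (simp_all add: assms(1))
  moreover have "?W \<subseteq> convex hull {v, a, b}"
  proof
    fix z assume z: "z \<in> ?W"
    let ?s = "cross (z - v) (b - v) / cross (a - v) (b - v)" and ?t = "cross (a - v) (z - v) / cross (a - v) (b - v)"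
    have p: "0 < ?s" "0 < ?t" "?s + ?t < 1"
      using z unfolding mem_Collect_eq open_sector_iff [OF assms(1)] by blast+
    have "z - v = ?s *\<^sub>R (a - v) + ?t *\<^sub>R (b - v)"
      by (rule cross_decompose [OF assms(1)])
    then have "z = (1 - ?s - ?t) *\<^sub>R v + ?s *\<^sub>R a + ?t *\<^sub>R b"
      unfolding diff_eq_eq by (simp only: scaleR_diff_left scaleR_diff_right scaleR_one) (simp add: algebra_simps)
    then show "z \<in> convex hull {v, a, b}"
      unfolding convex_hull_3 using p
      by (intro CollectI exI [of _ "1 - ?s - ?t"] exI [of _ ?s] exI [of _ ?t]) auto
  qed
  ultimately have sub: "?W \<subseteq> interior (convex hull {v, a, b})"
    by (rule interior_maximal [rotated])
  have "v + t *\<^sub>R d \<in> ?W" if t: "0 < t" "t < 1 / (x + y)" for t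
  proof -
    have td: "t *\<^sub>R d = (t * x) *\<^sub>R (a - v) + (t * y) *\<^sub>R (b - v)"
      unfolding xy(3) by (simp add: scaleR_add_right)
    have "t * (x + y) < 1" using t xy by (simp add: pos_less_divide_eq)
    then have lt: "t * x + t * y < 1" by (simp add: distrib_left)
    have "t *\<^sub>R d \<in> open_sector (a - v) (b - v)"
      unfolding td open_sector_def using t xy mult_pos_pos by blast
    moreover have "cross (t *\<^sub>R d) (b - v) / cross (a - v) (b - v) + cross (a - v) (t *\<^sub>R d) / cross (a - v) (b - v) < 1"
      unfolding td cross_combination using assms(1) lt by simp
    ultimately show ?thesis by simp
  qed
  then show ?thesis
    using xy sub by (intro exI [of _ "1 / (x + y)"]) auto
qed

lemma open_sectors_disjoint:
  fixes v a b c d :: "real^2"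
  assumes "cross (a - v) (b - v) \<noteq> 0" "cross (c - v) (d - v) \<noteq> 0"
    and "interior (convex hull {v, a, b}) \<inter> interior (convex hull {v, c, d}) = {}"
  shows "open_sector (a - v) (b - v) \<inter> open_sector (c - v) (d - v) = {}"
proof (rule ccontr)
  assume "open_sector (a - v) (b - v) \<inter> open_sector (c - v) (d - v) \<noteq> {}"
  then obtain x where x: "x \<in> open_sector (a - v) (b - v)" "x \<in> open_sector (c - v) (d - v)" by blast
  obtain e where e: "0 < e" "\<And>t. 0 < t \<Longrightarrow> t < e \<Longrightarrow> v + t *\<^sub>R x \<in> interior (convex hull {v, a, b})"
    using open_sector_into_triangle [OF assms(1) x(1)] by metis
  obtain f where f: "0 < f" "\<And>t. 0 < t \<Longrightarrow> t < f \<Longrightarrow> v + t *\<^sub>R x \<in> interior (convex hull {v, c, d})"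
    using open_sector_into_triangle [OF assms(2) x(2)] by metis
  define t where "t = min e f / 2"
  have "0 < t" "t < e" "t < f" using e(1) f(1) by (auto simp: t_def min_def)
  then show False using e(2) f(2) assms(3) by blast
qed

lemma triangles_same_side:
  fixes a b p q :: "real^2"
  assumes "cross (b - a) (p - a) * cross (b - a) (q - a) > 0"
  shows "interior (convex hull {a, b, p}) \<inter> interior (convex hull {a, b, q}) \<noteq> {}"
  using open_sectors_disjoint [of b a p b q] open_sector_same_side [OF assms] assms
  by (metis mult_eq_0_iff less_irrefl)

lemma closed_triangle_sector:
  assumes "z \<in> convex hull {v, a, b}" shows "z - v \<in> closed_sector (a - v) (b - v)"
proof -
  from assms obtain r s t where z: "0 \<le> s" "0 \<le> t" "r + s + t = 1" "z = r *\<^sub>R v + s *\<^sub>R a + t *\<^sub>R b"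
    unfolding convex_hull_3 by blast
  have r: "r = 1 - s - t" using z(3) by simp
  have "z - v = s *\<^sub>R (a - v) + t *\<^sub>R (b - v)"
    unfolding z(4) r by (simp add: algebra_simps)
  then show ?thesis using z unfolding closed_sector_def by blast
qed

lemma closed_sector_scale:
  assumes "d \<in> closed_sector u w" "0 \<le> c" shows "c *\<^sub>R d \<in> closed_sector u w"
proof -
  obtain s t where "0 \<le> s" "0 \<le> t" "d = s *\<^sub>R u + t *\<^sub>R w"
    using assms(1) unfolding closed_sector_def by blast
  then have "c *\<^sub>R d = (c * s) *\<^sub>R u + (c * t) *\<^sub>R w" "0 \<le> c * s" "0 \<le> c * t"
    using assms(2) by (simp_all add: scaleR_add_right)
  then show ?thesis unfolding closed_sector_def by blast
qed

lemma interior_cone_scale: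
  fixes C :: "'a::real_normed_vector set"
  assumes "\<And>x c. x \<in> C \<Longrightarrow> 0 \<le> c \<Longrightarrow> c *\<^sub>R x \<in> C" "x \<in> interior C" "0 < c"
  shows "c *\<^sub>R x \<in> interior C"
proof (rule interiorI)
  show "open ((\<lambda>x. c *\<^sub>R x) ` interior C)"
    using assms(3) by (intro open_scaling) auto
  show "c *\<^sub>R x \<in> (\<lambda>x. c *\<^sub>R x) ` interior C" using assms(2) by blast
  show "(\<lambda>x. c *\<^sub>R x) ` interior C \<subseteq> C"
    using assms(1,3) interior_subset by fastforce
qed

section \<open>Convex polygons and their fan triangulation\<close>

text \<open>
  Non-degeneracy of a triangle in terms of angles, hence invariant under isometries.
\<close>

lemma cross_nz_iff_hyp_angle:
  assumes "v \<in> hyp_plane" "a \<noteq> v" "b \<noteq> v"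
  shows "cross (a - v) (b - v) \<noteq> 0 \<longleftrightarrow> 0 < hyp_angle v a b \<and> hyp_angle v a b < pi"
proof -
  let ?q = "conf v (b - v) / conf v (a - v)"
  have a: "a - v \<noteq> 0" using assms by simp
  have "cross (a - v) (b - v) \<noteq> 0 \<longleftrightarrow> Im ?q \<noteq> 0"
    unfolding Im_conf_quotient [OF assms(1) a]
    using less_imp_neq [OF Im_conf_quotient_coeff_pos [OF assms(1) a]]
    by (simp only: mult_eq_0_iff neg_equal_0_iff_equal) auto
  also have "\<dots> \<longleftrightarrow> \<not> (Arg ?q = 0 \<or> Arg ?q = pi)"
    unfolding Arg_eq_0_pi complex_is_Real_iff ..
  also have "\<dots> \<longleftrightarrow> 0 < \<bar>Arg ?q\<bar> \<and> \<bar>Arg ?q\<bar> < pi"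
    using Arg_le_pi [of ?q] mpi_less_Arg [of ?q] by linarith
  finally show ?thesis
    by (simp only: hyp_angle_conf [OF assms])
qed

locale hyp_polygon =
  fixes F :: "(real^2) set"
  assumes polygon: "compact_convex_polygon F"
begin

lemma polytope_F: "polytope F" and F_subset: "F \<subseteq> hyp_plane" and interior_F: "interior F \<noteq> {}"
  using polygon unfolding compact_convex_polygon_def by blast+

lemma convex_F: "convex F" and compact_F: "compact F" and closed_F: "closed F" and bounded_F: "bounded F"
  using polytope_F polytope_imp_convex polytope_imp_compact polytope_imp_closed polytope_imp_bounded by blast+

definition sides :: "(real^2) set set" where "sides = {s. s edge_of F}"

definition corners :: "(real^2) set" where "corners = {v. v extreme_point_of F}"

definition center :: "real^2" where "center = (SOME p. p \<in> interior F)"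

lemma center: "center \<in> interior F"
  unfolding center_def using interior_F by (simp add: some_in_eq)

lemma center_F: "center \<in> F" and center_in: "center \<in> hyp_plane"
  using center interior_subset F_subset by blast+

lemma finite_corners: "finite corners"
  unfolding corners_def by (intro finite_polyhedron_extreme_points polytope_imp_polyhedron polytope_F)

lemma side_face: "s \<in> sides \<Longrightarrow> s face_of F"
  by (simp add: sides_def edge_of_def)

lemma side_subset: "s \<in> sides \<Longrightarrow> s \<subseteq> F"
  using side_face face_of_imp_subset by blast

lemma finite_sides: "finite sides"
  using finite_polytope_faces [OF polytope_F] by (rule finite_subset [rotated]) (auto simp: side_face)

lemma corner_F: "v \<in> corners \<Longrightarrow> v \<in> F"
  unfolding corners_def by (simp add: extreme_point_of_def)

lemma corner_in: "v \<in> corners \<Longrightarrow> v \<in> hyp_plane"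
  using corner_F F_subset by blast

lemma corner_side_iff: "s \<in> sides \<Longrightarrow> u extreme_point_of s \<longleftrightarrow> u \<in> corners \<and> u \<in> s"
  unfolding corners_def using extreme_point_of_face [OF side_face] by simp

lemma side_ends:
  assumes "s \<in> sides"
  shows "\<exists>a b. a \<noteq> b \<and> s = closed_segment a b \<and> a \<in> corners \<and> b \<in> corners \<and>
    (\<forall>u. u \<in> corners \<and> u \<in> s \<longleftrightarrow> u = a \<or> u = b)"
proof -
  have "polytope s" using face_of_polytope_polytope [OF polytope_F side_face [OF assms]] .
  moreover have ad: "aff_dim s = 1" using assms by (simp add: sides_def edge_of_def)
  moreover from ad have "s \<noteq> {}" by auto
  moreover from ad have "collinear s" by (simp add: collinear_aff_dim)
  ultimately obtain a b where ab: "s = closed_segment a b"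
    using compact_convex_collinear_segment polytope_imp_compact polytope_imp_convex by metis
  have "a \<noteq> b"
    using ad ab by auto
  moreover have iff: "u \<in> corners \<and> u \<in> s \<longleftrightarrow> u = a \<or> u = b" for u
    using corner_side_iff [OF assms, of u] extreme_point_of_segment [of u a b] unfolding ab by metis
  ultimately show ?thesis using ab iff [of a] iff [of b] by (intro exI [of _ a] exI [of _ b]) simp
qed

lemma frontier_F: "frontier F = \<Union>sides"
proof -
  have "aff_dim F = 2" using aff_dim_nonempty_interior [OF interior_F] by simp
  then have "s facet_of F \<longleftrightarrow> s \<in> sides" for s
    unfolding facet_of_def sides_def edge_of_def by auto
  then have "{s. s facet_of F} = sides" by auto
  then show ?thesis
    using rel_frontier_of_polyhedron [OF polytope_imp_polyhedron [OF polytope_F]]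
      rel_frontier_nonempty_interior [OF interior_F] by simp
qed

lemma corner_on_side: "v \<in> corners \<Longrightarrow> \<exists>s\<in>sides. v \<in> s"
proof -
  assume v: "v \<in> corners"
  then have "v \<notin> interior F" using extreme_point_not_in_interior [of v F] by (simp add: corners_def)
  then have "v \<in> frontier F"
    using corner_F [OF v] closed_F by (simp add: frontier_def)
  then show ?thesis unfolding frontier_F by blast
qed

lemma center_not_side: "s \<in> sides \<Longrightarrow> center \<notin> s"
  using center frontier_F by (auto simp: frontier_def)

text \<open>
  An inner point of a side \<open>s\<close> determines \<open>s\<close>: a face through it contains both ends of \<open>s\<close>, and a
  side contains only two corners.
\<close>

lemma sides_meet_in_corner:
  assumes "s \<in> sides" "t \<in> sides" "y \<in> s" "y \<in> t" "y \<notin> corners"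
  shows "s = t"
proof -
  obtain a b where ne: "a \<noteq> b" and ab: "s = closed_segment a b" "a \<in> corners" "b \<in> corners"
    "\<forall>u. u \<in> corners \<and> u \<in> s \<longleftrightarrow> u = a \<or> u = b"
    using side_ends [OF assms(1)] by (elim exE conjE) (rule that)
  obtain c d where "c \<noteq> d" and cd: "t = closed_segment c d" and "c \<in> corners" "d \<in> corners"
    and cd': "\<forall>u. u \<in> corners \<and> u \<in> t \<longleftrightarrow> u = c \<or> u = d"
    using side_ends [OF assms(2)] by (elim exE conjE) (rule that)
  have "y \<in> open_segment a b"
    using assms(3,5) ab(1-3) unfolding open_segment_def by blast
  moreover have "a \<in> F" "b \<in> F" using ab(2,3) corner_F by simp_all
  ultimately have "a \<in> t" "b \<in> t"
    using side_face [OF assms(2)] assms(4) unfolding face_of_def by blast+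
  then have "a = c \<or> a = d" "b = c \<or> b = d" using ab(2,3) cd' by blast+
  then have "{a, b} = {c, d}" using ne by auto
  then show ?thesis unfolding ab(1) cd closed_segment_eq .
qed

definition other_end :: "real^2 \<Rightarrow> (real^2) set \<Rightarrow> real^2" where
  "other_end u s = (SOME a. s = closed_segment u a)"

lemma other_end:
  assumes "s \<in> sides" "u \<in> corners" "u \<in> s"
  shows "s = closed_segment u (other_end u s)" "other_end u s \<noteq> u" "other_end u s \<in> corners"
proof -
  obtain a b where ab: "a \<noteq> b" "s = closed_segment a b" "a \<in> corners" "b \<in> corners"
    "\<forall>u. u \<in> corners \<and> u \<in> s \<longleftrightarrow> u = a \<or> u = b"
    using side_ends [OF assms(1)] by (elim exE conjE) (rule that)
  have "u = a \<or> u = b" using ab(5) assms(2,3) by blast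
  then have "\<exists>a. s = closed_segment u a"
    using ab(2) closed_segment_commute [of a b] by auto
  then show s: "s = closed_segment u (other_end u s)"
    unfolding other_end_def by (rule someI_ex)
  then have "{u, other_end u s} = {a, b}"
    using ab(2) unfolding closed_segment_eq [symmetric] by simp
  then show "other_end u s \<noteq> u" "other_end u s \<in> corners"
    using ab(1,3,4) by (auto simp: doubleton_eq_iff)
qed

lemma other_end_eq:
  assumes "s \<in> sides" "u \<in> corners" "s = closed_segment u a" shows "other_end u s = a"
proof -
  have "u \<in> s" using assms(3) by simp
  then have "closed_segment u a = closed_segment u (other_end u s)"
    using other_end(1) [OF assms(1,2)] assms(3) by simp
  then show ?thesis unfolding closed_segment_eq by (auto simp: doubleton_eq_iff)
qed

lemma cross_side_nz:
  assumes "s \<in> sides" "s = closed_segment a b" "a \<noteq> b"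
  shows "cross (b - a) (center - a) \<noteq> 0"
proof
  assume c: "cross (b - a) (center - a) = 0"
  have "\<exists>l. center - a = l *\<^sub>R (b - a)"
  proof (cases "(b - a) $ 1 = 0")
    case True
    then have n: "(b - a) $ 2 \<noteq> 0" using assms(3) by (auto simp: vec_eq_iff forall_2)
    then have "(center - a) $ 1 = 0" using c True by (simp add: cross_def)
    then have "center - a = ((center - a) $ 2 / (b - a) $ 2) *\<^sub>R (b - a)"
      using n True by (simp add: vec_eq_iff forall_2)
    then show ?thesis ..
  next
    case False
    have "(center - a) $ 2 = (center - a) $ 1 / (b - a) $ 1 * (b - a) $ 2"
      using c False unfolding cross_def by (simp add: divide_simps) (simp add: algebra_simps)
    then have "center - a = ((center - a) $ 1 / (b - a) $ 1) *\<^sub>R (b - a)"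
      using False unfolding vec_eq_iff forall_2 by simp
    then show ?thesis ..
  qed
  then obtain l where l: "center - a = l *\<^sub>R (b - a)" ..
  have "center = (1 - l) *\<^sub>R a + l *\<^sub>R b"
    using l unfolding diff_eq_eq by (simp add: algebra_simps)
  moreover have "a \<in> affine hull s" "b \<in> affine hull s"
    unfolding assms(2) by (simp_all add: hull_inc)
  ultimately have "center \<in> affine hull s"
    using mem_affine [OF affine_affine_hull, of a s b "1 - l" l] by simp
  then have "center \<in> s"
    using face_of_imp_eq_affine_Int [OF convex_F side_face [OF assms(1)]] center_F by blast
  then show False using center_not_side assms by blast
qed

definition fan :: "(real^2) set \<Rightarrow> (real^2) set" where
  "fan s = convex hull (insert center s)"

lemma fan_segment: "s = closed_segment a b \<Longrightarrow> fan s = convex hull {a, b, center}"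
proof -
  assume "s = closed_segment a b"
  then have "fan s = convex hull (insert center (convex hull {a, b}))"
    by (simp only: fan_def segment_convex_hull)
  also have "\<dots> = convex hull (insert center {a, b})"
    by (rule hull_insert [symmetric])
  also have "insert center {a, b} = {a, b, center}" by auto
  finally show ?thesis .
qed

lemma fan_subset: "s \<in> sides \<Longrightarrow> fan s \<subseteq> F"
  unfolding fan_def using side_subset center_F by (intro hull_minimal convex_F) auto

lemma fan_compact:
  assumes "s \<in> sides" shows "compact (fan s)"
proof -
  obtain a b where "s = closed_segment a b" using side_ends [OF assms] by auto
  then show ?thesis
    by (simp only: fan_segment finite_imp_compact_convex_hull finite.emptyI finite.insertI)
qed

lemma fan_eq:
  assumes "s \<in> sides" "x \<in> fan s" shows "\<exists>y\<in>s. x \<in> closed_segment center y"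
proof -
  have "s \<noteq> {}" using side_ends [OF assms(1)] by auto
  moreover have "convex hull s = s"
    using side_face [OF assms(1)] face_of_imp_convex by (intro hull_same) blast
  ultimately show ?thesis
    using assms(2) unfolding fan_def by (auto simp: convex_hull_insert_segments)
qed

lemma fan_cover: "F = (\<Union>s\<in>sides. fan s)"
proof
  show "(\<Union>s\<in>sides. fan s) \<subseteq> F" using fan_subset by blast
  show "F \<subseteq> (\<Union>s\<in>sides. fan s)"
  proof
    fix x assume x: "x \<in> F"
    have fr: "\<exists>s\<in>sides. z \<in> s" if "z \<in> frontier F" for z using that frontier_F by blast
    show "x \<in> (\<Union>s\<in>sides. fan s)"
    proof (cases "x = center")
      case True
      have "frontier F \<noteq> {}"
        using bounded_F interior_F frontier_not_empty interior_subset not_bounded_UNIV by blast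
      then obtain s where "s \<in> sides" using fr by blast
      then show ?thesis using True unfolding fan_def by (auto intro: hull_inc)
    next
      case False
      then have "x - center \<noteq> 0" by simp
      then obtain d where d: "0 < d" "center + d *\<^sub>R (x - center) \<in> frontier F"
        using ray_to_frontier [OF bounded_F center] by metis
      have "1 \<le> d"
      proof (rule ccontr)
        assume "\<not> 1 \<le> d"
        then have "center + d *\<^sub>R (x - center) \<in> open_segment center x"
          using False d(1) unfolding in_segment by (intro conjI exI [of _ d]) (auto simp: algebra_simps)
        moreover have "open_segment center x \<subseteq> interior F"
          using x closure_subset by (intro in_interior_closure_convex_segment convex_F center) blast
        ultimately show False using d(2) by (auto simp: frontier_def)
      qed
      define y where "y = center + d *\<^sub>R (x - center)"
      obtain s where s: "s \<in> sides" "y \<in> s" using fr d(2) y_def by blast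
      have "x = (1 - 1 / d) *\<^sub>R center + (1 / d) *\<^sub>R y"
        unfolding y_def using d(1) by (simp add: scaleR_add_right algebra_simps)
      moreover have "center \<in> fan s" "y \<in> fan s"
        unfolding fan_def using s by (auto intro: hull_inc)
      moreover have "convex (fan s)" unfolding fan_def by simp
      ultimately have "x \<in> fan s"
        using \<open>1 \<le> d\<close> convexD_alt [of "fan s" center y "1 / d"] by simp
      then show ?thesis using s by blast
    qed
  qed
qed

text \<open>
  A ray from an interior point of a convex set leaves it only once.
\<close>

lemma frontier_ray_unique:
  assumes "y \<in> frontier F" "z \<in> frontier F" "center + d *\<^sub>R (y - center) = center + e *\<^sub>R (z - center)"
    "0 < d" "0 < e"
  shows "y = z"
proof -
  have aux: "\<not> d < e" if "y \<in> frontier F" "z \<in> frontier F" "d *\<^sub>R (y - center) = e *\<^sub>R (z - center)" "0 < d" for d e y z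
  proof
    assume "d < e"
    have "z - center = (d / e) *\<^sub>R (y - center)"
    proof -
      have "(1 / e) *\<^sub>R (d *\<^sub>R (y - center)) = (1 / e) *\<^sub>R (e *\<^sub>R (z - center))"
        by (simp only: that(3))
      moreover have "e \<noteq> 0" using that(4) \<open>d < e\<close> by simp
      ultimately show ?thesis by simp
    qed
    then have "z = (d / e) *\<^sub>R (y - center) + center"
      unfolding diff_eq_eq .
    then have "z = (1 - d / e) *\<^sub>R center + (d / e) *\<^sub>R y"
      by (simp only: scaleR_diff_left scaleR_diff_right scaleR_one) simp
    moreover have "y \<noteq> center" using that(1) center by (auto simp: frontier_def)
    moreover have "0 < d / e" "d / e < 1" using that(4) \<open>d < e\<close> by simp_all
    ultimately have "z \<in> open_segment center y"
      unfolding in_segment by metis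
    moreover have "open_segment center y \<subseteq> interior F"
      using that(1) by (intro in_interior_closure_convex_segment convex_F center) (simp add: frontier_def)
    ultimately show False using that(2) by (auto simp: frontier_def)
  qed
  have eq: "d *\<^sub>R (y - center) = e *\<^sub>R (z - center)" using assms(3) by simp
  have "d = e"
    using aux [OF assms(1,2) eq assms(4)] aux [OF assms(2,1) eq [symmetric] assms(5)] by linarith
  then show ?thesis using eq assms(4) by simp
qed

lemma side_frontier: "s \<in> sides \<Longrightarrow> y \<in> s \<Longrightarrow> y \<in> frontier F"
  using frontier_F by blast

text \<open>
  The rays from the center through a point of both triangles meet the frontier in the same point,
  which lies on both sides and is therefore a corner.
\<close>

lemma fan_overlap:
  assumes "s \<in> sides" "t \<in> sides" "s \<noteq> t"
  shows "fan s \<inter> fan t \<subseteq> (\<Union>v\<in>corners. closed_segment center v)"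
proof
  fix x assume "x \<in> fan s \<inter> fan t"
  then have "x \<in> fan s" "x \<in> fan t" by simp_all
  from fan_eq [OF assms(1) this(1)] fan_eq [OF assms(2) this(2)]
  obtain y z where yz: "y \<in> s" "z \<in> t" "x \<in> closed_segment center y" "x \<in> closed_segment center z"
    by (elim bexE) (rule that)
  obtain d where d: "0 \<le> d" "x = (1 - d) *\<^sub>R center + d *\<^sub>R y"
    using yz(3) unfolding in_segment by blast
  obtain e where e: "0 \<le> e" "x = (1 - e) *\<^sub>R center + e *\<^sub>R z"
    using yz(4) unfolding in_segment by blast
  show "x \<in> (\<Union>v\<in>corners. closed_segment center v)"
  proof (cases "x = center")
    case True
    moreover have "\<exists>a. a \<in> corners" using side_ends [OF assms(1)] by auto
    ultimately show ?thesis by auto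
  next
    case False
    have "d \<noteq> 0"
    proof
      assume "d = 0"
      then show False using d(2) False by simp
    qed
    moreover have "e \<noteq> 0"
    proof
      assume "e = 0"
      then show False using e(2) False by simp
    qed
    ultimately have "0 < d" "0 < e" using d(1) e(1) by simp_all
    moreover have "center + d *\<^sub>R (y - center) = x"
      unfolding d(2) by (simp add: algebra_simps)
    moreover have "center + e *\<^sub>R (z - center) = x"
      unfolding e(2) by (simp add: algebra_simps)
    ultimately have "y = z"
      by (intro frontier_ray_unique [OF side_frontier [OF assms(1) yz(1)] side_frontier [OF assms(2) yz(2)], of d e])
        simp_all
    then have "y \<in> corners" using sides_meet_in_corner [OF assms(1,2)] yz(1,2) assms(3) by blast
    then show ?thesis using yz(3) by blast
  qed
qed

lemma negligible_segment: "negligible (closed_segment a (b :: real^2))"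
proof (rule ccontr)
  assume "\<not> negligible (closed_segment a b)"
  then have "interior (closed_segment a b) \<noteq> {}" by (simp add: negligible_convex_interior)
  then have "aff_dim (closed_segment a b) = 2" using aff_dim_nonempty_interior by fastforce
  moreover have "aff_dim (closed_segment a b) \<le> 1"
    unfolding collinear_aff_dim [symmetric] by (rule collinear_closed_segment)
  ultimately show False by simp
qed

lemma fan_overlap_negligible:
  assumes "s \<in> sides" "t \<in> sides" "s \<noteq> t" shows "negligible (fan s \<inter> fan t)"
  by (rule negligible_subset [OF _ fan_overlap [OF assms]])
    (use negligible_segment in \<open>auto intro!: negligible_Union finite_imageI finite_corners\<close>)

lemma fan_in: "s \<in> sides \<Longrightarrow> fan s \<subseteq> hyp_plane"
  using fan_subset F_subset by blast

lemma hyp_area_F: "hyp_area F = (\<Sum>s\<in>sides. hyp_area (fan s))"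
  by (subst fan_cover, rule hyp_area_finite_UN [OF finite_sides fan_compact fan_in fan_overlap_negligible])

definition end1 :: "(real^2) set \<Rightarrow> real^2" where "end1 s = (SOME a. a \<in> corners \<and> a \<in> s)"
definition end2 :: "(real^2) set \<Rightarrow> real^2" where "end2 s = other_end (end1 s) s"

lemma ends:
  assumes "s \<in> sides"
  shows "end1 s \<noteq> end2 s" "s = closed_segment (end1 s) (end2 s)"
    "end1 s \<in> corners" "end2 s \<in> corners" "{u \<in> corners. u \<in> s} = {end1 s, end2 s}"
proof -
  have "\<exists>a. a \<in> corners \<and> a \<in> s" using side_ends [OF assms] by auto
  then have e: "end1 s \<in> corners \<and> end1 s \<in> s" unfolding end1_def by (rule someI_ex)
  show "end1 s \<in> corners" using e by blast
  show "end1 s \<noteq> end2 s" "end2 s \<in> corners" and s: "s = closed_segment (end1 s) (end2 s)"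
    using other_end [OF assms, of "end1 s"] e unfolding end2_def by auto
  have "{u. u extreme_point_of s} = {end1 s, end2 s}"
    by (subst s) (auto simp: extreme_point_of_segment)
  then show "{u \<in> corners. u \<in> s} = {end1 s, end2 s}"
    using corner_side_iff [OF assms] by auto
qed

text \<open>
  The triangles of the fan cover a small disc around the center.
\<close>

lemma center_angle_sum: "(\<Sum>s\<in>sides. hyp_angle center (end1 s) (end2 s)) = 2 * pi"
proof (rule sum_hyp_angle_sectors [OF center_in finite_sides])
  have nz: "cross (end1 s - center) (end2 s - center) \<noteq> 0" if "s \<in> sides" for s
    using cross_side_nz [OF that ends(2) [OF that] ends(1) [OF that]] by (simp add: cross_def algebra_simps)
  show "cross (end1 s - center) (end2 s - center) \<noteq> 0" if "s \<in> sides" for s by (rule nz [OF that])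
  have hull: "convex hull {center, end1 s, end2 s} = fan s" if "s \<in> sides" for s
    using fan_segment [OF ends(2) [OF that]] by (simp add: insert_commute)
  show "open_sector (end1 s - center) (end2 s - center) \<inter> open_sector (end1 t - center) (end2 t - center) = {}"
    if st: "s \<in> sides" "t \<in> sides" "s \<noteq> t" for s t
  proof (rule open_sectors_disjoint [OF nz [OF st(1)] nz [OF st(2)]])
    have "interior (fan s) \<inter> interior (fan t) = {}"
      using fan_overlap_negligible [OF st] negligible_convex_interior [of "fan s \<inter> fan t"]
      by (simp add: interior_Int convex_Int fan_def)
    then show "interior (convex hull {center, end1 s, end2 s}) \<inter> interior (convex hull {center, end1 t, end2 t}) = {}"
      by (simp only: hull st)
  qed
  show "(\<Union>s\<in>sides. closed_sector (end1 s - center) (end2 s - center)) = UNIV"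
  proof -
    have "d \<in> (\<Union>s\<in>sides. closed_sector (end1 s - center) (end2 s - center))" for d
    proof -
      obtain e where e: "e > 0" "cball center e \<subseteq> F"
        using center by (meson mem_interior_cball)
      define t where "t = e / (norm d + 1)"
      have t: "0 < t" "t * norm d \<le> e"
        using e(1) by (simp_all add: t_def divide_simps add_nonneg_pos)
      have "center + t *\<^sub>R d \<in> cball center e"
        using t by (simp add: dist_norm)
      then obtain s where s: "s \<in> sides" "center + t *\<^sub>R d \<in> fan s"
        using e(2) fan_cover by blast
      have "t *\<^sub>R d \<in> closed_sector (end1 s - center) (end2 s - center)"
        using closed_triangle_sector [of "center + t *\<^sub>R d" center "end1 s" "end2 s"] s(2) hull [OF s(1)] by simp
      then have "(1 / t) *\<^sub>R (t *\<^sub>R d) \<in> closed_sector (end1 s - center) (end2 s - center)"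
        by (rule closed_sector_scale) (use t(1) in simp)
      then show ?thesis using s(1) t(1) by auto
    qed
    then show ?thesis by blast
  qed
qed

text \<open>
  The angle at \<open>u\<close> of the fan triangle over the side \<open>s\<close>. It is a part of the interior angle of the
  polygon at \<open>u\<close>, the other part belonging to the other side at \<open>u\<close>.
\<close>

definition corner_angle :: "real^2 \<Rightarrow> (real^2) set \<Rightarrow> real" where
  "corner_angle u s = hyp_angle u (other_end u s) center"

lemma hyp_area_fan:
  assumes "s \<in> sides"
  shows "hyp_area (fan s) = pi - hyp_angle center (end1 s) (end2 s) - (\<Sum>u\<in>{u \<in> corners. u \<in> s}. corner_angle u s)"
proof -
  note e = ends [OF assms]
  have "hyp_area (fan s) = hyp_area (convex hull {end1 s, end2 s, center})"
    by (simp only: fan_segment [OF e(2)])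
  also have "\<dots> = pi - hyp_angle (end1 s) (end2 s) center - hyp_angle (end2 s) center (end1 s)
      - hyp_angle center (end1 s) (end2 s)"
    by (rule hyp_area_triangle [OF corner_in [OF e(3)] corner_in [OF e(4)] center_in cross_side_nz [OF assms e(2,1)]])
  also have "hyp_angle (end1 s) (end2 s) center = corner_angle (end1 s) s"
    unfolding corner_angle_def end2_def ..
  also have "hyp_angle (end2 s) center (end1 s) = corner_angle (end2 s) s"
    unfolding corner_angle_def using other_end_eq [OF assms e(4), of "end1 s"] e(2)
    by (simp add: closed_segment_commute hyp_angle_commute)
  finally show ?thesis
    unfolding e(5) using e(1) by simp
qed

theorem hyp_area_polygon:
  "hyp_area F = (real (card sides) - 2) * pi - (\<Sum>u\<in>corners. \<Sum>s\<in>{s \<in> sides. u \<in> s}. corner_angle u s)"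
proof -
  have "hyp_area F = (\<Sum>s\<in>sides. pi) - (\<Sum>s\<in>sides. hyp_angle center (end1 s) (end2 s))
      - (\<Sum>s\<in>sides. \<Sum>u\<in>{u \<in> corners. u \<in> s}. corner_angle u s)"
    unfolding hyp_area_F by (simp add: hyp_area_fan sum_subtractf)
  also have "(\<Sum>s\<in>sides. \<Sum>u\<in>{u \<in> corners. u \<in> s}. corner_angle u s)
      = (\<Sum>u\<in>corners. \<Sum>s\<in>{s \<in> sides. u \<in> s}. corner_angle u s)"
    by (rule sum.swap_restrict [OF finite_sides finite_corners])
  finally show ?thesis
    unfolding center_angle_sum by (simp add: algebra_simps)
qed

end

section \<open>The group action\<close>

lemma hyp_orbit_iff: "y \<in> hyp_orbit G x \<longleftrightarrow> (\<exists>g\<in>G. y = g x)"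
  unfolding orbit_def by auto

lemma hyp_stabilizer_iff: "g \<in> hyp_stabilizer G x \<longleftrightarrow> g \<in> G \<and> g x = x"
  unfolding stabilizer_def by auto

type_synonym flag = "(real^2) \<times> (real^2) set \<times> (real^2 \<Rightarrow> real^2)"

locale hyp_tiling = hyp_polygon F for F +
  fixes G :: "(real^2 \<Rightarrow> real^2) set"
  assumes group: "discrete_isometry_group G"
    and tiles: "tiles_edge_to_edge G F"
    and pairing: "sides_paired G F"
begin

lemma subgroup_G: "subgroup G (BijGroup hyp_plane)"
  using group by (simp add: discrete_isometry_group_def)

lemma G_isometry: "g \<in> G \<Longrightarrow> hyp_isometry g"
  using group by (simp add: discrete_isometry_group_def)

lemma G_Bij: "g \<in> G \<Longrightarrow> g \<in> Bij hyp_plane"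
  using subgroup.subset [OF subgroup_G] by (auto simp: BijGroup_def)

lemma G_in: "g \<in> G \<Longrightarrow> x \<in> hyp_plane \<Longrightarrow> g x \<in> hyp_plane"
  by (rule hyp_isometry_in [OF G_isometry])

definition one :: "real^2 \<Rightarrow> real^2" where "one = (\<lambda>x\<in>hyp_plane. x)"

lemma one_G: "one \<in> G"
  using subgroup.one_closed [OF subgroup_G] by (simp add: BijGroup_def one_def)

lemma one_apply: "x \<in> hyp_plane \<Longrightarrow> one x = x"
  by (simp add: one_def)

lemma one_image: "S \<subseteq> hyp_plane \<Longrightarrow> one ` S = S"
proof -
  assume S: "S \<subseteq> hyp_plane"
  have "one ` S = id ` S" by (rule image_cong [OF refl]) (use S one_apply in auto)
  then show ?thesis by simp
qed

lemma G_compose: "g \<in> G \<Longrightarrow> h \<in> G \<Longrightarrow> compose hyp_plane g h \<in> G"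
  using subgroup.m_closed [OF subgroup_G, of g h] G_Bij by (simp add: BijGroup_def)

lemma compose_apply: "x \<in> hyp_plane \<Longrightarrow> compose hyp_plane g h x = g (h x)"
  by (simp add: compose_def)

lemma G_inverse:
  assumes "g \<in> G"
  obtains h where "h \<in> G" "\<And>x. x \<in> hyp_plane \<Longrightarrow> h (g x) = x" "\<And>x. x \<in> hyp_plane \<Longrightarrow> g (h x) = x"
proof -
  let ?B = "BijGroup hyp_plane"
  interpret B: group ?B by (rule group_BijGroup)
  define h where "h = inv\<^bsub>?B\<^esub> g"
  have h: "h \<in> G" unfolding h_def by (rule subgroup.m_inv_closed [OF subgroup_G assms])
  have g: "g \<in> carrier ?B" using G_Bij [OF assms] by (simp add: BijGroup_def)
  have "h \<otimes>\<^bsub>?B\<^esub> g = \<one>\<^bsub>?B\<^esub>" "g \<otimes>\<^bsub>?B\<^esub> h = \<one>\<^bsub>?B\<^esub>"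
    unfolding h_def using g by (rule B.l_inv, rule B.r_inv)
  then have "compose hyp_plane h g = one" "compose hyp_plane g h = one"
    using G_Bij [OF assms] G_Bij [OF h] by (simp_all add: BijGroup_def one_def)
  then have "compose hyp_plane h g x = one x" "compose hyp_plane g h x = one x" for x
    by simp_all
  then have "h (g x) = x" "g (h x) = x" if "x \<in> hyp_plane" for x
    using compose_apply [OF that] one_apply [OF that] by metis+
  then show ?thesis using that h by blast
qed

lemma G_eqI:
  assumes "g \<in> G" "h \<in> G" "\<And>x. x \<in> hyp_plane \<Longrightarrow> g x = h x" shows "g = h"
  by (rule extensionalityI [OF Bij_imp_extensional [OF G_Bij [OF assms(1)]] Bij_imp_extensional [OF G_Bij [OF assms(2)]] assms(3)])

lemma orbit_refl: "x \<in> hyp_plane \<Longrightarrow> x \<in> hyp_orbit G x"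
  unfolding hyp_orbit_iff using one_G one_apply by (intro bexI [of _ one]) simp_all

lemma orbit_image:
  assumes "g \<in> G" "x \<in> hyp_plane" shows "hyp_orbit G (g x) = hyp_orbit G x"
proof (rule Set.set_eqI)
  fix y
  obtain h where h: "h \<in> G" "\<And>x. x \<in> hyp_plane \<Longrightarrow> h (g x) = x" 
    using G_inverse [OF assms(1)] by metis
  show "y \<in> hyp_orbit G (g x) \<longleftrightarrow> y \<in> hyp_orbit G x"
    unfolding hyp_orbit_iff
  proof
    assume "\<exists>k\<in>G. y = k (g x)"
    then obtain k where "k \<in> G" "y = k (g x)" by blast
    then show "\<exists>k\<in>G. y = k x"
      using G_compose [of k g] compose_apply [OF assms(2), of k g] assms(1) by metis
  next
    assume "\<exists>k\<in>G. y = k x"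
    then obtain k where "k \<in> G" "y = k x" by blast
    then show "\<exists>k\<in>G. y = k (g x)"
      using G_compose [of k h] compose_apply [of "g x" k h] h G_in [OF assms] assms(2) by metis
  qed
qed

lemma orbit_eq_iff:
  assumes "x \<in> hyp_plane" "y \<in> hyp_plane"
  shows "hyp_orbit G x = hyp_orbit G y \<longleftrightarrow> (\<exists>g\<in>G. g x = y)"
proof
  assume "hyp_orbit G x = hyp_orbit G y"
  then have "y \<in> hyp_orbit G x" using orbit_refl [OF assms(2)] by simp
  then show "\<exists>g\<in>G. g x = y" unfolding hyp_orbit_iff by auto
next
  assume "\<exists>g\<in>G. g x = y"
  then show "hyp_orbit G x = hyp_orbit G y" using orbit_image assms(1) by metis
qed

lemma G_continuous:
  assumes "g \<in> G" shows "continuous_on hyp_plane g"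
proof (rule continuous_at_imp_continuous_on, rule ballI)
  fix x assume "x \<in> hyp_plane"
  moreover have "orientation_preserving g" using group assms by (simp add: discrete_isometry_group_def)
  ultimately obtain g' where "(g has_derivative g') (at x)"
    unfolding orientation_preserving_def by blast
  then show "isCont g x" by (rule has_derivative_continuous)
qed

lemma G_open_image:
  assumes "g \<in> G" "open U" "U \<subseteq> hyp_plane" shows "open (g ` U)"
proof -
  obtain h where h: "h \<in> G" "\<And>x. x \<in> hyp_plane \<Longrightarrow> h (g x) = x" "\<And>x. x \<in> hyp_plane \<Longrightarrow> g (h x) = x"
    using G_inverse [OF assms(1)] by metis
  have "g ` U = hyp_plane \<inter> h -` U"
  proof (intro subset_antisym subsetI)
    fix y assume "y \<in> g ` U"
    then show "y \<in> hyp_plane \<inter> h -` U" using h(2) assms(3) G_in [OF assms(1)] by fastforce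
  next
    fix y assume "y \<in> hyp_plane \<inter> h -` U"
    then show "y \<in> g ` U" using h(3) [of y] by (intro image_eqI [of _ _ "h y"]) auto
  qed
  moreover have "open (hyp_plane \<inter> h -` U)"
    by (rule continuous_open_preimage [OF G_continuous [OF h(1)] open_ball assms(2)])
  ultimately show ?thesis by simp
qed

section \<open>Flags\<close>

lemma side_in: "s \<in> sides \<Longrightarrow> s \<subseteq> hyp_plane"
  using side_subset F_subset by blast

lemma fan_image:
  assumes "g \<in> G" "s \<in> sides" "u \<in> corners" "u \<in> s"
  shows "g ` fan s = convex hull {g u, g (other_end u s), g center}"
proof -
  note o = other_end [OF assms(2-4)]
  have "fan s = convex hull {u, other_end u s, center}" by (rule fan_segment [OF o(1)])
  then show ?thesis
    using hyp_isometry_hull [OF G_isometry [OF assms(1)], of "{u, other_end u s, center}"]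
      corner_in [OF assms(3)] corner_in [OF o(3)] center_in by simp
qed

lemma cross_flag_nz:
  assumes "g \<in> G" "s \<in> sides" "u \<in> corners" "u \<in> s"
  shows "cross (g (other_end u s) - g u) (g center - g u) \<noteq> 0"
proof -
  note o = other_end [OF assms(2-4)]
  note c = corner_in [OF assms(3)] corner_in [OF o(3)]
  note iso = G_isometry [OF assms(1)]
  have nz: "cross (other_end u s - u) (center - u) \<noteq> 0"
    by (rule cross_side_nz [OF assms(2) o(1) o(2) [symmetric]])
  have ne: "center \<noteq> u" using cross_nz(2) [OF nz] by simp
  have "0 < hyp_angle u (other_end u s) center \<and> hyp_angle u (other_end u s) center < pi"
    using nz cross_nz_iff_hyp_angle [OF c(1) o(2) ne] by simp
  then have "0 < hyp_angle (g u) (g (other_end u s)) (g center) \<and> hyp_angle (g u) (g (other_end u s)) (g center) < pi"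
    unfolding hyp_isometry_hyp_angle [OF iso c center_in] .
  moreover have "g (other_end u s) \<noteq> g u" "g center \<noteq> g u"
    using o(2) ne hyp_isometry_eq_iff [OF iso c(2,1)] hyp_isometry_eq_iff [OF iso center_in c(1)] by simp_all
  ultimately show ?thesis
    using cross_nz_iff_hyp_angle [OF G_in [OF assms(1) c(1)], of "g (other_end u s)" "g center"] by simp
qed

text \<open>
  Different tiles share at most a side, which has no interior; in one tile the triangles of the
  fan overlap only in segments.
\<close>

lemma flags_disjoint:
  assumes "g \<in> G" "h \<in> G" "s \<in> sides" "t \<in> sides" "g \<noteq> h \<or> s \<noteq> t"
  shows "interior (g ` fan s) \<inter> interior (h ` fan t) = {}"
proof (cases "g = h")
  case False
  have "interior (g ` F \<inter> h ` F) = {}"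
  proof -
    have "aff_dim (g ` F \<inter> h ` F) < 2"
      using tiles assms(1,2) False unfolding tiles_edge_to_edge_def edge_of_def by fastforce
    then have "aff_dim (g ` F \<inter> h ` F) \<noteq> int DIM(real^2)" by simp
    then show ?thesis using aff_dim_nonempty_interior by blast
  qed
  then have "interior (g ` F) \<inter> interior (h ` F) = {}" by simp
  moreover have "interior (g ` fan s) \<subseteq> interior (g ` F)" "interior (h ` fan t) \<subseteq> interior (h ` F)"
    using fan_subset assms(3,4) by (intro interior_mono image_mono; simp)+
  ultimately show ?thesis by blast
next
  case True
  then have "s \<noteq> t" using assms(5) by simp
  note iso = G_isometry [OF assms(1)]
  have "g ` fan s \<inter> g ` fan t = g ` (fan s \<inter> fan t)"
    using fan_in assms(3,4) inj_on_image_Int [OF hyp_isometry_inj [OF iso]] by metis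
  also have "\<dots> \<subseteq> g ` (\<Union>v\<in>corners. closed_segment center v)"
    by (rule image_mono [OF fan_overlap [OF assms(3,4) \<open>s \<noteq> t\<close>]])
  also have "\<dots> = (\<Union>v\<in>corners. closed_segment (g center) (g v))"
    unfolding image_UN using hyp_isometry_closed_segment [OF iso center_in corner_in] by simp
  finally have "negligible (g ` fan s \<inter> g ` fan t)"
    by (rule negligible_subset [rotated])
      (use negligible_segment in \<open>auto intro!: negligible_Union finite_imageI finite_corners\<close>)
  then have "negligible (interior (g ` fan s \<inter> g ` fan t))"
    by (rule negligible_subset [OF _ interior_subset])
  then have "interior (g ` fan s \<inter> g ` fan t) = {}"
    using open_not_negligible open_interior by blast
  then show ?thesis using True by simp
qed

lemma flag_end:
  assumes "g \<in> G" "s \<in> sides" "g ` s = closed_segment a b"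
  shows "\<exists>u\<in>corners. u \<in> s \<and> g u = a \<and> g (other_end u s) = b"
proof -
  note e = ends [OF assms(2)]
  have s: "end1 s \<in> s" "end2 s \<in> s" using e(5) by blast+
  have o: "other_end (end1 s) s = end2 s" "other_end (end2 s) s = end1 s"
    using other_end_eq [OF assms(2) e(3), of "end2 s"] other_end_eq [OF assms(2) e(4), of "end1 s"] e(2)
    by (simp_all add: closed_segment_commute)
  have "closed_segment a b = g ` closed_segment (end1 s) (end2 s)"
    using e(2) assms(3) by simp
  also have "\<dots> = closed_segment (g (end1 s)) (g (end2 s))"
    by (rule hyp_isometry_closed_segment [OF G_isometry [OF assms(1)] corner_in [OF e(3)] corner_in [OF e(4)]])
  finally have "{a, b} = {g (end1 s), g (end2 s)}" unfolding closed_segment_eq .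
  then consider "a = g (end1 s)" "b = g (end2 s)" | "a = g (end2 s)" "b = g (end1 s)"
    by (auto simp: doubleton_eq_iff)
  then show ?thesis
  proof cases
    case 1 then show ?thesis using e(3) s(1) o(1) by (intro bexI [of _ "end1 s"]) simp_all
  next
    case 2 then show ?thesis using e(4) s(2) o(2) by (intro bexI [of _ "end2 s"]) simp_all
  qed
qed

text \<open>
  Two triangles over the same base and on the same side of it would overlap.
\<close>

lemma flags_opposite:
  assumes "g \<in> G" "h \<in> G" "s \<in> sides" "t \<in> sides" "g \<noteq> h \<or> s \<noteq> t"
    and "g ` s = closed_segment a b" "h ` t = closed_segment a b"
  shows "cross (b - a) (g center - a) * cross (b - a) (h center - a) < 0"
proof -
  obtain u where u: "u \<in> corners" "u \<in> s" "g u = a" "g (other_end u s) = b"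
    using flag_end [OF assms(1,3,6)] by blast
  obtain w where w: "w \<in> corners" "w \<in> t" "h w = a" "h (other_end w t) = b"
    using flag_end [OF assms(2,4,7)] by blast
  have "cross (b - a) (g center - a) \<noteq> 0" "cross (b - a) (h center - a) \<noteq> 0"
    using cross_flag_nz [OF assms(1,3) u(1,2)] cross_flag_nz [OF assms(2,4) w(1,2)] u(3,4) w(3,4) by simp_all
  moreover have "\<not> cross (b - a) (g center - a) * cross (b - a) (h center - a) > 0"
  proof
    assume "cross (b - a) (g center - a) * cross (b - a) (h center - a) > 0"
    from triangles_same_side [OF this]
    show False
      using flags_disjoint [OF assms(1-5)] fan_image [OF assms(1,3) u(1,2)] fan_image [OF assms(2,4) w(1,2)] u(3,4) w(3,4)
      by simp
  qed
  ultimately show ?thesis by (metis mult_eq_0_iff not_less_iff_gr_or_eq)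
qed

text \<open>
  Only two sides of a segment are available.
\<close>

lemma three_flags:
  assumes "g1 \<in> G" "g2 \<in> G" "g3 \<in> G" "s1 \<in> sides" "s2 \<in> sides" "s3 \<in> sides"
    and "g1 ` s1 = closed_segment a b" "g2 ` s2 = closed_segment a b" "g3 ` s3 = closed_segment a b"
    and "s1 \<noteq> s2" "s2 \<noteq> s3" "s1 \<noteq> s3"
  shows False
proof -
  have "cross (b - a) (g1 center - a) * cross (b - a) (g2 center - a) < 0"
    "cross (b - a) (g2 center - a) * cross (b - a) (g3 center - a) < 0"
    "cross (b - a) (g1 center - a) * cross (b - a) (g3 center - a) < 0"
    using assms by (intro flags_opposite; simp)+
  then show False by (auto simp: mult_less_0_iff)
qed

section \<open>Sides of the polygon and edges of the surface graph\<close>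

lemma side_mate:
  assumes "s \<in> sides" obtains t g where "t \<in> sides" "t \<noteq> s" "g \<in> G" "g ` s = t"
proof -
  obtain \<sigma> \<gamma> where "\<forall>s. s edge_of F \<longrightarrow> \<sigma> s edge_of F \<and> \<sigma> s \<noteq> s \<and> \<sigma> (\<sigma> s) = s \<and>
      \<gamma> s \<in> G \<and> \<gamma> s ` s = \<sigma> s \<and> F \<inter> \<gamma> s ` F = \<sigma> s"
    using pairing unfolding sides_paired_def by blast
  then show ?thesis using that [of "\<sigma> s" "\<gamma> s"] assms by (simp add: sides_def)
qed

lemma orbits_of_image:
  assumes "g \<in> G" "S \<subseteq> hyp_plane" shows "hyp_orbit G ` (g ` S) = hyp_orbit G ` S"
  unfolding image_image by (rule image_cong [OF refl]) (use assms orbit_image in blast)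

lemma side_not_corner: "s \<in> sides \<Longrightarrow> \<exists>x\<in>s. x \<notin> corners"
proof -
  assume s: "s \<in> sides"
  note e = ends [OF s]
  let ?m = "midpoint (end1 s) (end2 s)"
  have "?m \<in> s" by (subst e(2)) simp
  moreover have "?m \<noteq> end1 s" "?m \<noteq> end2 s" using e(1) by simp_all
  ultimately have "?m \<notin> corners" using e(5) by blast
  then show ?thesis using \<open>?m \<in> s\<close> by blast
qed

text \<open>
  A point of \<open>s\<close> that is no corner lies in the tile that carries the corresponding point of \<open>t\<close>.
  Unless this tile is the polygon itself, it meets the polygon in all of \<open>s\<close>, and the preimage of \<open>s\<close> is a side that
  shares with \<open>t\<close> a point which is no corner.
\<close>

lemma same_surface_edge:
  assumes s: "s \<in> sides" and t: "t \<in> sides" and img: "hyp_orbit G ` s = hyp_orbit G ` t"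
  shows "\<exists>g\<in>G. g ` t = s"
proof -
  obtain x where x: "x \<in> s" "x \<notin> corners" using side_not_corner [OF s] by blast
  then obtain y where y: "y \<in> t" "hyp_orbit G x = hyp_orbit G y" using img by blast
  have xy: "x \<in> hyp_plane" "y \<in> hyp_plane" using x(1) y(1) side_in s t by blast+
  obtain g where g: "g \<in> G" "g y = x" using orbit_eq_iff [OF xy(2,1)] y(2) by auto
  show ?thesis
  proof (cases "g = one")
    case True
    then have "x = y" using g one_apply xy by simp
    then have "s = t" using sides_meet_in_corner [OF s t x(1)] y(1) x(2) by simp
    then show ?thesis using one_G one_image [OF side_in [OF t]] by (intro bexI [of _ one]) simp_all
  next
    case False
    have x2: "x \<in> g ` F \<inter> F" using g(2) y(1) x(1) side_subset s t by blast
    have Fone: "one ` F = F" by (rule one_image [OF F_subset])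
    have "g ` F \<inter> F = {} \<or> (\<exists>v. g ` F \<inter> F = {v} \<and> v extreme_point_of (g ` F) \<and> v extreme_point_of F) \<or>
        (g ` F \<inter> F edge_of (g ` F) \<and> g ` F \<inter> F edge_of F)"
      using tiles g(1) one_G False Fone unfolding tiles_edge_to_edge_def by metis
    moreover have "\<not> x extreme_point_of F" using x(2) by (simp add: corners_def)
    ultimately have "g ` F \<inter> F edge_of (g ` F) \<and> g ` F \<inter> F edge_of F"
      using x2 by (metis empty_iff singletonD)
    then have e: "g ` F \<inter> F edge_of (g ` F)" "g ` F \<inter> F \<in> sides"
      by (simp_all add: sides_def)
    have "g ` F \<inter> F = s" by (rule sides_meet_in_corner [OF e(2) s x2 x(1,2)])
    then have sg: "s face_of (g ` F)" using e(1) by (simp add: edge_of_def)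
    obtain h where h: "h \<in> G" "\<And>x. x \<in> hyp_plane \<Longrightarrow> h (g x) = x" "\<And>x. x \<in> hyp_plane \<Longrightarrow> g (h x) = x"
      using G_inverse [OF g(1)] by metis
    note iso = G_isometry [OF h(1)]
    have gh: "g ` (h ` S) = S" "h ` (g ` S) = S" if "S \<subseteq> hyp_plane" for S
    proof -
      have "g ` (h ` S) = id ` S" "h ` (g ` S) = id ` S"
        unfolding image_image by (rule image_cong [OF refl]; use that h in auto)+
      then show "g ` (h ` S) = S" "h ` (g ` S) = S" by simp_all
    qed
    have gF: "g ` F \<subseteq> hyp_plane" using G_in [OF g(1)] F_subset by blast
    have "(h ` s) face_of F"
      using hyp_isometry_face_of [OF iso gF sg] gh(2) [OF F_subset] by simp
    moreover have "aff_dim (h ` s) = 1"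
    proof -
      note en = ends [OF s]
      have "h ` s = closed_segment (h (end1 s)) (h (end2 s))"
        using hyp_isometry_closed_segment [OF iso corner_in [OF en(3)] corner_in [OF en(4)]] en(2) by simp
      moreover have "h (end1 s) \<noteq> h (end2 s)"
        using hyp_isometry_eq_iff [OF iso corner_in [OF en(3)] corner_in [OF en(4)]] en(1) by simp
      ultimately show ?thesis
        by (simp add: segment_convex_hull aff_dim_convex_hull aff_dim_2)
    qed
    ultimately have hs: "h ` s \<in> sides" by (simp add: sides_def edge_of_def)
    have "y \<in> h ` s" using x(1) h(2) [OF xy(2)] g(2) by (metis image_eqI)
    moreover have "y \<notin> corners"
    proof
      assume "y \<in> corners"
      then have "x extreme_point_of (g ` F)"
        using hyp_isometry_extreme_point [OF G_isometry [OF g(1)] F_subset, of y] g(2) by (simp add: corners_def)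
      then have "x extreme_point_of s" using extreme_point_of_face [OF sg] x(1) by simp
      then show False using corner_side_iff [OF s] x(2) by simp
    qed
    ultimately have "h ` s = t" using sides_meet_in_corner [OF hs t] y(1) by simp
    then have "g ` t = s" using gh(1) [OF side_in [OF s]] by simp
    then show ?thesis using g(1) by blast
  qed
qed

text \<open>
  The partner of \<open>s\<close> under the side pairing lies in the fibre. A third member would yield three flags with the
  same side.
\<close>

lemma surface_edge_fibre:
  assumes s: "s \<in> sides"
  shows "card {t \<in> sides. hyp_orbit G ` t = hyp_orbit G ` s} = 2"
proof -
  obtain t g where t: "t \<in> sides" "t \<noteq> s" "g \<in> G" "g ` s = t" by (rule side_mate [OF s])
  have ts: "hyp_orbit G ` t = hyp_orbit G ` s"
    using orbits_of_image [OF t(3) side_in [OF s]] t(4) by simp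
  have "r = s \<or> r = t" if r: "r \<in> sides" "hyp_orbit G ` r = hyp_orbit G ` s" for r
  proof (rule ccontr)
    assume "\<not> (r = s \<or> r = t)"
    then have ne: "r \<noteq> s" "r \<noteq> t" by simp_all
    obtain g where g: "g \<in> G" "g ` r = s" using same_surface_edge [OF s r(1) r(2) [symmetric]] by blast
    obtain h where h: "h \<in> G" "h ` t = s" using same_surface_edge [OF s t(1) ts [symmetric]] by blast
    note e = ends(2) [OF s]
    have "one ` s = s" by (rule one_image [OF side_in [OF s]])
    then show False
      using three_flags [OF one_G h(1) g(1) s t(1) r(1), of "end1 s" "end2 s"] h(2) g(2) e t(2) ne by metis
  qed
  then have "{t \<in> sides. hyp_orbit G ` t = hyp_orbit G ` s} = {s, t}"
    using s t(1) ts by auto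
  then show ?thesis using t(2) by simp
qed

theorem card_sides: "card sides = 2 * card (surface_edges G F)"
proof -
  let ?f = "\<lambda>s. hyp_orbit G ` s"
  have "card sides = (\<Sum>s\<in>sides. 1)" by simp
  also have "\<dots> = (\<Sum>e\<in>?f ` sides. \<Sum>s\<in>{s \<in> sides. ?f s = e}. 1)"
    by (rule sum.image_gen [OF finite_sides])
  also have "\<dots> = (\<Sum>e\<in>?f ` sides. 2)"
    using surface_edge_fibre by (intro sum.cong refl) auto
  also have "\<dots> = 2 * card (surface_edges G F)"
    by (simp add: surface_edges_def sides_def)
  finally show ?thesis .
qed

section \<open>The tiles around a vertex\<close>

definition corner_class :: "real^2 \<Rightarrow> (real^2) set" where
  "corner_class v = {u \<in> corners. hyp_orbit G u = hyp_orbit G v}"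

text \<open>
  An element \<open>(u, s, g)\<close> stands for the triangle over the side \<open>g s\<close> in the tile \<open>g F\<close>, where
  \<open>v\<close> is the image of the corner \<open>u\<close> under \<open>g\<close>. Grouping by \<open>u\<close> gives the count by the stabilizer.
\<close>

definition flags_at :: "real^2 \<Rightarrow> flag set" where
  "flags_at v = (SIGMA u:corner_class v. {s \<in> sides. u \<in> s} \<times> {g \<in> G. g u = v})"

abbreviation flag_side :: "flag \<Rightarrow> real^2" where
  "flag_side k \<equiv> (case k of (u, s, g) \<Rightarrow> g (other_end u s))"

abbreviation flag_center :: "flag \<Rightarrow> real^2" where
  "flag_center k \<equiv> (case k of (u, s, g) \<Rightarrow> g center)"

lemma flags_at_iff:
  assumes "v \<in> corners"
  shows "(u, s, g) \<in> flags_at v \<longleftrightarrow> u \<in> corners \<and> s \<in> sides \<and> u \<in> s \<and> g \<in> G \<and> g u = v"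
proof -
  have "hyp_orbit G u = hyp_orbit G v" if "u \<in> corners" "g \<in> G" "g u = v"
    using orbit_image [OF that(2) corner_in [OF that(1)]] that(3) by simp
  then show ?thesis unfolding flags_at_def corner_class_def by auto
qed

text \<open>
  The elements of the group that move \<open>u\<close> to \<open>v\<close> form a coset of the stabilizer of \<open>v\<close>.
\<close>

lemma card_moving:
  assumes v: "v \<in> corners" and u: "u \<in> corner_class v"
  shows "card {g \<in> G. g u = v} = card (hyp_stabilizer G v)"
    and "finite (hyp_stabilizer G v) \<Longrightarrow> finite {g \<in> G. g u = v}"
proof -
  have uc: "u \<in> hyp_plane" "v \<in> hyp_plane" using u v corner_in by (simp_all add: corner_class_def)
  obtain k where k: "k \<in> G" "k u = v"
    using u orbit_eq_iff [OF uc] unfolding corner_class_def by auto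
  obtain h where h: "h \<in> G" "\<And>x. x \<in> hyp_plane \<Longrightarrow> h (k x) = x" "\<And>x. x \<in> hyp_plane \<Longrightarrow> k (h x) = x"
    using G_inverse [OF k(1)] by metis
  have "bij_betw (\<lambda>g. compose hyp_plane g k) (hyp_stabilizer G v) {g \<in> G. g u = v}"
  proof (rule bij_betw_byWitness [where f' = "\<lambda>g. compose hyp_plane g h"])
    show "\<forall>g\<in>hyp_stabilizer G v. compose hyp_plane (compose hyp_plane g k) h = g"
    proof
      fix g assume "g \<in> hyp_stabilizer G v"
      then have g: "g \<in> G" by (simp add: hyp_stabilizer_iff)
      show "compose hyp_plane (compose hyp_plane g k) h = g"
        by (rule G_eqI [OF G_compose [OF G_compose [OF g k(1)] h(1)] g])
          (simp only: compose_apply G_in [OF h(1)] h(3))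
    qed
    show "\<forall>g\<in>{g \<in> G. g u = v}. compose hyp_plane (compose hyp_plane g h) k = g"
    proof
      fix g assume "g \<in> {g \<in> G. g u = v}"
      then have g: "g \<in> G" by simp
      show "compose hyp_plane (compose hyp_plane g h) k = g"
        by (rule G_eqI [OF G_compose [OF G_compose [OF g h(1)] k(1)] g])
          (simp only: compose_apply G_in [OF k(1)] h(2))
    qed
    show "(\<lambda>g. compose hyp_plane g k) ` hyp_stabilizer G v \<subseteq> {g \<in> G. g u = v}"
    proof (rule image_subsetI)
      fix g assume "g \<in> hyp_stabilizer G v"
      then have g: "g \<in> G" "g v = v" by (simp_all add: hyp_stabilizer_iff)
      have "compose hyp_plane g k u = v" unfolding compose_apply [OF uc(1)] k(2) g(2) ..
      then show "compose hyp_plane g k \<in> {g \<in> G. g u = v}" using G_compose [OF g(1) k(1)] by simp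
    qed
    show "(\<lambda>g. compose hyp_plane g h) ` {g \<in> G. g u = v} \<subseteq> hyp_stabilizer G v"
    proof (rule image_subsetI)
      fix g assume "g \<in> {g \<in> G. g u = v}"
      then have g: "g \<in> G" "g u = v" by simp_all
      have "h v = u" using h(2) [OF uc(1)] k(2) by simp
      then have "compose hyp_plane g h v = v" unfolding compose_apply [OF uc(2)] using g(2) by simp
      then show "compose hyp_plane g h \<in> hyp_stabilizer G v"
        using G_compose [OF g(1) h(1)] by (simp add: hyp_stabilizer_iff)
    qed
  qed
  from bij_betw_same_card [OF this] bij_betw_finite [OF this]
  show "card {g \<in> G. g u = v} = card (hyp_stabilizer G v)"
    "finite (hyp_stabilizer G v) \<Longrightarrow> finite {g \<in> G. g u = v}" by simp_all
qed

lemma finite_flags_at: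
  assumes "v \<in> corners" "finite (hyp_stabilizer G v)" shows "finite (flags_at v)"
  unfolding flags_at_def
  using card_moving(2) [OF assms(1) _ assms(2)] finite_corners finite_sides
  by (intro finite_SigmaI finite_cartesian_product) (simp_all add: corner_class_def)

lemma flag_cross:
  assumes "v \<in> corners" "k \<in> flags_at v"
  shows "cross (flag_side k - v) (flag_center k - v) \<noteq> 0"
proof -
  obtain u s g where k: "k = (u, s, g)" by (cases k)
  then have m: "u \<in> corners" "s \<in> sides" "u \<in> s" "g \<in> G" "g u = v"
    using assms(2) flags_at_iff [OF assms(1)] by simp_all
  show ?thesis using cross_flag_nz [OF m(4,2,1,3)] by (simp add: k m(5))
qed

abbreviation flag_sector :: "real^2 \<Rightarrow> flag \<Rightarrow> (real^2) set" where
  "flag_sector v k \<equiv> closed_sector (flag_side k - v) (flag_center k - v)"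

text \<open>
  Across the side of a flag lies the flag obtained from the side pairing. It contains \<open>v\<close> as
  well, and the two sectors fill a neighbourhood of the common ray.
\<close>

lemma flag_sectors_side_interior:
  assumes v: "v \<in> corners" and k: "k \<in> flags_at v" and "0 < \<alpha>"
  shows "\<alpha> *\<^sub>R (flag_side k - v) \<in> interior (\<Union>k\<in>flags_at v. flag_sector v k)"
proof -
  obtain u s g where usg: "k = (u, s, g)" by (cases k)
  have m: "u \<in> corners" "s \<in> sides" "u \<in> s" "g \<in> G" "g u = v"
    using k flags_at_iff [OF v] unfolding usg by simp_all
  define a where "a = g (other_end u s)"
  note o = other_end [OF m(2,1,3)]
  obtain t q where t: "t \<in> sides" "t \<noteq> s" "q \<in> G" "q ` s = t" by (rule side_mate [OF m(2)])
  obtain r where r: "r \<in> G" "\<And>x. x \<in> hyp_plane \<Longrightarrow> r (q x) = x"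
    using G_inverse [OF t(3)] by metis
  define h where "h = compose hyp_plane g r"
  have h: "h \<in> G" unfolding h_def by (rule G_compose [OF m(4) r(1)])
  have gs: "g ` s = closed_segment v a"
  proof -
    have "g ` s = g ` closed_segment u (other_end u s)" using o(1) by simp
    then show ?thesis
      using hyp_isometry_closed_segment [OF G_isometry [OF m(4)] corner_in [OF m(1)] corner_in [OF o(3)]]
      by (simp add: m(5) a_def)
  qed
  have "h (q x) = g x" if "x \<in> s" for x
    using that side_in [OF m(2)] G_in [OF t(3)] r(2) compose_apply [of "q x" g r] unfolding h_def by auto
  then have "h ` t = g ` s"
    unfolding t(4) [symmetric] image_image by (intro image_cong refl)
  then have ht: "h ` t = closed_segment v a" using gs by simp
  then obtain w where w: "w \<in> corners" "w \<in> t" "h w = v" "h (other_end w t) = a"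
    using flag_end [OF h t(1)] by blast
  have k': "(w, t, h) \<in> flags_at v"
    using w t(1) h flags_at_iff [OF v] by simp
  have "cross (a - v) (g center - v) * cross (a - v) (h center - v) < 0"
    by (rule flags_opposite [OF m(4) h m(2) t(1) _ gs ht]) (use t(2) in simp)
  then have "\<alpha> *\<^sub>R (a - v) \<in> interior (closed_sector (a - v) (g center - v) \<union> closed_sector (a - v) (h center - v))"
    using \<open>0 < \<alpha>\<close> by (rule common_side_interior)
  moreover have "closed_sector (a - v) (g center - v) = flag_sector v k"
    by (simp add: usg a_def)
  moreover have "closed_sector (a - v) (h center - v) = flag_sector v (w, t, h)"
    by (simp add: w(4))
  ultimately have "\<alpha> *\<^sub>R (a - v) \<in> interior (flag_sector v k \<union> flag_sector v (w, t, h))"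
    by simp
  moreover have "interior (flag_sector v k \<union> flag_sector v (w, t, h)) \<subseteq> interior (\<Union>k\<in>flags_at v. flag_sector v k)"
    using k k' by (intro interior_mono) blast
  ultimately show ?thesis by (auto simp: usg a_def)
qed

lemma flag_sectors_scale:
  assumes "d \<in> (\<Union>k\<in>flags_at v. flag_sector v k)" "0 \<le> c"
  shows "c *\<^sub>R d \<in> (\<Union>k\<in>flags_at v. flag_sector v k)"
proof -
  obtain k where k: "k \<in> flags_at v" "d \<in> flag_sector v k" using assms(1) by (rule UN_E)
  have "c *\<^sub>R d \<in> flag_sector v k" by (rule closed_sector_scale [OF k(2) assms(2)])
  then show ?thesis using k(1) by blast
qed

text \<open>
  The segment from \<open>v\<close> to the center of the tile runs through the interior of the tile. Close to
  \<open>v\<close> it avoids the triangles of this tile that do not contain \<open>v\<close>, hence the sectors of the remaining ones fill a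
  neighbourhood of its points.
\<close>

lemma flag_sectors_center_interior:
  assumes v: "v \<in> corners" and k: "k \<in> flags_at v" and "0 < \<beta>"
  shows "\<beta> *\<^sub>R (flag_center k - v) \<in> interior (\<Union>k\<in>flags_at v. flag_sector v k)"
proof -
  let ?C = "\<Union>k\<in>flags_at v. flag_sector v k"
  obtain u s g where usg: "k = (u, s, g)" by (cases k)
  have m: "u \<in> corners" "s \<in> sides" "u \<in> s" "g \<in> G" "g u = v"
    using k flags_at_iff [OF v] unfolding usg by simp_all
  note iso = G_isometry [OF m(4)]
  \<comment> \<open>The part of the tile that stays away from \<open>v\<close>.\<close>
  define W where "W = (\<Union>t\<in>{t \<in> sides. u \<notin> t}. g ` fan t)"
  have "closed W"
    unfolding W_def
  proof (intro closed_UN ballI compact_imp_closed)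
    show "finite {t \<in> sides. u \<notin> t}" using finite_sides by simp
    fix t assume "t \<in> {t \<in> sides. u \<notin> t}"
    then show "compact (g ` fan t)"
      by (intro compact_continuous_image continuous_on_subset [OF G_continuous [OF m(4)]] fan_compact fan_in) auto
  qed
  have "v \<notin> W"
  proof
    assume "v \<in> W"
    then obtain t x where t: "t \<in> sides" "u \<notin> t" "x \<in> fan t" "g x = v"
      unfolding W_def by auto
    have "x \<in> hyp_plane" using fan_in [OF t(1)] t(3) by (rule subsetD)
    then have "x = u"
      using hyp_isometry_eq_iff [OF iso _ corner_in [OF m(1)]] t(4) m(5) by simp
    then obtain y where y: "y \<in> t" "u \<in> closed_segment center y" using fan_eq [OF t(1) t(3)] by auto
    have "y \<in> F" using side_subset [OF t(1)] y(1) by (rule subsetD)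
    then have "u \<notin> open_segment center y"
      using m(1) center_F unfolding corners_def extreme_point_of_def by simp
    then have "u = center" using y t(2) unfolding open_segment_def by blast
    then show False using m(3) center_not_side [OF m(2)] by blast
  qed
  define c where "c = g center - v"
  have "open (- W)" using \<open>closed W\<close> by (rule open_Compl)
  then obtain e where e: "0 < e" "ball v e \<subseteq> - W"
    using \<open>v \<notin> W\<close> unfolding open_contains_ball by blast
  define t where "t = min (1 / 2) (e / (2 * (norm c + 1)))"
  have t: "0 < t" "t < 1" "t * norm c < e"
  proof -
    show "0 < t" "t < 1" using e(1) by (simp_all add: t_def add_nonneg_pos)
    have "t * norm c \<le> e / (2 * (norm c + 1)) * norm c"
      by (intro mult_right_mono) (simp_all add: t_def)
    also have "\<dots> < e"
      using e(1) by (simp add: divide_simps add_nonneg_pos)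
    finally show "t * norm c < e" .
  qed
  define z where "z = v + t *\<^sub>R c"
  have "z \<in> ball v e" using t by (simp add: z_def dist_norm)
  then have zW: "z \<in> - W" using e(2) by blast
  have c0: "c \<noteq> 0" unfolding c_def using cross_nz(2) [OF flag_cross [OF v k]] by (simp add: usg)
  have zi: "z \<in> interior (g ` F)"
  proof -
    have "interior F \<subseteq> hyp_plane" using interior_subset F_subset by blast
    then have "open (g ` interior F)" by (intro G_open_image m(4) open_interior)
    then have "g center \<in> interior (g ` F)"
      using center interior_subset by (intro interiorI [of "g ` interior F"]) auto
    moreover have "convex (g ` F)" by (rule hyp_isometry_convex [OF iso F_subset convex_F])
    moreover have "v \<in> closure (g ` F)"
      using m(5) corner_F [OF m(1)] closure_subset [of "g ` F"] by blast
    ultimately have "open_segment (g center) v \<subseteq> interior (g ` F)"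
      by (intro in_interior_closure_convex_segment)
    moreover have "z \<in> open_segment (g center) v"
    proof -
      have "z = (1 - (1 - t)) *\<^sub>R g center + (1 - t) *\<^sub>R v"
        unfolding z_def c_def by (simp add: algebra_simps)
      moreover have "g center \<noteq> v" using c0 by (simp add: c_def)
      moreover have "0 < 1 - t" "1 - t < 1" using t by simp_all
      ultimately show ?thesis unfolding in_segment by metis
    qed
    ultimately show ?thesis by blast
  qed
  have zC: "z - v \<in> interior ?C"
  proof (rule interiorI)
    let ?U = "interior (g ` F) \<inter> - W"
    show "open ((\<lambda>x. x - v) ` ?U)"
      using \<open>open (- W)\<close> by (intro open_translation_subtract open_Int open_interior)
    show "z - v \<in> (\<lambda>x. x - v) ` ?U" using zi zW by blast
    show "(\<lambda>x. x - v) ` ?U \<subseteq> ?C"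
    proof (rule image_subsetI)
      fix x assume x: "x \<in> ?U"
      then have "x \<in> g ` F" using interior_subset by blast
      then obtain r where r: "r \<in> sides" "x \<in> g ` fan r" using fan_cover by blast
      then have ur: "u \<in> r" using x unfolding W_def by blast
      have "x - v \<in> closed_sector (g (other_end u r) - v) (g center - v)"
        using closed_triangle_sector r(2) fan_image [OF m(4) r(1) m(1) ur] m(5) by simp
      moreover have "(u, r, g) \<in> flags_at v" using m r(1) ur flags_at_iff [OF v] by simp
      ultimately show "x - v \<in> ?C" by force
    qed
  qed
  have "0 < \<beta> / t" using t(1) \<open>0 < \<beta>\<close> by simp
  then have "(\<beta> / t) *\<^sub>R (z - v) \<in> interior ?C"
    by (intro interior_cone_scale [OF _ zC] flag_sectors_scale)
  moreover have "(\<beta> / t) *\<^sub>R (z - v) = \<beta> *\<^sub>R (flag_center k - v)"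
    using t by (simp add: z_def c_def usg)
  ultimately show ?thesis by simp
qed

text \<open>
  Away from the apex the union of the sectors is closed and open, and the punctured plane is
  connected. The tiles that contain \<open>v\<close> thus close up around \<open>v\<close>.
\<close>

lemma flag_sectors_cover:
  assumes v: "v \<in> corners" and fin: "finite (hyp_stabilizer G v)"
  shows "(\<Union>k\<in>flags_at v. flag_sector v k) = UNIV"
proof -
  define C where "C = (\<Union>k\<in>flags_at v. flag_sector v k)"
  have closed: "closed C"
    unfolding C_def
    by (intro closed_UN ballI finite_flags_at v fin closed_closed_sector flag_cross)
  have interior: "C - {0} \<subseteq> interior C"
  proof
    fix d assume d: "d \<in> C - {0}"
    then obtain k where k: "k \<in> flags_at v" "d \<in> flag_sector v k" unfolding C_def by blast
    then obtain \<alpha> \<beta> where ab: "0 \<le> \<alpha>" "0 \<le> \<beta>" "d = \<alpha> *\<^sub>R (flag_side k - v) + \<beta> *\<^sub>R (flag_center k - v)"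
      unfolding closed_sector_def by blast
    consider "0 < \<alpha>" "0 < \<beta>" | "0 < \<alpha>" "\<beta> = 0" | "\<alpha> = 0" "0 < \<beta>" | "\<alpha> = 0" "\<beta> = 0" using ab(1,2) by linarith
    then show "d \<in> interior C"
    proof cases
      case 1
      have "open_sector (flag_side k - v) (flag_center k - v) \<subseteq> flag_sector v k"
        unfolding open_sector_def closed_sector_def using less_imp_le by blast
      moreover have "d \<in> open_sector (flag_side k - v) (flag_center k - v)"
        unfolding open_sector_def using 1 ab(3) by blast
      ultimately show ?thesis
        using k(1) unfolding C_def by (intro interiorI [OF open_open_sector [OF flag_cross [OF v k(1)]]]) blast+
    next
      case 2
      then show ?thesis using flag_sectors_side_interior [OF v k(1)] ab(3) unfolding C_def by simp
    next
      case 3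
      then show ?thesis using flag_sectors_center_interior [OF v k(1)] ab(3) unfolding C_def by simp
    next
      case 4
      then show ?thesis using d ab(3) by simp
    qed
  qed
  obtain s where s: "s \<in> sides" "v \<in> s" using corner_on_side [OF v] by blast
  have k0: "(v, s, one) \<in> flags_at v"
    using v s one_G one_apply corner_in flags_at_iff [OF v] by simp
  then have "flag_side (v, s, one) - v \<in> C" "flag_side (v, s, one) - v \<noteq> 0"
  proof -
    show "flag_side (v, s, one) - v \<noteq> 0" by (rule cross_nz(1) [OF flag_cross [OF v k0]])
    have "flag_side (v, s, one) - v = 1 *\<^sub>R (flag_side (v, s, one) - v) + 0 *\<^sub>R (flag_center (v, s, one) - v)"
      by simp
    then have "flag_side (v, s, one) - v \<in> flag_sector v (v, s, one)"
      unfolding closed_sector_def using zero_le_one order_refl by blast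
    then show "flag_side (v, s, one) - v \<in> C" unfolding C_def using k0 by blast
  qed
  then have ne: "C \<inter> (- {0}) \<noteq> {}" by blast
  have "connected (- {0 :: real^2})" by (rule connected_punctured_universe) simp
  then have "\<not> (\<exists>A B. open A \<and> open B \<and> - {0} \<subseteq> A \<union> B \<and> A \<inter> B \<inter> - {0} = {} \<and> A \<inter> - {0} \<noteq> {} \<and> B \<inter> - {0 :: real^2} \<noteq> {})"
    unfolding connected_def .
  moreover have "open (interior C)" "open (- C)"
    using closed by (simp_all add: open_Compl)
  moreover have "- {0} \<subseteq> interior C \<union> - C" "interior C \<inter> - C \<inter> - {0} = {}" "interior C \<inter> - {0} \<noteq> {}"
    using interior ne interior_subset [of C] by blast+
  ultimately have "- C \<inter> - {0} = {}" by metis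
  moreover have "0 \<in> C"
    using flag_sectors_scale [of "flag_side (v, s, one) - v" v 0] \<open>flag_side (v, s, one) - v \<in> C\<close> unfolding C_def by simp
  ultimately have "C = UNIV" by blast
  then show ?thesis unfolding C_def .
qed

lemma flag_angle_sum:
  assumes v: "v \<in> corners" and fin: "finite (hyp_stabilizer G v)"
  shows "(\<Sum>k\<in>flags_at v. hyp_angle v (flag_side k) (flag_center k)) = 2 * pi"
proof (rule sum_hyp_angle_sectors [OF corner_in [OF v] finite_flags_at [OF v fin] flag_cross [OF v]])
  fix j k assume jk: "j \<in> flags_at v" "k \<in> flags_at v" "j \<noteq> k"
  obtain u s g where usg: "j = (u, s, g)" by (cases j)
  obtain w t h where wth: "k = (w, t, h)" by (cases k)
  have m: "u \<in> corners" "s \<in> sides" "u \<in> s" "g \<in> G" "g u = v"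
    and n: "w \<in> corners" "t \<in> sides" "w \<in> t" "h \<in> G" "h w = v"
    using jk(1,2) flags_at_iff [OF v] unfolding usg wth by simp_all
  have "g \<noteq> h \<or> s \<noteq> t"
  proof (rule ccontr)
    assume "\<not> (g \<noteq> h \<or> s \<noteq> t)"
    then have "g = h" "s = t" by simp_all
    moreover from this have "u = w"
      using hyp_isometry_eq_iff [OF G_isometry [OF m(4)] corner_in [OF m(1)] corner_in [OF n(1)]] m(5) n(5) by simp
    ultimately show False using jk(3) usg wth by simp
  qed
  then have "interior (g ` fan s) \<inter> interior (h ` fan t) = {}"
    by (rule flags_disjoint [OF m(4) n(4) m(2) n(2)])
  then have "interior (convex hull {v, flag_side j, flag_center j}) \<inter> interior (convex hull {v, flag_side k, flag_center k}) = {}"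
    using fan_image [OF m(4,2,1,3)] fan_image [OF n(4,2,1,3)] m(5) n(5) by (simp add: usg wth)
  then show "open_sector (flag_side j - v) (flag_center j - v) \<inter> open_sector (flag_side k - v) (flag_center k - v) = {}"
    by (rule open_sectors_disjoint [OF flag_cross [OF v jk(1)] flag_cross [OF v jk(2)]])
qed (assumption, rule flag_sectors_cover [OF v fin])

text \<open>
  A corner \<open>u\<close> of the class contributes its angles to the full angle at \<open>v\<close> once for each element of
  the group that moves \<open>u\<close> to \<open>v\<close>.
\<close>

theorem corner_class_angle_sum:
  assumes v: "v \<in> corners" and fin: "finite (hyp_stabilizer G v)"
  shows "real (card (hyp_stabilizer G v)) * (\<Sum>u\<in>corner_class v. \<Sum>s\<in>{s \<in> sides. u \<in> s}. corner_angle u s) = 2 * pi"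
proof -
  have angle: "hyp_angle v (g (other_end u s)) (g center) = corner_angle u s"
    if "(u, s, g) \<in> flags_at v" for u s g
  proof -
    have m: "u \<in> corners" "s \<in> sides" "u \<in> s" "g \<in> G" "g u = v"
      using that flags_at_iff [OF v] by simp_all
    show ?thesis
      unfolding corner_angle_def m(5) [symmetric]
      by (rule hyp_isometry_hyp_angle [OF G_isometry [OF m(4)] corner_in [OF m(1)]
          corner_in [OF other_end(3) [OF m(2,1,3)]] center_in])
  qed
  have "2 * pi = (\<Sum>k\<in>flags_at v. hyp_angle v (flag_side k) (flag_center k))"
    by (rule flag_angle_sum [OF v fin, symmetric])
  also have "\<dots> = (\<Sum>(u, s, g)\<in>flags_at v. corner_angle u s)"
    by (rule sum.cong [OF refl]) (use angle in auto)
  also have "\<dots> = (\<Sum>u\<in>corner_class v. \<Sum>(s, g)\<in>{s \<in> sides. u \<in> s} \<times> {g \<in> G. g u = v}. corner_angle u s)"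
    unfolding flags_at_def
    using card_moving(2) [OF v _ fin] finite_corners finite_sides
    by (subst sum.Sigma) (auto simp: corner_class_def)
  also have "\<dots> = (\<Sum>u\<in>corner_class v. \<Sum>s\<in>{s \<in> sides. u \<in> s}. \<Sum>g\<in>{g \<in> G. g u = v}. corner_angle u s)"
    by (intro sum.cong refl sum.cartesian_product [symmetric])
  also have "\<dots> = (\<Sum>u\<in>corner_class v. \<Sum>s\<in>{s \<in> sides. u \<in> s}. real (card (hyp_stabilizer G v)) * corner_angle u s)"
    using card_moving(1) [OF v] by (intro sum.cong refl) simp
  finally show ?thesis
    by (simp only: sum_distrib_left)
qed

text \<open>
  Gauss-Bonnet for the quotient. The Hilbert choice picks a corner in the orbit \<open>x\<close>; the order
  of the stabilizer is the same for all of them.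
\<close>

theorem hyp_area_orbifold:
  assumes "\<And>v. v \<in> corners \<Longrightarrow> finite (hyp_stabilizer G v)"
  shows "hyp_area F = 2 * (real (card (surface_edges G F)) - 1) * pi
    - (\<Sum>x\<in>surface_vertices G F. 2 * pi / real (card (hyp_stabilizer G (SOME v. v \<in> corners \<and> hyp_orbit G v = x))))"
proof -
  have sv: "surface_vertices G F = hyp_orbit G ` corners"
    by (simp add: surface_vertices_def corners_def)
  have "(\<Sum>u\<in>corners. \<Sum>s\<in>{s \<in> sides. u \<in> s}. corner_angle u s)
      = (\<Sum>x\<in>hyp_orbit G ` corners. \<Sum>u\<in>{u \<in> corners. hyp_orbit G u = x}. \<Sum>s\<in>{s \<in> sides. u \<in> s}. corner_angle u s)"
    by (rule sum.image_gen [OF finite_corners])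
  also have "\<dots> = (\<Sum>x\<in>surface_vertices G F. 2 * pi / real (card (hyp_stabilizer G (SOME v. v \<in> corners \<and> hyp_orbit G v = x))))"
    unfolding sv
  proof (rule sum.cong [OF refl])
    fix x assume "x \<in> hyp_orbit G ` corners"
    then have "\<exists>v. v \<in> corners \<and> hyp_orbit G v = x" by blast
    then have v: "(SOME v. v \<in> corners \<and> hyp_orbit G v = x) \<in> corners \<and> hyp_orbit G (SOME v. v \<in> corners \<and> hyp_orbit G v = x) = x"
      by (rule someI_ex)
    define v where "v = (SOME v. v \<in> corners \<and> hyp_orbit G v = x)"
    have vc: "v \<in> corners" "hyp_orbit G v = x" using v by (simp_all add: v_def)
    have cls: "{u \<in> corners. hyp_orbit G u = x} = corner_class v" by (simp add: corner_class_def vc(2))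
    have one_mem: "one \<in> hyp_stabilizer G v"
      using one_G one_apply [OF corner_in [OF vc(1)]] by (simp add: hyp_stabilizer_iff)
    then have "card (hyp_stabilizer G v) > 0"
      using assms [OF vc(1)] by (auto simp: card_gt_0_iff)
    then show "(\<Sum>u\<in>{u \<in> corners. hyp_orbit G u = x}. \<Sum>s\<in>{s \<in> sides. u \<in> s}. corner_angle u s)
        = 2 * pi / real (card (hyp_stabilizer G (SOME v. v \<in> corners \<and> hyp_orbit G v = x)))"
      using corner_class_angle_sum [OF vc(1) assms [OF vc(1)]] unfolding cls v_def [symmetric]
      by (simp add: nonzero_eq_divide_eq mult.commute)
  qed
  finally show ?thesis
    unfolding hyp_area_polygon card_sides by (simp add: algebra_simps)
qed

end

section \<open>Trees\<close>

text \<open>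
  A walk that never returns along the edge just used can always be continued. The first
  repetition of a vertex closes a cycle.
\<close>

lemma finite_graph_min_degree_2_cycle:
  fixes V :: "'p set"
  assumes fin: "finite V" and "V \<noteq> {}" 
    and ends: "\<And>e. e \<in> E \<Longrightarrow> card (e \<inter> V) = 2"
    and deg: "\<And>x. x \<in> V \<Longrightarrow> \<exists>e\<in>E. \<exists>f\<in>E. e \<noteq> f \<and> x \<in> e \<and> x \<in> f"
  shows "\<exists>k p c. graph_cycle V E k p c"
proof -
  have other: "\<exists>y. y \<in> V \<and> y \<noteq> x \<and> e \<inter> V = {x, y}" if ex: "e \<in> E" "x \<in> e" "x \<in> V" for e x
  proof -
    obtain a b where ab: "e \<inter> V = {a, b}" "a \<noteq> b"
      using ends [OF ex(1)] unfolding card_2_iff by blast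
    moreover have "x = a \<or> x = b"
      using ex(2,3) ab(1) by blast
    ultimately show ?thesis
      by (metis IntE insertCI insert_commute)
  qed
  \<comment> \<open>A state is a vertex together with the edge by which it was reached.\<close>
  define step where "step s t \<longleftrightarrow> fst t \<in> V \<and> snd t \<in> E \<and> fst t \<in> snd t \<and>
      fst t \<noteq> fst s \<and> snd t \<noteq> snd s \<and> snd t \<inter> V = {fst s, fst t}" for s t :: "'p \<times> 'p set"
  have ex_step: "\<exists>t. step s t" if s: "fst s \<in> V" for s
  proof -
    obtain e f where ef: "e \<in> E" "f \<in> E" "e \<noteq> f" "fst s \<in> e" "fst s \<in> f"
      using deg [OF s] by blast
    then obtain g where g: "g \<in> E" "g \<noteq> snd s" "fst s \<in> g"
      by metis
    then obtain y where y: "y \<in> V" "y \<noteq> fst s" "g \<inter> V = {fst s, y}"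
      using other s by blast
    then have "step s (y, g)"
      using g unfolding step_def by (metis IntE fst_conv snd_conv insertCI)
    then show ?thesis ..
  qed
  obtain x where x: "x \<in> V" using \<open>V \<noteq> {}\<close> by blast
  have "\<exists>w. \<forall>n. fst (w n) \<in> V \<and> step (w n) (w (Suc n))"
  proof (rule dependent_nat_choice)
    show "\<exists>s. fst s \<in> V" using x by auto
    show "\<exists>t. fst t \<in> V \<and> step s t" if "fst s \<in> V" for s
      using ex_step [OF that] unfolding step_def by metis
  qed
  then obtain w where w: "\<And>n. fst (w n) \<in> V" "\<And>n. step (w n) (w (Suc n))"
    by blast
  define p where "p n = fst (w n)" for n
  define c where "c n = snd (w (Suc n))" for n
  have p: "p n \<in> V" "p (Suc n) \<noteq> p n" and c: "c n \<in> E" "c (Suc n) \<noteq> c n" "c n \<inter> V = {p n, p (Suc n)}" for n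
    using w(1) [of n] w(2) [of n] w(2) [of "Suc n"] unfolding p_def c_def step_def by simp_all
  have "finite (range p)"
    using fin p(1) by (auto intro: finite_subset)
  then have "\<not> inj_on p UNIV"
    using finite_imageD infinite_UNIV_nat by blast
  then obtain i' j' where "i' < j'" "p i' = p j'"
    unfolding inj_on_def using linorder_neqE_nat by (metis (no_types))
  define j where "j = (LEAST j. \<exists>i<j. p i = p j)"
  have "\<exists>i<j. p i = p j"
    unfolding j_def using \<open>i' < j'\<close> \<open>p i' = p j'\<close> by (intro LeastI [of "\<lambda>j. \<exists>i<j. p i = p j"]) blast
  then obtain i where ij: "i < j" "p i = p j" by blast
  have inj: "a = b" if "a < j" "b < j" "p a = p b" for a b
    using that not_less_Least [of a "\<lambda>j. \<exists>i<j. p i = p j"] not_less_Least [of b "\<lambda>j. \<exists>i<j. p i = p j"]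
    unfolding j_def [symmetric] by (metis linorder_neqE_nat)
  define k where "k = j - i"
  have "j \<noteq> Suc i" using ij p(2) [of i] by auto
  then have k: "k \<ge> 2" using ij by (simp add: k_def)
  have injc: "a = b" if ab: "i \<le> a" "a \<le> b" "b < j" "c a = c b" for a b
  proof (rule ccontr)
    assume "a \<noteq> b"
    then have "a < b" using ab by simp
    have e: "{p a, p (Suc a)} = {p b, p (Suc b)}"
      using c(3) [of a] c(3) [of b] ab by simp
    have "p a \<noteq> p b" using inj [of a b] ab \<open>a < b\<close> by auto
    with e have e2: "p a = p (Suc b)" "p (Suc a) = p b" by (auto simp: doubleton_eq_iff)
    then have "b = Suc a"
      using inj [of "Suc a" b] ab \<open>a < b\<close> by auto
    then show False using c(2) [of a] ab by simp
  qed
  have "graph_cycle V E k (\<lambda>n. p (i + n)) (\<lambda>n. c (i + n))"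
    unfolding graph_cycle_def
  proof (intro conjI allI impI)
    show "inj_on (\<lambda>n. p (i + n)) {..<k}"
    proof (rule inj_onI)
      fix x y assume "x \<in> {..<k}" "y \<in> {..<k}" "p (i + x) = p (i + y)"
      then show "x = y" using inj [of "i + x" "i + y"] by (simp add: k_def)
    qed
    show "inj_on (\<lambda>n. c (i + n)) {..<k}"
    proof (rule inj_onI)
      fix x y assume "x \<in> {..<k}" "y \<in> {..<k}" "c (i + x) = c (i + y)"
      moreover from this have "i + x < j" "i + y < j"
        unfolding k_def lessThan_iff by linarith+
      ultimately show "x = y" using injc [of "i + x" "i + y"] injc [of "i + y" "i + x"]
        by (cases "x \<le> y") simp_all
    qed
    fix n assume "n < k"
    show "c (i + n) \<inter> V = {p (i + n), p (i + Suc n mod k)}"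
    proof (cases "Suc n = k")
      case True
      then have "i + Suc n = j" using ij by (simp add: k_def)
      then have "p (Suc (i + n)) = p i" using ij by simp
      then show ?thesis using c(3) [of "i + n"] True by simp
    next
      case False
      then have "Suc n mod k = Suc n" using \<open>n < k\<close> by simp
      then show ?thesis using c(3) [of "i + n"] by simp
    qed
  qed (use k p c in auto)
  then show ?thesis by blast
qed

text \<open>
  Removing a vertex of degree at most one removes at most one edge, so a smallest counterexample has
  minimum degree two.
\<close>

lemma graph_cycle_exists:
  fixes V :: "'p set"
  assumes "finite V" "finite E" "V \<noteq> {}" "\<And>e. e \<in> E \<Longrightarrow> card (e \<inter> V) = 2" "card V \<le> card E"
  shows "\<exists>k p c. graph_cycle V E k p c"
  using assms
proof (induction "card V" arbitrary: V E rule: less_induct)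
  case less
  show ?case
  proof (cases "\<forall>x\<in>V. \<exists>e\<in>E. \<exists>f\<in>E. e \<noteq> f \<and> x \<in> e \<and> x \<in> f")
    case True
    then show ?thesis
      using less.prems by (intro finite_graph_min_degree_2_cycle) auto
  next
    case False
    then obtain x where x: "x \<in> V" and u: "\<And>e f. e \<in> E \<Longrightarrow> f \<in> E \<Longrightarrow> x \<in> e \<Longrightarrow> x \<in> f \<Longrightarrow> e = f"
      by blast
    let ?V = "V - {x}" and ?E = "{e \<in> E. x \<notin> e}"
    have cV: "card ?V = card V - 1" "card V > 0"
      using less.prems x by (auto simp: card_gt_0_iff)
    have "card {e \<in> E. x \<in> e} \<le> 1"
      using u less.prems(2) by (auto simp: card_le_Suc0_iff_eq)
    moreover have "card E = card ?E + card {e \<in> E. x \<in> e}"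
      using less.prems(2) by (subst card_Un_disjoint [symmetric]) (auto intro: arg_cong [of _ _ card])
    ultimately have cE: "card ?V \<le> card ?E"
      using less.prems(5) cV by linarith
    have int: "e \<inter> ?V = e \<inter> V" if "e \<in> ?E" for e
      using that by auto
    have "?V \<noteq> {}"
    proof
      assume "?V = {}"
      then have V: "V = {x}" using x by auto
      then obtain e where "e \<in> E"
        using less.prems(5) by fastforce
      then have "card (e \<inter> {x}) = 2" using less.prems(4) V by blast
      moreover have "card (e \<inter> {x}) \<le> 1" using card_mono [of "{x}" "e \<inter> {x}"] by simp
      ultimately show False by simp
    qed
    then obtain k p c where cyc: "graph_cycle ?V ?E k p c"
      using less.hyps [of ?V ?E] cV cE less.prems(1,2,4) int by (metis (no_types, lifting)
        diff_less finite_Diff finite_subset less_numeral_extra(1) mem_Collect_eq subsetI)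
    have "graph_cycle V E k p c"
    proof -
      have "c i \<in> ?E" if "i < k" for i
        using cyc that unfolding graph_cycle_def by blast
      then have "c i \<inter> V = c i \<inter> ?V" if "i < k" for i
        using int that by blast
      then show ?thesis
        using cyc unfolding graph_cycle_def by auto
    qed
    then show ?thesis by blast
  qed
qed

text \<open>
  Each vertex other than a root \<open>r\<close> has an edge towards \<open>r\<close>, one step closer to it, and different vertices have
  different such edges.
\<close>

lemma connected_graph_card_le:
  assumes "finite V" "finite E" and conn: "\<And>x y. x \<in> V \<Longrightarrow> y \<in> V \<Longrightarrow> (x, y) \<in> (graph_adjacent V E)\<^sup>*"
    and "V \<noteq> {}" 
  shows "card V \<le> Suc (card E)"
proof -
  obtain r where r: "r \<in> V" using assms by blast
  let ?A = "graph_adjacent V E"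
  define d where "d x = (LEAST n. (r, x) \<in> ?A ^^ n)" for x
  have ex: "\<exists>e\<in>E. \<exists>y. e \<inter> V = {y, x} \<and> d x = Suc (d y)" if x: "x \<in> V - {r}" for x
  proof -
    have dr: "(r, x) \<in> ?A ^^ d x" if "x \<in> V" for x
    proof -
      from conn [OF r that] obtain n where "(r, x) \<in> ?A ^^ n"
        using rtrancl_imp_relpow by blast
      then show ?thesis unfolding d_def by (rule LeastI)
    qed
    obtain m where m: "d x = Suc m"
      using dr [of x] x by (cases "d x") auto
    with dr [of x] x obtain y where y: "(r, y) \<in> ?A ^^ m" "(y, x) \<in> ?A"
      by (auto elim: relpow_Suc_E)
    from y(2) obtain e where e: "e \<in> E" "e \<inter> V = {y, x}"
      by (auto simp: graph_adjacent_def)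
    then have "y \<in> V" by blast
    have "d y \<le> m" unfolding d_def using y(1) by (rule Least_le)
    moreover have "(r, x) \<in> ?A ^^ Suc (d y)"
      using dr [OF \<open>y \<in> V\<close>] y(2) by auto
    then have "d x \<le> Suc (d y)" unfolding d_def [of x] by (rule Least_le)
    ultimately show ?thesis using e m by auto
  qed
  then obtain f g where fg: "\<And>x. x \<in> V - {r} \<Longrightarrow> f x \<in> E \<and> f x \<inter> V = {g x, x} \<and> d x = Suc (d (g x))"
    by metis
  have "inj_on f (V - {r})"
  proof (rule inj_onI, rule ccontr)
    fix x y assume xy: "x \<in> V - {r}" "y \<in> V - {r}" "f x = f y" "x \<noteq> y"
    then have "{g x, x} = {g y, y}" using fg by metis
    then have "g x = y" "g y = x" using xy by (auto simp: doubleton_eq_iff)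
    then show False using fg [OF xy(1)] fg [OF xy(2)] by simp
  qed
  then have "card (V - {r}) \<le> card E"
    using fg assms by (intro card_inj_on_le) auto
  then show ?thesis using r assms by (simp add: card_Diff_singleton)
qed

theorem tree_graph_card:
  assumes "tree_graph V E" shows "card V = Suc (card E)"
proof (rule antisym)
  show "card V \<le> Suc (card E)"
    using assms by (intro connected_graph_card_le) (auto simp: tree_graph_def)
  show "Suc (card E) \<le> card V"
    using assms graph_cycle_exists [of V E] unfolding tree_graph_def by (metis not_less_eq_eq)
qed

section \<open>The area of a fundamental domain\<close>

theorem mainTheorem3:
  fixes l :: nat and G :: "(real^2 \<Rightarrow> real^2) set" and F :: "(real^2) set"
  assumes "l \<ge> 4"
    and "group_of_type_3s l G"
    and "fundamental_domain G F"
  shows "hyp_area F = (4 / 3 * real l - 4) * pi"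
proof -
  interpret hyp_tiling F G
    using assms(2,3) by unfold_locales (simp_all add: fundamental_domain_def group_of_type_3s_def)
  let ?V = "surface_vertices G F" and ?E = "surface_edges G F" and ?C = "cone_points G"
  have tree: "tree_graph ?V ?E" and CV: "?C \<subseteq> ?V"
    using assms(3) by (simp_all add: fundamental_domain_def tree_surface_graph_def)
  have finV: "finite ?V" using tree by (simp add: tree_graph_def)
  have l: "card ?C = l" using assms(2) by (simp add: group_of_type_3s_def)
  have three: "card (hyp_stabilizer G v) = 3" if "v \<in> hyp_plane" "hyp_orbit G v \<in> ?C" for v
    using assms(2) that unfolding group_of_type_3s_def by blast
  have trivial: "hyp_stabilizer G v = {\<one>\<^bsub>BijGroup hyp_plane\<^esub>}"
    if "v \<in> hyp_plane" "hyp_orbit G v \<notin> ?C" for v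
    using that unfolding cone_points_def by blast
  have fin: "finite (hyp_stabilizer G v)" if "v \<in> corners" for v
  proof (cases "hyp_orbit G v \<in> ?C")
    case True
    then have "card (hyp_stabilizer G v) = 3" by (rule three [OF corner_in [OF that]])
    then show ?thesis by (intro card_ge_0_finite) simp
  next
    case False
    then show ?thesis using trivial [OF corner_in [OF that]] by simp
  qed
  let ?v = "\<lambda>x. SOME v. v \<in> corners \<and> hyp_orbit G v = x"
  have "2 * pi / real (card (hyp_stabilizer G (?v x))) = (if x \<in> ?C then 2 * pi / 3 else 2 * pi)"
    if "x \<in> ?V" for x
  proof -
    have "\<exists>v. v \<in> corners \<and> hyp_orbit G v = x"
      using that unfolding surface_vertices_def corners_def by blast
    then have "?v x \<in> corners \<and> hyp_orbit G (?v x) = x" by (rule someI_ex)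
    then show ?thesis
      using three [of "?v x"] trivial [of "?v x"] corner_in [of "?v x"] by simp
  qed
  then have "(\<Sum>x\<in>?V. 2 * pi / real (card (hyp_stabilizer G (?v x))))
      = (\<Sum>x\<in>?V. if x \<in> ?C then 2 * pi / 3 else 2 * pi)"
    by (rule sum.cong [OF refl])
  also have "\<dots> = real l * (2 * pi / 3) + (real (card ?V) - real l) * (2 * pi)"
  proof -
    have "?V \<inter> {x. x \<in> ?C} = ?C" "?V \<inter> - {x. x \<in> ?C} = ?V - ?C" using CV by blast+
    moreover have "real (card (?V - ?C)) = real (card ?V) - real l"
      using card_Diff_subset [OF finite_subset [OF CV finV] CV] card_mono [OF finV CV] l by simp
    ultimately show ?thesis using finV l by (simp add: sum.If_cases)
  qed
  finally have angles: "(\<Sum>x\<in>?V. 2 * pi / real (card (hyp_stabilizer G (?v x))))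
      = real l * (2 * pi / 3) + (real (card ?V) - real l) * (2 * pi)" .
  have "real (card ?V) = real (card ?E) + 1"
    using tree_graph_card [OF tree] by simp
  moreover have "hyp_area F = 2 * (real (card ?E) - 1) * pi
      - (\<Sum>x\<in>?V. 2 * pi / real (card (hyp_stabilizer G (?v x))))"
    by (rule hyp_area_orbifold [OF fin])
  ultimately show ?thesis
    unfolding angles by (simp add: field_simps)
qed

end
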